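(* Let $n\ge 1$ and let $X=C_n(\mathbb{R}^3)=\{(x_1,\dots,x_n)\in(\mathbb{R}^3)^n : x_i\neq x_j \text{ for } i\neq j\}$ be the configuration space of $n$ distinct ordered points in three-dimensional space. Then every motion planner in $X$ has order of instability at least $2n-1$, and there exists a motion planner in $X$ whose order of instability equals $2n-1$.
   Context: For a topological space $X$, let $PX$ be the space of all continuous paths $\gamma:[0,1]\to X$ with the compact-open topology, and let $\pi:PX\to X\times X$, $\pi(\gamma)=(\gamma(0),\gamma(1))$. A motion planner in $X$ is given by finitely many subsets $F_1,\dots,F_k\subset X\times X$ and continuous maps $s_i:F_i\to PX$ ($i=1,\dots,k$) such that: (a) the sets $F_1,\dots,F_k$ are pairwise disjoint and cover $X\times X$; (b) $\pi\circ s_i=1_{F_i}$ for every $i$; (c) each $F_i$ is an ENR (Euclidean neighbourhood retract). The order of instability of a motion planner is the largest integer $r$ such that there are indices $1\le i_1<i_2<\dots<i_r\le k$ with $\bar F_{i_1}\cap\bar F_{i_2}\cap\dots\cap\bar F_{i_r}\neq\emptyset$ (closures taken in $X\times X$). *)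

theory Defs
  imports "HOL-Analysis.Analysis"
begin

definition compact_open_topology :: "'a topology \<Rightarrow> 'b topology \<Rightarrow> ('a \<Rightarrow> 'b) topology" where
  "compact_open_topology X Y =
     topology_generated_by
       {{f \<in> topspace X \<rightarrow>\<^sub>E topspace Y. continuous_map X Y f \<and> f ` K \<subseteq> U} | K U.
          compactin X K \<and> openin Y U}"

lemma topspace_compact_open_topology:
  "topspace (compact_open_topology X Y) =
     {f \<in> topspace X \<rightarrow>\<^sub>E topspace Y. continuous_map X Y f}"
proof -
  have "compactin X {}" "openin Y {}"
    by auto
  then show ?thesis
    unfolding compact_open_topology_def topology_generated_by_topspace by blast
qed

text \<open>A path is a function on the reals that is undefined (extensional) outside the unit interval,
  so that the points of the path space are exactly the continuous maps from the interval.\<close>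

definition path_space :: "'a::topological_space set \<Rightarrow> (real \<Rightarrow> 'a) topology" where
  "path_space X = compact_open_topology (top_of_set {0..1}) (top_of_set X)"

lemma topspace_path_space:
  "topspace (path_space X) = {\<gamma> \<in> extensional {0..1}. path \<gamma> \<and> path_image \<gamma> \<subseteq> X}"
  by (auto simp: path_space_def topspace_compact_open_topology path_def path_image_def
      PiE_def Pi_def image_subset_iff)

definition endpoints :: "(real \<Rightarrow> 'a) \<Rightarrow> 'a::topological_space \<times> 'a" where
  "endpoints \<gamma> = (pathstart \<gamma>, pathfinish \<gamma>)"

text \<open>\<^const>\<open>ENR\<close> asks for a retraction from an open subset of the ambient Euclidean space, but for
  subsets of Euclidean spaces it is invariant under homeomorphism
  (theorem \<open>homeomorphic_ENR_iff_ENR\<close>), so it does not depend on the embedding.\<close>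

definition motion_planner ::
  "'a::euclidean_space set \<Rightarrow> nat \<Rightarrow> (nat \<Rightarrow> ('a \<times> 'a) set) \<Rightarrow> (nat \<Rightarrow> 'a \<times> 'a \<Rightarrow> real \<Rightarrow> 'a) \<Rightarrow> bool"
where
  "motion_planner X k F s \<longleftrightarrow>
     disjoint_family_on F {1..k} \<and>
     (\<Union>i\<in>{1..k}. F i) = X \<times> X \<and>
     (\<forall>i\<in>{1..k}.
        continuous_map (top_of_set (F i)) (path_space X) (s i) \<and>
        (\<forall>p\<in>F i. endpoints (s i p) = p) \<and>
        ENR (F i))"

text \<open>Increasing tuples of \<open>r\<close> indices are encoded as index sets of cardinality \<open>r\<close>.  The empty
  index set only contributes \<open>r = 0\<close>, so it has no effect on the maximum when \<open>X\<close> is nonempty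
  and covered.\<close>

definition order_of_instability ::
  "'a::topological_space set \<Rightarrow> nat \<Rightarrow> (nat \<Rightarrow> ('a \<times> 'a) set) \<Rightarrow> nat"
where
  "order_of_instability X k F =
     Max {card I | I. I \<subseteq> {1..k} \<and> (\<Inter>i\<in>I. top_of_set (X \<times> X) closure_of F i) \<noteq> {}}"

definition configuration_space :: "('a ^ 'n) set" where
  "configuration_space = {x. \<forall>i j. i \<noteq> j \<longrightarrow> x $ i \<noteq> x $ j}"

end

theory Submission
  imports Defs "HOL-Combinatorics.Permutations"
begin

text \<open>Lower bound: put one of the \<open>n\<close> points at the origin and let the other \<open>m = n - 1\<close> ones orbit around
  it at very different distances. This embeds \<open>(S\<^sup>2)\<^sup>m\<close> into the configuration space, and the
  directions from the first point to the others give a retraction. If the order of instability were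
  at most \<open>2 m\<close>, the product of two copies of \<open>(S\<^sup>2)\<^sup>m\<close> would be covered by \<open>2 m\<close> open sets over
  each of which the two projections are homotopic. With \<open>u\<^sub>j\<close> and \<open>v\<^sub>j\<close> the pullbacks of the
  generator of \<open>H\<^sup>2(S\<^sup>2)\<close> under the \<open>j\<close>-th coordinates of the two projections, each \<open>u\<^sub>j - v\<^sub>j\<close> vanishes
  on all these sets, so the product of all \<open>(u\<^sub>j - v\<^sub>j)\<^sup>2 = - 2 u\<^sub>j v\<^sub>j\<close> is zero; but it
  is a nonzero multiple of the top class. Cohomology is realised by Alexander-Spanier cochains, that
  is, functions of tuples of nearby points, and the top class is detected on a fine Kuhn
  triangulation of a torus of dimension \<open>4 m\<close> that is mapped to the product with degree one.

  Upper bound: classify configurations by the number of distinct first coordinates (heights). A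
  configuration is moved along a straight line to a standard one that refines its order of heights,
  and standard configurations are joined by straight lines. This is continuous as long as the order of
  heights is locally constant, which is the case on the set of pairs where the total number of
  heights has a given value between \<open>2\<close> and \<open>2 n\<close>.\<close>

section \<open>Cochains on tuples\<close>

text \<open>The planner gives sections only over the sets \<open>F i\<close>, which need not be
  open. Since \<open>F i\<close> is an ENR, a retraction of a neighbourhood carries the section
  there, but its paths then join points that are merely near the given ones. This error is kept
  small against the scale 1/4 on which the cocycles of the sphere behave well, and is absorbed by
  one more comparison of maps. If at most r closures meet at a point, the neighbourhoods can be
  given multiplicity at most r and be sorted into r families of disjoint sets, however many
  \<open>F i\<close> there are.

  Tuples of nearby points suit this situation because cochains are arbitrary integer functions: a
  primitive found over one covering set is at once a function on all pairs. Subtracting its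
  coboundary makes one factor vanish on the small tuples in that set, so a product with one factor
  for each set vanishes on all small tuples.

  The relation u^2 = 0 is needed for functions, not just for classes; hence each square uses two
  representatives of the generator, supported near opposite poles.\<close>

definition face :: "nat \<Rightarrow> (nat \<Rightarrow> 'a) \<Rightarrow> nat \<Rightarrow> 'a" where
  "face k x = (\<lambda>l. if l < k then x l else x (Suc l))"

definition coboundary :: "nat \<Rightarrow> ((nat \<Rightarrow> 'a) \<Rightarrow> int) \<Rightarrow> (nat \<Rightarrow> 'a) \<Rightarrow> int" where
  "coboundary p \<phi> x = (\<Sum>k\<le>Suc p. (-1) ^ k * \<phi> (face k x))"

definition cup :: "nat \<Rightarrow> ((nat \<Rightarrow> 'a) \<Rightarrow> int) \<Rightarrow> ((nat \<Rightarrow> 'a) \<Rightarrow> int) \<Rightarrow> (nat \<Rightarrow> 'a) \<Rightarrow> int" where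
  "cup p \<alpha> \<beta> x = \<alpha> x * \<beta> (\<lambda>k. x (k + p))"

text \<open>Tuples are total functions on \<open>nat\<close>, so that faces and shifts need no
  lengths. The degree is recovered by letting only the entries 0 to p matter.\<close>

definition cochain :: "nat \<Rightarrow> ((nat \<Rightarrow> 'a) \<Rightarrow> int) \<Rightarrow> bool" where
  "cochain p \<alpha> \<longleftrightarrow> (\<forall>x y. (\<forall>k\<le>p. x k = y k) \<longrightarrow> \<alpha> x = \<alpha> y)"

lemma cochainD: "cochain p \<alpha> \<Longrightarrow> (\<And>k. k \<le> p \<Longrightarrow> x k = y k) \<Longrightarrow> \<alpha> x = \<alpha> y"
  by (auto simp: cochain_def)

lemma cochain_cup:
  assumes "cochain p \<alpha>" "cochain q \<beta>"
  shows "cochain (p + q) (cup p \<alpha> \<beta>)"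
  unfolding cochain_def cup_def
proof (intro allI impI)
  fix x y :: "nat \<Rightarrow> 'a"
  assume "\<forall>k\<le>p + q. x k = y k"
  then have "\<alpha> x = \<alpha> y" "\<beta> (\<lambda>k. x (k + p)) = \<beta> (\<lambda>k. y (k + p))"
    by (auto intro!: cochainD[OF assms(1)] cochainD[OF assms(2)])
  then show "\<alpha> x * \<beta> (\<lambda>k. x (k + p)) = \<alpha> y * \<beta> (\<lambda>k. y (k + p))"
    by simp
qed

text \<open>The Leibniz rule. Faces with index at most p affect only the first factor, later ones
  only the second. The right-hand side contains two further terms, from the last face of the first
  factor and the face 0 of the second; they agree up to sign and cancel.\<close>

lemma coboundary_cup:
  assumes \<alpha>: "cochain p \<alpha>"
  shows "coboundary (p + q) (cup p \<alpha> \<beta>) x =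
         cup (Suc p) (coboundary p \<alpha>) \<beta> x + (-1) ^ p * cup p \<alpha> (coboundary q \<beta>) x"
proof -
  let ?\<beta>p = "\<beta> (\<lambda>l. x (l + Suc p))"
  have low: "cup p \<alpha> \<beta> (face k x) = \<alpha> (face k x) * ?\<beta>p" if "k \<le> p" for k
    using that by (simp add: cup_def face_def)
  have high: "cup p \<alpha> \<beta> (face (k + p) x) = \<alpha> x * \<beta> (face k (\<lambda>l. x (l + p)))" if "0 < k" for k
  proof -
    have "\<alpha> (face (k + p) x) = \<alpha> x"
      using that by (intro cochainD[OF \<alpha>]) (auto simp: face_def)
    then show ?thesis
      by (simp add: cup_def face_def add.commute cong: if_cong)
  qed
  have face_p: "\<alpha> (face (Suc p) x) = \<alpha> x"
    by (intro cochainD[OF \<alpha>]) (auto simp: face_def)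
  have mid2: "\<beta> (face 0 (\<lambda>l. x (l + p))) = ?\<beta>p"
    by (simp add: face_def)
  have "coboundary (p + q) (cup p \<alpha> \<beta>) x =
        (\<Sum>k\<le>p. (-1) ^ k * cup p \<alpha> \<beta> (face k x)) +
        (\<Sum>k=Suc p..Suc (p + q). (-1) ^ k * cup p \<alpha> \<beta> (face k x))"
  proof -
    have "{..Suc (p + q)} = {..p} \<union> {Suc p..Suc (p + q)}"
      by auto
    then show ?thesis
      unfolding coboundary_def by (simp only:) (subst sum.union_disjoint, auto)
  qed
  also have "(\<Sum>k=Suc p..Suc (p + q). (-1) ^ k * cup p \<alpha> \<beta> (face k x)) =
     (\<Sum>k=1..Suc q. (-1) ^ (k + p) * cup p \<alpha> \<beta> (face (k + p) x))"
    using sum.shift_bounds_cl_nat_ivl[of "\<lambda>k. (-1) ^ k * cup p \<alpha> \<beta> (face k x)" 1 p "Suc q"]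
    by (simp add: add.commute)
  also have "\<dots> = (\<Sum>k=1..Suc q. (-1) ^ p * \<alpha> x * ((-1) ^ k * \<beta> (face k (\<lambda>l. x (l + p)))))"
    by (intro sum.cong) (auto simp: high power_add)
  also have "\<dots> = (-1) ^ p * \<alpha> x * (coboundary q \<beta> (\<lambda>l. x (l + p)) - ?\<beta>p)"
  proof -
    have "{..Suc q} = insert 0 {1..Suc q}"
      by auto
    then show ?thesis
      unfolding coboundary_def sum_distrib_left [symmetric] mid2 [symmetric] by simp
  qed
  also have "(\<Sum>k\<le>p. (-1) ^ k * cup p \<alpha> \<beta> (face k x)) =
     (\<Sum>k\<le>p. (-1) ^ k * \<alpha> (face k x)) * ?\<beta>p"
    by (simp add: low sum_distrib_right mult.assoc)
  also have "(\<Sum>k\<le>p. (-1) ^ k * \<alpha> (face k x)) =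
      coboundary p \<alpha> x - (-1) ^ Suc p * \<alpha> (face (Suc p) x)"
    by (simp add: coboundary_def)
  finally show ?thesis
    by (simp add: cup_def[of _ _ _ x] face_p algebra_simps)
qed

section \<open>Walks and the fundamental cycle of a discrete torus\<close>

primrec walk :: "('b \<Rightarrow> 'a \<Rightarrow> 'a) \<Rightarrow> (nat \<Rightarrow> 'b) \<Rightarrow> 'a \<Rightarrow> nat \<Rightarrow> 'a" where
  "walk T \<pi> x 0 = x"
| "walk T \<pi> x (Suc k) = T (\<pi> k) (walk T \<pi> x k)"

lemma walk_cong: "(\<And>l. l < k \<Longrightarrow> \<pi> l = \<rho> l) \<Longrightarrow> walk T \<pi> x k = walk T \<rho> x k"
  by (induction k) auto

lemma walk_shift: "(\<And>l. l < k \<Longrightarrow> \<rho> l = \<pi> (Suc l)) \<Longrightarrow> walk T \<rho> (T (\<pi> 0) x) k = walk T \<pi> x (Suc k)"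
  by (induction k) auto

lemma sign_cycle:
  fixes n :: nat
  defines "c \<equiv> \<lambda>n l. if l < n then Suc l else if l = n then 0 else l"
  shows "c n permutes {..n} \<and> sign (c n) = (-1) ^ n"
proof (induction n)
  case 0
  have "c 0 = id"
    by (auto simp: c_def fun_eq_iff)
  then show ?case
    by (simp only: permutes_id sign_id) simp
next
  case (Suc n)
  have eq: "c (Suc n) = Transposition.transpose 0 (Suc n) \<circ> c n"
    by (auto simp: c_def fun_eq_iff Transposition.transpose_def)
  have 1: "c n permutes {..Suc n}"
    using Suc by (auto intro: permutes_subset)
  have 2: "Transposition.transpose 0 (Suc n) permutes {..Suc n}"
    by (simp add: permutes_swap_id)
  have "sign (Transposition.transpose 0 (Suc n) \<circ> c n) = sign (Transposition.transpose 0 (Suc n)) * sign (c n)"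
    using 1 2 by (intro sign_compose) (auto simp: permutation_permutes)
  then show ?case
    using permutes_compose[OF 1 2] Suc unfolding eq by (simp add: sign_swap_id del: comp_apply)
qed

text \<open>Evaluation on the fundamental cycle of a discrete torus: \<open>T c\<close> is a unit step in
  direction \<open>c\<close>, and the walks from a grid point in all orders of the directions are the simplices
  of the Kuhn triangulation of a cube, signed by the order.\<close>

definition chain_eval :: "'a set \<Rightarrow> (nat \<Rightarrow> 'a \<Rightarrow> 'a) \<Rightarrow> nat \<Rightarrow> ((nat \<Rightarrow> 'a) \<Rightarrow> int) \<Rightarrow> int" where
  "chain_eval G T N \<phi> = (\<Sum>x\<in>G. \<Sum>\<pi> | \<pi> permutes {..<N}. sign \<pi> * \<phi> (walk T \<pi> x))"

locale torus_grid =
  fixes G :: "'a set" and T :: "nat \<Rightarrow> 'a \<Rightarrow> 'a" and N :: nat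
  assumes bij: "\<And>c. c < N \<Longrightarrow> bij_betw (T c) G G"
    and comm: "\<And>c d x. c < N \<Longrightarrow> d < N \<Longrightarrow> x \<in> G \<Longrightarrow> T c (T d x) = T d (T c x)"
begin

lemma walk_in:
  assumes "\<pi> permutes {..<N}" "x \<in> G" "k \<le> N"
  shows "walk T \<pi> x k \<in> G"
  using assms(3)
proof (induction k)
  case (Suc k)
  then have "\<pi> k < N"
    using permutes_in_image[OF assms(1), of k] by simp
  from bij_betwE[OF bij[OF this]] Suc show ?case
    by auto
qed (simp add: assms)

text \<open>Because the steps commute, two orders that differ by an adjacent exchange give simplices
  with a common face, opposite to the vertex between the two steps. This pairs the inner faces of
  the chain.\<close>

lemma walk_transpose:
  assumes \<pi>: "\<pi> permutes {..<N}" and x: "x \<in> G" and k: "0 < k" "k < N" and "l \<noteq> k" "l \<le> N"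
  shows "walk T (\<pi> \<circ> Transposition.transpose (k - 1) k) x l = walk T \<pi> x l"
proof (cases "l < k")
  case True
  then show ?thesis
    by (intro walk_cong) (auto simp: Transposition.transpose_def)
next
  case False
  with \<open>l \<noteq> k\<close> have "Suc k \<le> l"
    by simp
  then show ?thesis
    using \<open>l \<le> N\<close>
  proof (induction l rule: dec_induct)
    case base
    obtain j where j: "k = Suc j"
      using k(1) by (cases k) auto
    have less: "\<pi> j < N" "\<pi> k < N"
      using permutes_in_image[OF \<pi>] k j by auto
    have "walk T (\<pi> \<circ> Transposition.transpose (k - 1) k) x j = walk T \<pi> x j"
      by (intro walk_cong) (auto simp: Transposition.transpose_def j)
    then show ?case
      using comm[OF less walk_in[OF \<pi> x, of j]] k by (simp add: j del: comp_apply) simp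
  next
    case (step l)
    then have "(\<pi> \<circ> Transposition.transpose (k - 1) k) l = \<pi> l"
      by (auto simp: Transposition.transpose_def)
    with step show ?case
      by (simp del: comp_apply)
  qed
qed

text \<open>Stokes on a closed torus. Inner faces cancel in pairs, since an adjacent exchange keeps
  the face and reverses the sign. The outer faces cancel between neighbouring cubes, because a step
  is a bijection of the grid.\<close>

lemma chain_eval_coboundary:
  assumes \<psi>: "cochain p \<psi>" and N: "N = Suc p"
  shows "chain_eval G T N (coboundary p \<psi>) = 0"
proof -
  let ?P = "{\<pi>. \<pi> permutes {..<N}}"
  define E where "E k = (\<Sum>x\<in>G. \<Sum>\<pi>\<in>?P. sign \<pi> * \<psi> (face k (walk T \<pi> x)))" for k
  have inner: "E k = 0" if k: "0 < k" "k < N" for k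
    unfolding E_def
  proof (rule sum.neutral, rule ballI)
    fix x assume x: "x \<in> G"
    define t where "t = Transposition.transpose (k - 1) k"
    have t: "t permutes {..<N}"
      using k unfolding t_def by (intro permutes_swap_id) auto
    let ?f = "\<lambda>\<pi>. sign \<pi> * \<psi> (face k (walk T \<pi> x))"
    have "sum ?f ?P = (\<Sum>\<pi>\<in>?P. ?f (\<pi> \<circ> t))"
      using sum_permutations_compose_right[OF t] by blast
    also have "\<dots> = (\<Sum>\<pi>\<in>?P. - ?f \<pi>)"
    proof (intro sum.cong refl)
      fix \<pi> assume "\<pi> \<in> ?P"
      then have \<pi>: "\<pi> permutes {..<N}"
        by simp
      have "sign (\<pi> \<circ> t) = sign \<pi> * sign t"
        using \<pi> t by (intro sign_compose) (auto simp: permutation_permutes)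
      then have s: "sign (\<pi> \<circ> t) = - sign \<pi>"
        using k by (simp add: t_def sign_swap_id)
      have "\<psi> (face k (walk T (\<pi> \<circ> t) x)) = \<psi> (face k (walk T \<pi> x))"
        unfolding t_def face_def using N
        by (intro cochainD[OF \<psi>]) (auto intro!: walk_transpose[OF \<pi> x k, simplified] simp del: walk.simps comp_apply)
      then show "?f (\<pi> \<circ> t) = - ?f \<pi>"
        by (simp add: s)
    qed
    also have "\<dots> = - sum ?f ?P"
      by (simp add: sum_negf)
    finally show "sum ?f ?P = 0"
      by simp
  qed
  \<comment> \<open>Rotating the order by one place: the face 0 of the simplex of \<pi> at x is the
    last face of the simplex of \<open>\<pi> \<circ> c\<close> that starts at
    \<open>T (\<pi> 0) x\<close>.\<close>
  define c where "c = (\<lambda>l. if l < p then Suc l else if l = p then 0 else l)"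
  have c: "c permutes {..<N}" "sign c = (-1) ^ p"
    using sign_cycle[of p] by (simp_all add: c_def N lessThan_Suc_atMost)
  have "E N = (\<Sum>\<pi>\<in>?P. \<Sum>x\<in>G. sign \<pi> * \<psi> (walk T \<pi> x))"
    unfolding E_def
    by (subst sum.swap, intro sum.cong refl arg_cong2[where f = "(*)"] cochainD[OF \<psi>])
       (auto simp: face_def N)
  also have "\<dots> = (\<Sum>\<pi>\<in>?P. \<Sum>x\<in>G. sign (\<pi> \<circ> c) * \<psi> (walk T (\<pi> \<circ> c) x))"
    using sum_permutations_compose_right[OF c(1)] by blast
  also have "\<dots> = (\<Sum>\<pi>\<in>?P. \<Sum>x\<in>G. (-1) ^ p * (sign \<pi> * \<psi> (face 0 (walk T \<pi> x))))"
  proof (rule sum.cong[OF refl])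
    fix \<pi> assume "\<pi> \<in> ?P"
    then have \<pi>: "\<pi> permutes {..<N}"
      by simp
    have s: "sign (\<pi> \<circ> c) = (-1) ^ p * sign \<pi>"
      using \<pi> c by (subst sign_compose) (auto simp: permutation_permutes)
    have "\<pi> 0 < N"
      using permutes_in_image[OF \<pi>] N by auto
    from sum.reindex_bij_betw[OF bij[OF this], of "\<lambda>x. sign (\<pi> \<circ> c) * \<psi> (walk T (\<pi> \<circ> c) x)"]
    have "(\<Sum>x\<in>G. sign (\<pi> \<circ> c) * \<psi> (walk T (\<pi> \<circ> c) x)) =
          (\<Sum>x\<in>G. sign (\<pi> \<circ> c) * \<psi> (walk T (\<pi> \<circ> c) (T (\<pi> 0) x)))"
      by simp
    also have "\<dots> = (\<Sum>x\<in>G. (-1) ^ p * (sign \<pi> * \<psi> (face 0 (walk T \<pi> x))))"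
    proof (intro sum.cong refl)
      fix x assume "x \<in> G"
      have "\<psi> (walk T (\<pi> \<circ> c) (T (\<pi> 0) x)) = \<psi> (face 0 (walk T \<pi> x))"
      proof (rule cochainD[OF \<psi>])
        fix k assume "k \<le> p"
        then have "walk T (\<pi> \<circ> c) (T (\<pi> 0) x) k = walk T \<pi> x (Suc k)"
          by (intro walk_shift) (auto simp: c_def)
        then show "walk T (\<pi> \<circ> c) (T (\<pi> 0) x) k = face 0 (walk T \<pi> x) k"
          by (simp add: face_def)
      qed
      then show "sign (\<pi> \<circ> c) * \<psi> (walk T (\<pi> \<circ> c) (T (\<pi> 0) x)) =
          (-1) ^ p * (sign \<pi> * \<psi> (face 0 (walk T \<pi> x)))"
        by (simp add: s)
    qed
    finally show "(\<Sum>x\<in>G. sign (\<pi> \<circ> c) * \<psi> (walk T (\<pi> \<circ> c) x)) = \<dots>" .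
  qed
  also have "\<dots> = (-1) ^ p * E 0"
    unfolding E_def by (subst sum.swap) (simp add: sum_distrib_left)
  finally have EN: "E N = (-1) ^ p * E 0" .
  have "chain_eval G T N (coboundary p \<psi>) =
     (\<Sum>x\<in>G. \<Sum>\<pi>\<in>?P. \<Sum>k\<le>N. (-1) ^ k * (sign \<pi> * \<psi> (face k (walk T \<pi> x))))"
    by (simp add: chain_eval_def coboundary_def N sum_distrib_left mult.left_commute mult.assoc del: sum.atMost_Suc)
  also have "\<dots> = (\<Sum>k\<le>N. \<Sum>x\<in>G. \<Sum>\<pi>\<in>?P. (-1) ^ k * (sign \<pi> * \<psi> (face k (walk T \<pi> x))))"
    by (subst sum.swap) (simp add: sum.swap[of _ "{..N}" ?P] sum.swap[of _ "{..N}" G])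
  also have "\<dots> = (\<Sum>k\<le>N. (-1) ^ k * E k)"
    by (simp add: E_def sum_distrib_left)
  also have "\<dots> = (\<Sum>k\<in>{0, N}. (-1) ^ k * E k)"
    by (intro sum.mono_neutral_right) (use inner in auto)
  also have "\<dots> = 0"
    using EN N by (simp add: flip: mult.assoc power_add)
  finally show ?thesis .
qed

end

section \<open>Cup products of cochains of degree two\<close>

text \<open>The iterated cup product of M cochains of degree 2, each written as a function of three
  points; neighbouring factors share a vertex.\<close>

definition triple_cup :: "nat \<Rightarrow> (nat \<Rightarrow> 'a \<Rightarrow> 'a \<Rightarrow> 'a \<Rightarrow> int) \<Rightarrow> (nat \<Rightarrow> 'a) \<Rightarrow> int" where
  "triple_cup M a X = (\<Prod>i<M. a i (X (2 * i)) (X (2 * i + 1)) (X (2 * i + 2)))"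

text \<open>The identity is demanded on small tuples only, as for Alexander-Spanier cocycles; the
  cocycles of the sphere used below satisfy it only there.\<close>

definition cocycle_on :: "('a set \<Rightarrow> bool) \<Rightarrow> ('a \<Rightarrow> 'a \<Rightarrow> 'a \<Rightarrow> int) \<Rightarrow> bool" where
  "cocycle_on sm c \<longleftrightarrow>
     (\<forall>p q r s. sm {p, q, r, s} \<longrightarrow> c q r s - c p r s + c p q s - c p q r = 0)"

definition bd1 :: "('a \<Rightarrow> 'a \<Rightarrow> int) \<Rightarrow> 'a \<Rightarrow> 'a \<Rightarrow> 'a \<Rightarrow> int" where
  "bd1 b x y z = b y z - b x z + b x y"

lemma cocycle_on_diff_bd1: "cocycle_on sm c \<Longrightarrow> cocycle_on sm (\<lambda>x y z. c x y z - bd1 b x y z)"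
  by (force simp: cocycle_on_def bd1_def)

lemma cochain_triple_cup: "cochain (2 * M) (triple_cup M a)"
  unfolding cochain_def triple_cup_def
proof (intro allI impI prod.cong refl)
  fix X Y :: "nat \<Rightarrow> 'a" and i
  assume "\<forall>k\<le>2 * M. X k = Y k" "i \<in> {..<M}"
  then show "a i (X (2 * i)) (X (2 * i + 1)) (X (2 * i + 2)) =
      a i (Y (2 * i)) (Y (2 * i + 1)) (Y (2 * i + 2))"
    by auto
qed

lemma triple_cup_add:
  "triple_cup (j + k) a X = cup (2 * j) (triple_cup j a) (triple_cup k (\<lambda>i. a (j + i))) X"
proof -
  define f where "f i = a i (X (2 * i)) (X (2 * i + 1)) (X (2 * i + 2))" for i
  have split: "{..<j + k} = {..<j} \<union> {j..<j + k}"
    by auto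
  have "prod f {..<j + k} = prod f {..<j} * prod f {j..<j + k}"
    unfolding split by (rule prod.union_disjoint) auto
  also have "prod f {j..<j + k} = (\<Prod>i<k. f (j + i))"
    using prod.shift_bounds_nat_ivl[of f 0 j k] by (simp add: lessThan_atLeast0 add.commute)
  finally show ?thesis
    unfolding triple_cup_def cup_def f_def by (simp add: algebra_simps)
qed

locale small_sets =
  fixes sm :: "'a set \<Rightarrow> bool"
  assumes mono: "\<And>A B. sm A \<Longrightarrow> B \<subseteq> A \<Longrightarrow> sm B"
begin

lemma coboundary_triple_cup:
  assumes "\<And>i. i < M \<Longrightarrow> cocycle_on sm (a i)" and "sm (X ` {..Suc (2 * M)})"
  shows "coboundary (2 * M) (triple_cup M a) X = 0"
  using assms
proof (induction M)
  case 0
  then show ?case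
    by (simp add: coboundary_def triple_cup_def)
next
  case (Suc M)
  let ?c = "triple_cup 1 (\<lambda>i. a (M + i))"
  have 1: "coboundary (2 * M) (triple_cup M a) X = 0"
    using Suc.prems by (intro Suc.IH) (auto elim!: mono)
  have "sm {X (2 * M), X (Suc (2 * M)), X (Suc (Suc (2 * M))), X (Suc (Suc (Suc (2 * M))))}"
    using Suc.prems(2) by (rule mono) auto
  moreover have "cocycle_on sm (a M)"
    using Suc.prems by simp
  ultimately have 2: "coboundary 2 ?c (\<lambda>k. X (k + 2 * M)) = 0"
    by (auto simp: coboundary_def triple_cup_def face_def cocycle_on_def numeral_2_eq_2)
  have eq: "triple_cup (Suc M) a = cup (2 * M) (triple_cup M a) ?c"
    using triple_cup_add[of M 1 a] by (auto simp: fun_eq_iff)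
  have "2 * Suc M = 2 * M + 2"
    by simp
  then show ?case
    using coboundary_cup[OF cochain_triple_cup, of M 2 a ?c X] 1 2
    by (simp only: eq) (simp add: cup_def)
qed

text \<open>The primitive is the same product with b in place of its coboundary. In the Leibniz rule
  every other term contains the coboundary of a product of cocycles, and no sign remains because the
  factors in front of b have even total degree.\<close>

lemma triple_cup_exact:
  assumes j: "j < M" and a: "\<And>i. i < M \<Longrightarrow> i \<noteq> j \<Longrightarrow> cocycle_on sm (a i)" and "a j = bd1 b"
  shows "\<exists>\<psi>. cochain (2 * M - 1) \<psi> \<and>
     (\<forall>X. sm (X ` {..2 * M}) \<longrightarrow> coboundary (2 * M - 1) \<psi> X = triple_cup M a X)"
proof -
  define k where "k = M - Suc j"
  define b' where "b' = (\<lambda>X :: nat \<Rightarrow> 'a. b (X 0) (X 1))"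
  define \<beta> where "\<beta> = triple_cup k (\<lambda>i. a (Suc j + i))"
  define \<psi> where "\<psi> = cup (2 * j) (triple_cup j a) (cup 1 b' \<beta>)"
  have M: "M = j + Suc k" "2 * M - 1 = 2 * j + (1 + 2 * k)"
    using j by (auto simp: k_def)
  have b': "cochain 1 b'"
    by (simp add: cochain_def b'_def)
  have "cochain (2 * M - 1) \<psi>"
    unfolding \<psi>_def M(2) \<beta>_def by (intro cochain_cup cochain_triple_cup b')
  moreover have "coboundary (2 * M - 1) \<psi> X = triple_cup M a X" if X: "sm (X ` {..2 * M})" for X
  proof -
    have 1: "coboundary (2 * j) (triple_cup j a) X = 0"
      using j by (intro coboundary_triple_cup a mono[OF X]) auto
    have 2: "coboundary (2 * k) \<beta> (\<lambda>l. X (Suc (l + 2 * j))) = 0"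
      unfolding \<beta>_def using M(1)
      by (intro coboundary_triple_cup a mono[OF X]) auto
    have 3: "coboundary (Suc 0) b' Y = a j (Y 0) (Y 1) (Y 2)" for Y
      by (simp add: coboundary_def b'_def face_def assms(3) bd1_def numeral_2_eq_2)
    have "triple_cup (Suc k) (\<lambda>i. a (j + i)) Y =
        cup 2 (triple_cup 1 (\<lambda>i. a (j + i))) \<beta> Y" for Y
      using triple_cup_add[of 1 k "\<lambda>i. a (j + i)" Y] by (simp add: \<beta>_def)
    then have 4: "triple_cup (Suc k) (\<lambda>i. a (j + i)) Y =
        a j (Y 0) (Y 1) (Y 2) * \<beta> (\<lambda>l. Y (Suc (Suc l)))" for Y
      by (simp add: cup_def[of _ _ _ Y] triple_cup_def[of "Suc 0"] numeral_2_eq_2)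
    have "coboundary (2 * M - 1) \<psi> X =
        triple_cup j a X * coboundary (1 + 2 * k) (cup 1 b' \<beta>) (\<lambda>l. X (l + 2 * j))"
      unfolding M(2) \<psi>_def
      by (subst coboundary_cup[OF cochain_triple_cup]) (simp add: cup_def[of _ _ _ X] 1)
    also have "coboundary (1 + 2 * k) (cup 1 b' \<beta>) (\<lambda>l. X (l + 2 * j)) =
        a j (X (2 * j)) (X (2 * j + 1)) (X (2 * j + 2)) * \<beta> (\<lambda>l. X (l + 2 * j + 2))"
      by (subst coboundary_cup[OF b'])
         (use 2 in \<open>simp add: cup_def[of _ _ _ "\<lambda>l. X (l + 2 * j)"] 3 add.commute\<close>)
    also have "triple_cup j a X * \<dots> = triple_cup M a X"
    proof -
      have "triple_cup M a X = triple_cup j a X * triple_cup (Suc k) (\<lambda>i. a (j + i)) (\<lambda>l. X (l + 2 * j))"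
        unfolding M(1) by (subst triple_cup_add) (rule cup_def)
      then show ?thesis
        by (simp only: 4) (simp add: add.commute)
    qed
    finally show ?thesis .
  qed
  ultimately show ?thesis
    by blast
qed

end

section \<open>Evaluating products on a finely mapped torus\<close>

locale small_torus = torus_grid G T N + small_sets sm
  for G :: "'a set" and T N and sm :: "'z set \<Rightarrow> bool" +
  fixes \<Gamma> :: "'a \<Rightarrow> 'z" and M :: nat
  assumes N: "N = 2 * M"
    and small: "\<And>x \<pi>. x \<in> G \<Longrightarrow> \<pi> permutes {..<N} \<Longrightarrow> sm ((\<Gamma> \<circ> walk T \<pi> x) ` {..N})"
begin

lemma chain_eval_exact:
  assumes "j < M" and "\<And>i. i < M \<Longrightarrow> i \<noteq> j \<Longrightarrow> cocycle_on sm (a i)" and "a j = bd1 b"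
  shows "chain_eval G T N (\<lambda>X. triple_cup M a (\<Gamma> \<circ> X)) = 0"
proof -
  obtain \<psi> where \<psi>: "cochain (2 * M - 1) \<psi>"
     "\<And>X. sm (X ` {..2 * M}) \<Longrightarrow> coboundary (2 * M - 1) \<psi> X = triple_cup M a X"
    using triple_cup_exact[of j M a b, OF assms] by blast
  let ?\<psi> = "\<lambda>X. \<psi> (\<Gamma> \<circ> X)"
  have face: "\<Gamma> \<circ> face k X = face k (\<Gamma> \<circ> X)" for k and X :: "nat \<Rightarrow> 'a"
    by (auto simp: face_def)
  have "chain_eval G T N (\<lambda>X. triple_cup M a (\<Gamma> \<circ> X)) =
        chain_eval G T N (coboundary (2 * M - 1) ?\<psi>)"
    unfolding chain_eval_def
  proof (intro sum.cong refl arg_cong2[where f = "(*)"])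
    fix x \<pi> assume "x \<in> G" "\<pi> \<in> {\<pi>. \<pi> permutes {..<N}}"
    then have "triple_cup M a (\<Gamma> \<circ> walk T \<pi> x) = coboundary (2 * M - 1) \<psi> (\<Gamma> \<circ> walk T \<pi> x)"
      using small[of x \<pi>] by (intro \<psi>(2)[symmetric]) (simp add: N)
    then show "triple_cup M a (\<Gamma> \<circ> walk T \<pi> x) = coboundary (2 * M - 1) ?\<psi> (walk T \<pi> x)"
      by (simp add: coboundary_def face)
  qed
  also have "\<dots> = 0"
    using \<open>j < M\<close> \<psi>(1) by (intro chain_eval_coboundary) (auto simp: N cochain_def)
  finally show ?thesis .
qed

text \<open>The factors are replaced one at a time. Each replacement changes the product by a
  product with one exact factor, on which the cycle evaluates to zero.\<close>

lemma chain_eval_cohomologous: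
  assumes "\<And>i. i < M \<Longrightarrow> cocycle_on sm (a i)"
  shows "chain_eval G T N (\<lambda>X. triple_cup M a (\<Gamma> \<circ> X)) =
         chain_eval G T N (\<lambda>X. triple_cup M (\<lambda>i x y z. a i x y z - bd1 (b i) x y z) (\<Gamma> \<circ> X))"
proof -
  define a' where "a' l i = (if i < l then (\<lambda>x y z. a i x y z - bd1 (b i) x y z) else a i)" for l i
  have coc: "cocycle_on sm (a' l i)" if "i < M" for l i
    using assms that cocycle_on_diff_bd1 by (auto simp: a'_def)
  have *: "chain_eval G T N (\<lambda>X. triple_cup M a (\<Gamma> \<circ> X)) =
        chain_eval G T N (\<lambda>X. triple_cup M (a' l) (\<Gamma> \<circ> X))" if "l \<le> M" for l
    using that
  proof (induction l)
    case 0
    have "a' 0 = a"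
      by (rule ext) (simp add: a'_def)
    then show ?case
      by (simp only:)
  next
    case (Suc l)
    let ?e = "(a' l) (l := bd1 (b l))"
    have lin: "triple_cup M (a' (Suc l)) X = triple_cup M (a' l) X - triple_cup M ?e X" for X
    proof -
      have *: "triple_cup M f X = f l (X (2 * l)) (X (2 * l + 1)) (X (2 * l + 2)) *
         (\<Prod>i\<in>{..<M} - {l}. f i (X (2 * i)) (X (2 * i + 1)) (X (2 * i + 2)))" for f
        unfolding triple_cup_def using Suc.prems by (intro prod.remove) auto
      have 1: "(\<Prod>i\<in>{..<M} - {l}. a' (Suc l) i (X (2 * i)) (X (2 * i + 1)) (X (2 * i + 2))) =
            (\<Prod>i\<in>{..<M} - {l}. a' l i (X (2 * i)) (X (2 * i + 1)) (X (2 * i + 2)))"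
        by (intro prod.cong) (auto simp: a'_def)
      have 2: "(\<Prod>i\<in>{..<M} - {l}. ?e i (X (2 * i)) (X (2 * i + 1)) (X (2 * i + 2))) =
            (\<Prod>i\<in>{..<M} - {l}. a' l i (X (2 * i)) (X (2 * i + 1)) (X (2 * i + 2)))"
        by (intro prod.cong) auto
      show ?thesis
        unfolding * 1 2 by (simp add: a'_def algebra_simps)
    qed
    have "chain_eval G T N (\<lambda>X. triple_cup M ?e (\<Gamma> \<circ> X)) = 0"
      using Suc.prems coc by (intro chain_eval_exact[where j = l and b = "b l"]) auto
    moreover have "chain_eval G T N (\<lambda>X. triple_cup M (a' (Suc l)) (\<Gamma> \<circ> X)) =
        chain_eval G T N (\<lambda>X. triple_cup M (a' l) (\<Gamma> \<circ> X)) -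
        chain_eval G T N (\<lambda>X. triple_cup M ?e (\<Gamma> \<circ> X))"
      by (simp only: lin chain_eval_def right_diff_distrib sum_subtractf)
    ultimately show ?case
      using Suc.IH Suc.prems by linarith
  qed
  have eq: "triple_cup M (a' M) = triple_cup M (\<lambda>i x y z. a i x y z - bd1 (b i) x y z)"
  proof (rule ext)
    fix X :: "nat \<Rightarrow> 'z"
    show "triple_cup M (a' M) X = triple_cup M (\<lambda>i x y z. a i x y z - bd1 (b i) x y z) X"
      unfolding triple_cup_def
    proof (rule prod.cong[OF refl])
      fix i assume "i \<in> {..<M}"
      then have "a' M i = (\<lambda>x y z. a i x y z - bd1 (b i) x y z)"
        by (simp add: a'_def)
      then show "a' M i (X (2 * i)) (X (2 * i + 1)) (X (2 * i + 2)) =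
         a i (X (2 * i)) (X (2 * i + 1)) (X (2 * i + 2)) -
         bd1 (b i) (X (2 * i)) (X (2 * i + 1)) (X (2 * i + 2))"
        by simp
    qed
  qed
  show ?thesis
    using *[OF order_refl] unfolding eq .
qed

text \<open>The usual argument that the cup length bounds the size of a cover. After the corrections
  by \<open>bd1 (b i)\<close>, the factor i vanishes on simplices inside \<open>C i\<close>, and
  every simplex of the cycle lies in some \<open>C i\<close>.\<close>

lemma chain_eval_eq_0:
  assumes "\<And>i. i < M \<Longrightarrow> cocycle_on sm (a i)"
    and "\<And>i x y z. i < M \<Longrightarrow> sm {x, y, z} \<Longrightarrow> {x, y, z} \<subseteq> C i \<Longrightarrow> a i x y z = bd1 (b i) x y z"
    and cover: "\<And>S. sm S \<Longrightarrow> S \<noteq> {} \<Longrightarrow> \<exists>i<M. S \<subseteq> C i"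
  shows "chain_eval G T N (\<lambda>X. triple_cup M a (\<Gamma> \<circ> X)) = 0"
proof -
  have 0: "triple_cup M (\<lambda>i x y z. a i x y z - bd1 (b i) x y z) (\<Gamma> \<circ> walk T \<pi> x) = 0"
    if x: "x \<in> G" "\<pi> permutes {..<N}" for x \<pi>
  proof -
    let ?X = "\<Gamma> \<circ> walk T \<pi> x"
    obtain i where i: "i < M" "?X ` {..N} \<subseteq> C i"
      using cover[OF small[OF x]] by auto
    have sub: "{?X (2 * i), ?X (2 * i + 1), ?X (2 * i + 2)} \<subseteq> ?X ` {..N}"
      using i(1) by (auto simp: N simp del: comp_apply walk.simps)
    have "a i (?X (2 * i)) (?X (2 * i + 1)) (?X (2 * i + 2)) =
          bd1 (b i) (?X (2 * i)) (?X (2 * i + 1)) (?X (2 * i + 2))"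
      using sub i by (intro assms(2) mono[OF small[OF x] sub]) auto
    then show ?thesis
      unfolding triple_cup_def using i(1) by (intro prod_zero) auto
  qed
  have "chain_eval G T N (\<lambda>X. triple_cup M a (\<Gamma> \<circ> X)) =
      chain_eval G T N (\<lambda>X. triple_cup M (\<lambda>i x y z. a i x y z - bd1 (b i) x y z) (\<Gamma> \<circ> X))"
    by (rule chain_eval_cohomologous[of a b, OF assms(1)])
  moreover have "chain_eval G T N (\<lambda>X. triple_cup M (\<lambda>i x y z. a i x y z - bd1 (b i) x y z) (\<Gamma> \<circ> X)) = 0"
    using 0 by (simp add: chain_eval_def)
  ultimately show ?thesis
    by simp
qed

end

section \<open>Evaluation on the discrete torus\<close>

text \<open>A discrete torus of dimension \<open>2 * M\<close>, stored as M discrete tori of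
  dimension two, one for each sphere. Accordingly the direction c moves one coordinate of the factor
  \<open>c div 2\<close>.\<close>

definition grid :: "nat \<Rightarrow> nat \<Rightarrow> (nat \<Rightarrow> nat \<times> nat) set" where
  "grid M K = {..<M} \<rightarrow>\<^sub>E {..<K} \<times> {..<K}"

definition pair_step :: "nat \<Rightarrow> nat \<Rightarrow> nat \<times> nat \<Rightarrow> nat \<times> nat" where
  "pair_step K c p = (if even c then (Suc (fst p) mod K, snd p) else (fst p, Suc (snd p) mod K))"

definition step :: "nat \<Rightarrow> nat \<Rightarrow> (nat \<Rightarrow> nat \<times> nat) \<Rightarrow> nat \<Rightarrow> nat \<times> nat" where
  "step K c x = x (c div 2 := pair_step K c (x (c div 2)))"

lemma step_other: "c div 2 \<noteq> f \<Longrightarrow> step K c x f = x f"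
  by (simp add: step_def)

lemma finite_grid: "finite (grid M K)"
  by (auto simp: grid_def intro!: finite_PiE)

lemma pair_step_in: "p \<in> {..<K} \<times> {..<K} \<Longrightarrow> pair_step K c p \<in> {..<K} \<times> {..<K}"
  by (cases p) (auto simp: pair_step_def intro!: mod_less_divisor)

lemma Suc_mod_inject: "s < K \<Longrightarrow> t < K \<Longrightarrow> Suc s mod K = Suc t mod K \<Longrightarrow> s = t"
  by (auto simp: mod_Suc split: if_splits)

lemma inj_on_pair_step: "inj_on (pair_step K c) ({..<K} \<times> {..<K})"
proof (rule inj_onI)
  fix p q assume "p \<in> {..<K} \<times> {..<K}" "q \<in> {..<K} \<times> {..<K}" "pair_step K c p = pair_step K c q"
  then show "p = q"
    using Suc_mod_inject[of "fst p" K "fst q"] Suc_mod_inject[of "snd p" K "snd q"]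
    by (cases "even c") (auto simp: pair_step_def prod_eq_iff)
qed

lemma bij_betw_step:
  assumes "c < 2 * M"
  shows "bij_betw (step K c) (grid M K) (grid M K)"
proof -
  let ?f = "c div 2"
  have f: "?f < M"
    using assms by auto
  have mem: "x ?f \<in> {..<K} \<times> {..<K}" if "x \<in> grid M K" for x
    using that unfolding grid_def by (rule PiE_mem) (use f in simp)
  have "step K c ` grid M K \<subseteq> grid M K"
  proof (rule image_subsetI)
    fix x assume x: "x \<in> grid M K"
    have "x(?f := pair_step K c (x ?f)) \<in> insert ?f {..<M} \<rightarrow>\<^sub>E {..<K} \<times> {..<K}"
      using x by (intro PiE_fun_upd pair_step_in mem) (simp_all only: grid_def)
    moreover have "insert ?f {..<M} = {..<M}"
      using f by auto
    ultimately show "step K c x \<in> grid M K"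
      by (simp only: step_def grid_def)
  qed
  moreover have "inj_on (step K c) (grid M K)"
  proof (rule inj_onI)
    fix x y assume xy: "x \<in> grid M K" "y \<in> grid M K" "step K c x = step K c y"
    have "x g = y g" for g
    proof (cases "g = ?f")
      case True
      have "pair_step K c (x ?f) = pair_step K c (y ?f)"
        using fun_cong[OF xy(3), of ?f] by (simp add: step_def)
      then have "x ?f = y ?f"
        by (rule inj_onD[OF inj_on_pair_step _ mem[OF xy(1)] mem[OF xy(2)]])
      with True show ?thesis
        by simp
    next
      case False
      then show ?thesis
        using fun_cong[OF xy(3), of g] by (simp add: step_def)
    qed
    then show "x = y" ..
  qed
  ultimately show ?thesis
    unfolding bij_betw_def by (intro conjI endo_inj_surj finite_grid)
qed

lemma step_commute: "step K c (step K d x) = step K d (step K c x)"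
proof (cases "c div 2 = d div 2")
  case True
  then show ?thesis
    by (auto simp: step_def pair_step_def fun_eq_iff)
next
  case False
  then show ?thesis
    by (auto simp: step_def fun_eq_iff)
qed

lemma torus_grid_grid: "torus_grid (grid M K) (step K) (2 * M)"
  by unfold_locales (auto intro: bij_betw_step step_commute)

lemma walk_untouched:
  "(\<And>l. l < k \<Longrightarrow> \<pi> l div 2 \<noteq> f) \<Longrightarrow> walk (step K) \<pi> x k f = x f"
  by (induction k) (auto simp: step_other)

definition double_perm :: "(nat \<Rightarrow> nat) \<Rightarrow> nat \<Rightarrow> nat" where
  "double_perm \<tau> c = 2 * \<tau> (c div 2) + c mod 2"

text \<open>Exchanging two factors exchanges two pairs of directions, which is a product of two
  transpositions and hence even. This is the commutativity of classes of degree two.\<close>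

lemma double_perm:
  assumes "\<tau> permutes {..<M}"
  shows "double_perm \<tau> permutes {..<2 * M} \<and> sign (double_perm \<tau>) = 1"
  using assms finite_lessThan
proof (induction rule: permutes_induct)
  case id
  have "double_perm id = id"
    by (auto simp: double_perm_def fun_eq_iff)
  then show ?case
    by (simp only: permutes_id sign_id)
next
  case (swap a b p)
  let ?s = "Transposition.transpose (2 * a) (2 * b)"
  let ?t = "Transposition.transpose (2 * a + 1) (2 * b + 1)"
  have eq: "double_perm (Transposition.transpose a b \<circ> p) = ?s \<circ> (?t \<circ> double_perm p)"
  proof (rule ext)
    fix c :: nat
    define u where "u = p (c div 2)"
    have ne: "2 * x \<noteq> Suc (2 * y)" "Suc (2 * y) \<noteq> 2 * x" for x y :: nat
      by presburger+
    have ev: "?s (2 * u) = 2 * Transposition.transpose a b u" "?t (2 * u) = 2 * u"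
      using ne by (auto simp: Transposition.transpose_def)
    have od: "?t (2 * u + 1) = 2 * Transposition.transpose a b u + 1" "?s (2 * v + 1) = 2 * v + 1" for v
      using ne by (auto simp: Transposition.transpose_def)
    show "double_perm (Transposition.transpose a b \<circ> p) c = (?s \<circ> (?t \<circ> double_perm p)) c"
    proof (cases "even c")
      case True
      then have "double_perm q c = 2 * q (c div 2)" for q
        by (simp add: double_perm_def)
      with ev show ?thesis
        by (simp add: u_def)
    next
      case False
      then have "double_perm q c = 2 * q (c div 2) + 1" for q
        by (simp add: double_perm_def odd_iff_mod_2_eq_one)
      with od show ?thesis
        by (simp add: u_def)
    qed
  qed
  have st: "?s permutes {..<2 * M}" "?t permutes {..<2 * M}"
    using swap by (auto intro!: permutes_swap_id)
  have p: "double_perm p permutes {..<2 * M}" "sign (double_perm p) = 1"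
    using swap by auto
  have tp: "?t \<circ> double_perm p permutes {..<2 * M}"
    by (rule permutes_compose[OF p(1) st(2)])
  have perm: "permutation q" if "q permutes {..<2 * M}" for q
    using that by (auto simp: permutation_permutes)
  have "sign (?s \<circ> (?t \<circ> double_perm p)) = sign ?s * (sign ?t * sign (double_perm p))"
    by (simp only: sign_compose[OF perm[OF st(1)] perm[OF tp]] sign_compose[OF perm[OF st(2)] perm[OF p(1)]])
  then show ?case
    unfolding eq using permutes_compose[OF tp st(1)] swap(3) p(2)
    by (simp add: sign_swap_id del: comp_apply)
qed

text \<open>Only the order that visits the factors in the order \<open>\<tau>\<close>, first coordinate first, contributes.\<close>

lemma sum_permutations_single:
  assumes \<tau>: "\<tau> permutes {..<M}"
    and W: "\<And>i p q r. W i p q r \<noteq> 0 \<Longrightarrow> fst p \<noteq> fst q \<and> snd q \<noteq> snd r"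
  shows "(\<Sum>\<pi> | \<pi> permutes {..<2 * M}. sign \<pi> *
     (\<Prod>i<M. W i (walk (step K) \<pi> x (2 * i) (\<tau> i)) (walk (step K) \<pi> x (2 * i + 1) (\<tau> i))
                 (walk (step K) \<pi> x (2 * i + 2) (\<tau> i)))) =
     (\<Prod>i<M. W i (x (\<tau> i)) (pair_step K 0 (x (\<tau> i))) (pair_step K 1 (pair_step K 0 (x (\<tau> i)))))"
    (is "sum ?F ?P = ?rhs")
proof -
  let ?\<rho> = "double_perm \<tau>"
  note \<rho> = double_perm[OF \<tau>]
  have "?F \<pi> = 0" if \<pi>: "\<pi> permutes {..<2 * M}" "\<pi> \<noteq> ?\<rho>" for \<pi>
  proof (rule ccontr)
    assume "?F \<pi> \<noteq> 0"
    then have nz: "W i (walk (step K) \<pi> x (2 * i) (\<tau> i)) (walk (step K) \<pi> x (2 * i + 1) (\<tau> i))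
                 (walk (step K) \<pi> x (2 * i + 2) (\<tau> i)) \<noteq> 0" if "i < M" for i
      using that by auto
    \<comment> \<open>A nonzero W forces step \<open>2 * i\<close> to move the first coordinate of
      the factor \<open>\<tau> i\<close> and the next step to move its second one. This determines
      \<pi> completely.\<close>
    have fst_step: "c = 2 * f" if "fst (y f) \<noteq> fst (step K c y f)" for c f and y :: "nat \<Rightarrow> nat \<times> nat"
      using that by (auto simp: step_def pair_step_def split: if_splits)
    have snd_step: "c = 2 * f + 1" if "snd (y f) \<noteq> snd (step K c y f)" for c f and y :: "nat \<Rightarrow> nat \<times> nat"
      using that by (auto simp: step_def pair_step_def split: if_splits)
    have 1: "\<pi> (2 * i) = 2 * \<tau> i" "\<pi> (2 * i + 1) = 2 * \<tau> i + 1" if "i < M" for i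
      using fst_step[of "walk (step K) \<pi> x (2 * i)" "\<tau> i" "\<pi> (2 * i)"]
        snd_step[of "walk (step K) \<pi> x (2 * i + 1)" "\<tau> i" "\<pi> (2 * i + 1)"] W[OF nz[OF that]]
      by auto
    have "\<pi> c = ?\<rho> c" for c
    proof (cases "c < 2 * M")
      case True
      then have "c div 2 < M"
        by auto
      from 1[OF this] show ?thesis
        by (cases "even c") (auto simp: double_perm_def elim!: evenE oddE)
    next
      case False
      then show ?thesis
        using \<pi>(1) \<rho> by (auto simp: permutes_def)
    qed
    with \<pi>(2) show False
      by blast
  qed
  then have "sum ?F ?P = sum ?F {?\<rho>}"
    using \<rho> by (intro sum.mono_neutral_right) (auto simp: finite_permutations)
  also have "\<dots> = (\<Prod>i<M. W i (walk (step K) ?\<rho> x (2 * i) (\<tau> i)) (walk (step K) ?\<rho> x (2 * i + 1) (\<tau> i))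
                 (walk (step K) ?\<rho> x (2 * i + 2) (\<tau> i)))"
    using \<rho> by simp
  also have "\<dots> = ?rhs"
  proof (rule prod.cong[OF refl])
    fix i assume "i \<in> {..<M}"
    have 0: "walk (step K) ?\<rho> x (2 * i) (\<tau> i) = x (\<tau> i)"
    proof (rule walk_untouched)
      fix l assume "l < 2 * i"
      then have "l div 2 \<noteq> i"
        by auto
      then show "?\<rho> l div 2 \<noteq> \<tau> i"
        using permutes_inj[OF \<tau>] by (auto simp: double_perm_def inj_def)
    qed
    have 1: "walk (step K) ?\<rho> x (2 * i + 1) (\<tau> i) = pair_step K 0 (x (\<tau> i))"
      using 0 by (simp add: step_def double_perm_def pair_step_def)
    have 2: "walk (step K) ?\<rho> x (2 * i + 2) (\<tau> i) = pair_step K 1 (pair_step K 0 (x (\<tau> i)))"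
      using 1 by (simp add: step_def double_perm_def pair_step_def)
    show "W i (walk (step K) ?\<rho> x (2 * i) (\<tau> i)) (walk (step K) ?\<rho> x (2 * i + 1) (\<tau> i))
                 (walk (step K) ?\<rho> x (2 * i + 2) (\<tau> i)) =
        W i (x (\<tau> i)) (pair_step K 0 (x (\<tau> i))) (pair_step K 1 (pair_step K 0 (x (\<tau> i))))"
      by (simp only: 0 1 2)
  qed
  finally show ?thesis .
qed

text \<open>With a single contributing order of directions, what remains is a sum over all grid
  points of a product over the factors, which factorises. This plays the role of the Kuenneth
  formula.\<close>

lemma chain_eval_product:
  assumes \<tau>: "\<tau> permutes {..<M}"
    and W: "\<And>i p q r. W i p q r \<noteq> 0 \<Longrightarrow> fst p \<noteq> fst q \<and> snd q \<noteq> snd r"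
  shows "chain_eval (grid M K) (step K) (2 * M)
     (\<lambda>X. \<Prod>i<M. W i (X (2 * i) (\<tau> i)) (X (2 * i + 1) (\<tau> i)) (X (2 * i + 2) (\<tau> i))) =
     (\<Prod>i<M. \<Sum>p\<in>{..<K} \<times> {..<K}. W i p (pair_step K 0 p) (pair_step K 1 (pair_step K 0 p)))"
proof -
  define V where "V i p = W i p (pair_step K 0 p) (pair_step K 1 (pair_step K 0 p))" for i p
  have "chain_eval (grid M K) (step K) (2 * M)
     (\<lambda>X. \<Prod>i<M. W i (X (2 * i) (\<tau> i)) (X (2 * i + 1) (\<tau> i)) (X (2 * i + 2) (\<tau> i))) =
     (\<Sum>x\<in>grid M K. \<Prod>i<M. V i (x (\<tau> i)))"
    unfolding chain_eval_def V_def
    by (intro sum.cong refl sum_permutations_single[OF \<tau> W])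
  also have "\<dots> = (\<Sum>x\<in>grid M K. \<Prod>f<M. V (inv \<tau> f) (x f))"
  proof (rule sum.cong[OF refl])
    fix x
    show "(\<Prod>i<M. V i (x (\<tau> i))) = (\<Prod>f<M. V (inv \<tau> f) (x f))"
      using prod.permute[OF \<tau>, of "\<lambda>f. V (inv \<tau> f) (x f)"] permutes_inverses[OF \<tau>] by (simp add: o_def)
  qed
  also have "\<dots> = (\<Prod>f<M. \<Sum>p\<in>{..<K} \<times> {..<K}. V (inv \<tau> f) p)"
    unfolding grid_def by (rule prod_sum_PiE [symmetric]) auto
  also have "\<dots> = (\<Prod>i<M. \<Sum>p\<in>{..<K} \<times> {..<K}. V i p)"
    using prod.permute[OF \<tau>, of "\<lambda>f. \<Sum>p\<in>{..<K} \<times> {..<K}. V (inv \<tau> f) p"]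
      permutes_inverses[OF \<tau>] by (simp add: o_def)
  finally show ?thesis
    by (simp add: V_def)
qed

section \<open>A generator of the second cohomology of the sphere\<close>

definition crossing :: "real ^ 3 \<Rightarrow> real ^ 3 \<Rightarrow> real ^ 3 \<Rightarrow> int" where
  "crossing p q r =
     (of_bool (q $ 1 > 0) - of_bool (p $ 1 > 0)) * (of_bool (r $ 2 > 0) - of_bool (q $ 2 > 0))"

text \<open>\<open>crossing\<close> is the cup product of the coboundaries of two half-space indicators. On small
  triples of unit vectors it is supported near the two poles, and cutting off one of the poles
  leaves a generator of the second cohomology of the sphere.\<close>

definition pole_cocycle :: "nat \<Rightarrow> real ^ 3 \<Rightarrow> real ^ 3 \<Rightarrow> real ^ 3 \<Rightarrow> int" where
  "pole_cocycle i p q r =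
     (if even i then if p $ 3 > 0 then crossing p q r else 0
      else if p $ 3 > 0 then 0 else - crossing p q r)"

definition clustered :: "(real ^ 3) set \<Rightarrow> bool" where
  "clustered S \<longleftrightarrow> (\<forall>p\<in>S. 1 \<le> norm p) \<and> (\<forall>p\<in>S. \<forall>q\<in>S. dist p q < 1 / 4)"

lemma clustered_subset: "clustered S \<Longrightarrow> R \<subseteq> S \<Longrightarrow> clustered R"
  unfolding clustered_def by blast

lemma norm_real3: "(norm (x :: real ^ 3))\<^sup>2 = (x $ 1)\<^sup>2 + (x $ 2)\<^sup>2 + (x $ 3)\<^sup>2"
  unfolding power2_norm_eq_inner inner_vec_def by (simp add: sum_3 power2_eq_square)

lemma sgn_component_pos: "sgn (x :: real ^ 3) $ k > 0 \<longleftrightarrow> x $ k > 0"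
  by (cases "x = 0") (auto simp: sgn_vec_def zero_less_divide_iff zero_less_mult_iff)

text \<open>Only the signs of coordinates enter, so degrees can be computed with vectors that are
  not normalised.\<close>

lemma pole_cocycle_sgn: "pole_cocycle i (sgn p) (sgn q) (sgn r) = pole_cocycle i p q r"
  by (simp add: pole_cocycle_def crossing_def sgn_component_pos)

text \<open>This is where the constant 1/4 comes from. A crossing forces the first two coordinates
  of q below 1/4 in absolute value; as q has norm at least 1, its third coordinate is then at least
  1/4 in absolute value, and no point within distance 1/4 can lie on the other side.\<close>

lemma same_hemisphere:
  assumes S: "clustered S" and "p \<in> S" "q \<in> S" "r \<in> S" "crossing p q r \<noteq> 0" and uv: "u \<in> S" "v \<in> S"
  shows "u $ 3 > 0 \<longleftrightarrow> v $ 3 > 0"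
proof -
  have comp: "\<bar>x $ k - y $ k\<bar> < 1 / 4" if "x \<in> S" "y \<in> S" for x y k
  proof -
    have "\<bar>(x - y) $ k\<bar> \<le> dist x y"
      unfolding dist_norm by (rule component_le_norm_cart)
    with that S show ?thesis
      by (fastforce simp: clustered_def)
  qed
  have "(q $ 1 > 0) \<noteq> (p $ 1 > 0)" "(r $ 2 > 0) \<noteq> (q $ 2 > 0)"
    using \<open>crossing p q r \<noteq> 0\<close> by (auto simp: crossing_def)
  then have "\<bar>q $ 1\<bar> \<le> \<bar>q $ 1 - p $ 1\<bar>" "\<bar>q $ 2\<bar> \<le> \<bar>r $ 2 - q $ 2\<bar>"
    by auto
  then have "\<bar>q $ 1\<bar> < 1 / 4" "\<bar>q $ 2\<bar> < 1 / 4"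
    using comp[of q p 1] comp[of r q 2] assms by auto
  then have "\<bar>q $ 1\<bar>\<^sup>2 \<le> (1 / 4)\<^sup>2" "\<bar>q $ 2\<bar>\<^sup>2 \<le> (1 / 4)\<^sup>2"
    by (intro power_mono; simp)+
  moreover have "1 \<le> (norm q)\<^sup>2"
    using S \<open>q \<in> S\<close> by (auto simp: clustered_def)
  ultimately have "(1 / 4)\<^sup>2 \<le> \<bar>q $ 3\<bar>\<^sup>2"
    unfolding norm_real3 by (simp add: power2_eq_square)
  then have "1 / 4 \<le> \<bar>q $ 3\<bar>"
    by (rule power2_le_imp_le) simp
  with comp[of u q 3] comp[of v q 3] uv \<open>q \<in> S\<close> show ?thesis
    by linarith
qed

lemma crossing_cocycle:
  "crossing q r s - crossing p r s + crossing p q s - crossing p q r = 0"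
  by (simp add: crossing_def algebra_simps)

text \<open>If some triple of the points crosses, all of them lie in one hemisphere, where the
  function is a constant multiple of \<open>crossing\<close>; otherwise all terms are zero.\<close>

lemma cocycle_on_pole_cocycle: "cocycle_on clustered (pole_cocycle i)"
  unfolding cocycle_on_def
proof (intro allI impI)
  fix p q r s assume S: "clustered {p, q, r, s}" (is "clustered ?S")
  show "pole_cocycle i q r s - pole_cocycle i p r s + pole_cocycle i p q s - pole_cocycle i p q r = 0"
  proof (cases "\<exists>x\<in>?S. \<exists>y\<in>?S. \<exists>z\<in>?S. crossing x y z \<noteq> 0")
    case True
    then obtain x y z where "x \<in> ?S" "y \<in> ?S" "z \<in> ?S" "crossing x y z \<noteq> 0"
      by blast
    from same_hemisphere[OF S this, of q p] have "q $ 3 > 0 \<longleftrightarrow> p $ 3 > 0"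
      by simp
    then show ?thesis
      using crossing_cocycle[of q r s p] by (simp add: pole_cocycle_def)
  next
    case False
    then show ?thesis
      by (simp add: pole_cocycle_def)
  qed
qed

text \<open>The shared vertex r cannot be near both poles, so the relation u^2 = 0 holds for the
  cochains themselves.\<close>

lemma pole_cocycle_cup:
  assumes "clustered S" "{p, q, r, s, t} \<subseteq> S" "even i"
  shows "pole_cocycle i p q r * pole_cocycle (Suc i) r s t = 0"
proof (cases "crossing p q r = 0")
  case False
  then have "p $ 3 > 0 \<longleftrightarrow> r $ 3 > 0"
    using assms by (intro same_hemisphere[of S p q r]) auto
  then show ?thesis
    using assms by (simp add: pole_cocycle_def)
qed (simp add: pole_cocycle_def)

text \<open>The squared norm is \<open>1 + 2 (1 - cos \<theta>) (1 - cos \<phi>)\<close>, and the value lies on the positive third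
  axis only for \<open>\<theta> = \<phi> = 0\<close>; hence the direction of this map has degree one.\<close>

definition torus_map :: "real \<Rightarrow> real \<Rightarrow> real ^ 3" where
  "torus_map \<theta> \<phi> = vector [sin \<theta>, sin \<phi>, cos \<theta> + cos \<phi> - 1]"

lemma torus_map_nth [simp]:
  "torus_map \<theta> \<phi> $ 1 = sin \<theta>" "torus_map \<theta> \<phi> $ 2 = sin \<phi>" "torus_map \<theta> \<phi> $ 3 = cos \<theta> + cos \<phi> - 1"
  by (simp_all add: torus_map_def)

lemma norm_torus_map: "1 \<le> norm (torus_map \<theta> \<phi>)" "norm (torus_map \<theta> \<phi>) \<le> 3"
proof -
  have "(norm (torus_map \<theta> \<phi>))\<^sup>2 = 1 + 2 * ((1 - cos \<theta>) * (1 - cos \<phi>))"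
    unfolding norm_real3 torus_map_nth sin_squared_eq by (simp add: power2_eq_square algebra_simps)
  moreover have "0 \<le> (1 - cos \<theta>) * (1 - cos \<phi>)"
    by (intro mult_nonneg_nonneg) auto
  moreover have "(1 - cos \<theta>) * (1 - cos \<phi>) \<le> 2 * 2"
    using cos_ge_minus_one[of \<theta>] cos_ge_minus_one[of \<phi>] by (intro mult_mono) auto
  ultimately have "1 \<le> (norm (torus_map \<theta> \<phi>))\<^sup>2 \<and> (norm (torus_map \<theta> \<phi>))\<^sup>2 \<le> 9"
    by linarith
  then have "1\<^sup>2 \<le> (norm (torus_map \<theta> \<phi>))\<^sup>2" "(norm (torus_map \<theta> \<phi>))\<^sup>2 \<le> 3\<^sup>2"
    by simp_all
  then show "1 \<le> norm (torus_map \<theta> \<phi>)" "norm (torus_map \<theta> \<phi>) \<le> 3"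
    by (auto intro: power2_le_imp_le)
qed

definition grid_map :: "nat \<Rightarrow> nat \<times> nat \<Rightarrow> real ^ 3" where
  "grid_map L p = torus_map (pi * fst p / L) (pi * snd p / L)"

lemma sin_grid_pos:
  fixes s L :: nat
  assumes "s < 2 * L"
  shows "sin (pi * s / L) > 0 \<longleftrightarrow> 0 < s \<and> s < L"
proof -
  have L: "L > 0"
    using assms by simp
  consider "s = 0" | "0 < s" "s < L" | "L \<le> s"
    by linarith
  then show ?thesis
  proof cases
    case 2
    then have "sin (pi * s / L) > 0"
      using L by (intro sin_gt_zero) (auto simp: field_simps)
    with 2 show ?thesis
      by simp
  next
    case 3
    have "real s < 2 * real L" "real L \<le> real s"
      using assms 3 by simp_all
    then have "sin (pi * s / L) \<le> 0"
      using L by (intro sin_le_zero) (auto simp: field_simps)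
    with 3 show ?thesis
      by simp
  qed simp
qed

text \<open>The sign of the sine jumps only at 0 and at L - 1, so four grid points contribute. Of
  these only (0, 0) has a positive third coordinate: L \<ge> 2 makes the cosine at L - 1
  nonpositive. The northern count is 1; the southern one is -(-1 - 1 + 1) = 1, which explains the
  minus sign for odd i.\<close>

lemma degree_grid_map:
  assumes L: "L \<ge> 2"
  defines "K \<equiv> 2 * L"
  shows "(\<Sum>p\<in>{..<K} \<times> {..<K}. pole_cocycle i (grid_map L p) (grid_map L (pair_step K 0 p))
     (grid_map L (pair_step K 1 (pair_step K 0 p)))) = 1"
proof -
  define \<Delta> :: "nat \<Rightarrow> int" where "\<Delta> s = (if s = 0 then 1 else if s = L - 1 then -1 else 0)" for s
  have \<Delta>: "of_bool (sin (pi * real (Suc s mod K) / L) > 0) - of_bool (sin (pi * s / L) > 0) = \<Delta> s"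
    if "s < K" for s
  proof -
    have "Suc s mod K < 2 * L"
      using that by (simp add: K_def)
    then show ?thesis
      using that L by (subst (1 2) sin_grid_pos) (auto simp: \<Delta>_def K_def mod_Suc)
  qed
  define g :: "nat \<Rightarrow> nat \<Rightarrow> int" where "g s t = (if even i then of_bool (cos (pi * s / L) + cos (pi * t / L) > 1)
     else - of_bool (\<not> cos (pi * s / L) + cos (pi * t / L) > 1))" for s t
  have "(\<Sum>p\<in>{..<K} \<times> {..<K}. pole_cocycle i (grid_map L p) (grid_map L (pair_step K 0 p))
     (grid_map L (pair_step K 1 (pair_step K 0 p)))) =
     (\<Sum>s<K. \<Sum>t<K. g s t * (\<Delta> s * \<Delta> t))"
    unfolding sum.cartesian_product
  proof (rule sum.cong[OF refl], unfold split_paired_all prod.case)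
    fix s t assume "(s, t) \<in> {..<K} \<times> {..<K}"
    then have st: "s < K" "t < K"
      by auto
    show "pole_cocycle i (grid_map L (s, t)) (grid_map L (pair_step K 0 (s, t)))
     (grid_map L (pair_step K 1 (pair_step K 0 (s, t)))) = g s t * (\<Delta> s * \<Delta> t)"
      unfolding \<Delta>[OF st(1), symmetric] \<Delta>[OF st(2), symmetric] g_def
      by (simp add: pole_cocycle_def crossing_def grid_map_def pair_step_def)
  qed
  also have "\<dots> = (\<Sum>s\<in>{0, L - 1}. \<Sum>t\<in>{0, L - 1}. g s t * (\<Delta> s * \<Delta> t))"
  proof -
    have "(\<Sum>t<K. g s t * (\<Delta> s * \<Delta> t)) = (\<Sum>t\<in>{0, L - 1}. g s t * (\<Delta> s * \<Delta> t))" for s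
      using L by (intro sum.mono_neutral_right) (auto simp: K_def \<Delta>_def)
    then show ?thesis
      using L by (simp only:) (intro sum.mono_neutral_right; auto simp: K_def \<Delta>_def)
  qed
  also have "\<dots> = g 0 0 - g 0 (L - 1) - g (L - 1) 0 + g (L - 1) (L - 1)"
    using L by (simp add: \<Delta>_def)
  also have "\<dots> = 1"
  proof -
    have "pi / 2 \<le> pi * real (L - 1) / L" "pi * real (L - 1) / L \<le> pi"
      using L by (auto simp: field_simps of_nat_diff)
    then have "cos (pi * real (L - 1) / L) \<le> cos (pi / 2)"
      by (intro cos_monotone_0_pi_le) auto
    then show ?thesis
      by (simp add: g_def)
  qed
  finally show ?thesis .
qed

text \<open>The product of the differences of the two cocycles belonging to \<open>2 * j\<close> and \<open>2 * j + 1\<close> expands into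
  signed products of one cocycle per factor. Choices \<open>\<tau>\<close> that use a factor twice contribute
  nothing, since the two representatives are supported at opposite poles; the other ones all have
  the same sign.\<close>

lemma no_cohomological_cover:
  fixes U :: "nat \<Rightarrow> 'z \<Rightarrow> real ^ 3" and m L :: nat
  assumes L: "L \<ge> 2"
    and mono: "\<And>A B. sm A \<Longrightarrow> B \<subseteq> A \<Longrightarrow> sm B"
    and small: "\<And>x \<pi>. x \<in> grid (2 * m) (2 * L) \<Longrightarrow> \<pi> permutes {..<4 * m} \<Longrightarrow>
        sm ((\<Gamma> \<circ> walk (step (2 * L)) \<pi> x) ` {..4 * m})"
    and U: "\<And>x f. x \<in> grid (2 * m) (2 * L) \<Longrightarrow> f < 2 * m \<Longrightarrow> U f (\<Gamma> x) = sgn (grid_map L (x f))"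
    and cl: "\<And>S f. sm S \<Longrightarrow> f < 2 * m \<Longrightarrow> clustered (U f ` S)"
    and cover: "\<And>S. sm S \<Longrightarrow> S \<noteq> {} \<Longrightarrow> \<exists>i<2 * m. S \<subseteq> C i"
    and bd: "\<And>i x y z. i < 2 * m \<Longrightarrow> sm {x, y, z} \<Longrightarrow> {x, y, z} \<subseteq> C i \<Longrightarrow>
        pole_cocycle i (U (2 * (i div 2)) x) (U (2 * (i div 2)) y) (U (2 * (i div 2)) z) -
        pole_cocycle i (U (2 * (i div 2) + 1) x) (U (2 * (i div 2) + 1) y) (U (2 * (i div 2) + 1) z) =
        bd1 (b i) x y z"
  shows False
proof -
  let ?K = "2 * L"
  define M where "M = 2 * m"
  define G where "G = grid M ?K"
  define T where "T = step ?K"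
  \<comment> \<open>Even numbers f stand for coordinates of the first projection, odd ones for the
    second. The positions 2j and 2j + 1 choose from the same pair of factors, which produces the
    square.\<close>
  define B where "B i = {2 * (i div 2), 2 * (i div 2) + 1}" for i :: nat
  have BM: "f < M" if "f \<in> B i" "i < M" for f i
  proof -
    have "i div 2 < m"
      using that by (simp add: M_def less_mult_imp_div_less mult.commute)
    with that show ?thesis
      by (auto simp: B_def M_def)
  qed
  have \<tau>B: "\<tau> i \<in> B i" if "\<tau> \<in> PiE {..<M} B" "i < M" for \<tau> i
    using PiE_mem[OF that(1), of i] that(2) by simp
  define w where "w f i x y z = (-1) ^ f * pole_cocycle i (U f x) (U f y) (U f z)" for f i x y z
  define a where "a i x y z = (\<Sum>f\<in>B i. w f i x y z)" for i x y z
  interpret torus_grid G T "2 * M"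
    unfolding G_def T_def by (rule torus_grid_grid)
  have four_m: "2 * M = 4 * m"
    by (simp add: M_def)
  interpret st: small_torus G T "2 * M" sm \<Gamma> M
    using mono small unfolding small_torus_def small_sets_def small_torus_axioms_def four_m
    by (auto simp: G_def T_def M_def torus_grid_grid[of "2 * m", simplified])
  have a: "a i x y z =
        pole_cocycle i (U (2 * (i div 2)) x) (U (2 * (i div 2)) y) (U (2 * (i div 2)) z) -
        pole_cocycle i (U (2 * (i div 2) + 1) x) (U (2 * (i div 2) + 1) y) (U (2 * (i div 2) + 1) z)" for i x y z
    by (simp add: a_def B_def w_def)
  have "chain_eval G T (2 * M) (\<lambda>X. triple_cup M a (\<Gamma> \<circ> X)) = 0"
  proof (rule st.chain_eval_eq_0)
    fix i assume i: "i < M"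
    have "cocycle_on sm (\<lambda>x y z. pole_cocycle i (U f x) (U f y) (U f z))" if "f \<in> B i" for f
      unfolding cocycle_on_def
    proof (intro allI impI)
      fix p q r s assume "sm {p, q, r, s}"
      from cl[OF this, of f] show "pole_cocycle i (U f q) (U f r) (U f s) - pole_cocycle i (U f p) (U f r) (U f s) +
         pole_cocycle i (U f p) (U f q) (U f s) - pole_cocycle i (U f p) (U f q) (U f r) = 0"
        using cocycle_on_pole_cocycle[of i] BM[OF that i] by (simp add: cocycle_on_def M_def)
    qed
    from this[of "2 * (i div 2)"] this[of "2 * (i div 2) + 1"] show "cocycle_on sm (a i)"
      unfolding cocycle_on_def a B_def by (simp add: algebra_simps)
  next
    show "a i x y z = bd1 (b i) x y z" if "i < M" "sm {x, y, z}" "{x, y, z} \<subseteq> C i" for i x y z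
      unfolding a using that by (intro bd) (auto simp: M_def)
  next
    show "\<exists>i<M. S \<subseteq> C i" if "sm S" "S \<noteq> {}" for S
      using cover[OF that] by (simp add: M_def)
  qed
  moreover have "chain_eval G T (2 * M) (\<lambda>X. triple_cup M a (\<Gamma> \<circ> X)) =
      (\<Sum>\<tau>\<in>PiE {..<M} B. chain_eval G T (2 * M) (\<lambda>X. \<Prod>i<M. w (\<tau> i) i (\<Gamma> (X (2 * i))) (\<Gamma> (X (2 * i + 1))) (\<Gamma> (X (2 * i + 2)))))"
  proof -
    have "triple_cup M a Y = (\<Sum>\<tau>\<in>PiE {..<M} B. \<Prod>i<M. w (\<tau> i) i (Y (2 * i)) (Y (2 * i + 1)) (Y (2 * i + 2)))" for Y
      unfolding triple_cup_def a_def by (rule prod_sum_PiE) (auto simp: B_def)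
    then show ?thesis
      unfolding chain_eval_def sum_distrib_left
      by (simp only: comp_apply sum_distrib_left)
         (subst sum.swap[of _ _ "PiE {..<M} B"], rule sum.cong[OF refl], rule sum.swap)
  qed
  moreover have "chain_eval G T (2 * M) (\<lambda>X. \<Prod>i<M. w (\<tau> i) i (\<Gamma> (X (2 * i))) (\<Gamma> (X (2 * i + 1))) (\<Gamma> (X (2 * i + 2)))) =
      (if inj_on \<tau> {..<M} then (\<Prod>i<M. (-1) ^ i) else 0)" if \<tau>: "\<tau> \<in> PiE {..<M} B" for \<tau>
  proof (cases "inj_on \<tau> {..<M}")
    case False
    then obtain j j' where j: "j < M" "j' < M" "j \<noteq> j'" "\<tau> j = \<tau> j'"
      by (auto simp: inj_on_def)
    define i i' where "i = min j j'" and "i' = max j j'"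
    have i: "i < M" "i' < M" "i < i'" "\<tau> i = \<tau> i'"
      using j by (auto simp: i_def i'_def min_def max_def)
    have "\<tau> i \<in> B i" "\<tau> i' \<in> B i'"
      by (rule \<tau>B[OF \<tau> i(1)], rule \<tau>B[OF \<tau> i(2)])
    \<comment> \<open>A factor belongs to only one pair of positions, so a repetition must occur at
      adjacent positions 2j and 2j + 1, where one cocycle is northern and the other
      southern.\<close>
    then have "\<tau> i div 2 = i div 2" "\<tau> i' div 2 = i' div 2"
      unfolding B_def by auto
    then have "i div 2 = i' div 2"
      using i(4) by (simp only:)
    with i(3) have ev: "even i" "i' = Suc i"
      by presburger+
    have zero: "(\<Prod>i<M. w (\<tau> i) i (\<Gamma> (walk T \<pi> x (2 * i))) (\<Gamma> (walk T \<pi> x (2 * i + 1))) (\<Gamma> (walk T \<pi> x (2 * i + 2)))) = 0"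
      if x: "x \<in> G" "\<pi> permutes {..<2 * M}" for x \<pi>
    proof -
      define Y where "Y k = \<Gamma> (walk T \<pi> x k)" for k
      define p where "p j = w (\<tau> j) j (Y (2 * j)) (Y (2 * j + 1)) (Y (2 * j + 2))" for j
      have "sm (Y ` {..4 * m})"
      proof -
        have "Y = \<Gamma> \<circ> walk T \<pi> x"
          by (rule ext) (simp add: Y_def)
        then show ?thesis
          using st.small[OF x] by (simp only: four_m)
      qed
      then have c: "clustered (U (\<tau> i) ` Y ` {..4 * m})"
        using BM[OF \<open>\<tau> i \<in> B i\<close> i(1)] by (intro cl) (auto simp: M_def)
      have "pole_cocycle i (U (\<tau> i) (Y (2 * i))) (U (\<tau> i) (Y (2 * i + 1))) (U (\<tau> i) (Y (2 * i + 2))) *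
        pole_cocycle (Suc i) (U (\<tau> i) (Y (2 * i + 2))) (U (\<tau> i) (Y (2 * i + 3))) (U (\<tau> i) (Y (2 * i + 4))) = 0"
        using i(2) ev by (intro pole_cocycle_cup[OF c]) (auto simp: M_def)
      moreover have "p i' = (-1) ^ \<tau> i * pole_cocycle (Suc i) (U (\<tau> i) (Y (2 * i + 2))) (U (\<tau> i) (Y (2 * i + 3))) (U (\<tau> i) (Y (2 * i + 4)))"
        using i(4) unfolding p_def w_def ev(2) by (simp add: eval_nat_numeral)
      ultimately have "p i = 0 \<or> p i' = 0"
        by (auto simp: p_def w_def)
      then have "(\<Prod>j<M. p j) = 0"
        using i by (auto intro!: prod_zero)
      then show ?thesis
        by (simp only: p_def Y_def)
    qed
    show ?thesis
      unfolding chain_eval_def if_not_P[OF False]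
      by (intro sum.neutral ballI) (simp only: zero mem_Collect_eq mult_zero_right)
  next
    case True
    define \<sigma> where "\<sigma> i = (if i < M then \<tau> i else i)" for i
    have "\<tau> ` {..<M} \<subseteq> {..<M}"
      using \<tau>B[OF \<tau>] BM by auto
    then have "\<tau> ` {..<M} = {..<M}"
      using True by (intro endo_inj_surj) auto
    then have "bij_betw \<tau> {..<M} {..<M}"
      using True by (simp add: bij_betw_def)
    then have "bij_betw \<sigma> {..<M} {..<M}"
      by (subst bij_betw_cong[where g = \<tau>]) (auto simp: \<sigma>_def)
    then have \<sigma>: "\<sigma> permutes {..<M}"
      by (rule bij_imp_permutes) (simp add: \<sigma>_def)
    \<comment> \<open>The normalisation \<open>sgn\<close> that U contributes is dropped here, which
      does not change the values of \<open>pole_cocycle\<close>.\<close>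
    define W where "W i p q r = (-1) ^ \<sigma> i * pole_cocycle i (grid_map L p) (grid_map L q) (grid_map L r)" for i p q r
    have "chain_eval G T (2 * M) (\<lambda>X. \<Prod>i<M. w (\<tau> i) i (\<Gamma> (X (2 * i))) (\<Gamma> (X (2 * i + 1))) (\<Gamma> (X (2 * i + 2)))) =
      chain_eval G T (2 * M) (\<lambda>X. \<Prod>i<M. W i (X (2 * i) (\<sigma> i)) (X (2 * i + 1) (\<sigma> i)) (X (2 * i + 2) (\<sigma> i)))"
      unfolding chain_eval_def
    proof (intro sum.cong refl arg_cong2[where f = "(*)"] prod.cong)
      fix x \<pi> i assume x: "x \<in> G" and \<pi>: "\<pi> \<in> {\<pi>. \<pi> permutes {..<2 * M}}" and "i \<in> {..<M}"
      then have i: "i < M" "\<sigma> i = \<tau> i" "\<sigma> i < M"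
        using permutes_in_image[OF \<sigma>, of i] by (auto simp: \<sigma>_def)
      have Uw: "U (\<sigma> i) (\<Gamma> (walk T \<pi> x k)) = sgn (grid_map L (walk T \<pi> x k (\<sigma> i)))" if "k \<le> 2 * M" for k
        using walk_in[of \<pi> x k] x \<pi> i that by (intro U) (auto simp: G_def M_def)
      show "w (\<tau> i) i (\<Gamma> (walk T \<pi> x (2 * i))) (\<Gamma> (walk T \<pi> x (2 * i + 1))) (\<Gamma> (walk T \<pi> x (2 * i + 2))) =
         W i (walk T \<pi> x (2 * i) (\<sigma> i)) (walk T \<pi> x (2 * i + 1) (\<sigma> i)) (walk T \<pi> x (2 * i + 2) (\<sigma> i))"
        unfolding w_def W_def i(2)[symmetric] using i(1)
        by (subst (1 2 3) Uw) (simp_all del: walk.simps add: pole_cocycle_sgn)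
    qed
    also have "\<dots> = (\<Prod>i<M. \<Sum>p\<in>{..<?K} \<times> {..<?K}. W i p (pair_step ?K 0 p) (pair_step ?K 1 (pair_step ?K 0 p)))"
      unfolding G_def T_def
    proof (rule chain_eval_product[OF \<sigma>])
      fix i p q r assume "W i p q r \<noteq> 0"
      then have "crossing (grid_map L p) (grid_map L q) (grid_map L r) \<noteq> 0"
        by (auto simp: W_def pole_cocycle_def split: if_splits)
      then show "fst p \<noteq> fst q \<and> snd q \<noteq> snd r"
        by (auto simp: crossing_def grid_map_def)
    qed
    also have "\<dots> = (\<Prod>i<M. (-1) ^ \<sigma> i)"
      unfolding W_def sum_distrib_left [symmetric] by (simp only: degree_grid_map[OF L]) simp
    also have "\<dots> = (\<Prod>i<M. (-1) ^ i)"
      using prod.permute[OF \<sigma>, of "\<lambda>i. (-1) ^ i :: int"] by (simp add: o_def)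
    finally show ?thesis
      using True by simp
  qed
  ultimately have "(\<Sum>\<tau>\<in>PiE {..<M} B. if inj_on \<tau> {..<M} then (\<Prod>i<M. (-1) ^ i) else 0) = (0 :: int)"
    by simp
  moreover have fin: "finite (PiE {..<M} B)"
    by (intro finite_PiE) (auto simp: B_def)
  moreover have "(\<Sum>\<tau>\<in>PiE {..<M} B. if inj_on \<tau> {..<M} then (\<Prod>i<M. (-1) ^ i) else 0) =
     int (card {\<tau> \<in> PiE {..<M} B. inj_on \<tau> {..<M}}) * (\<Prod>i<M. (-1) ^ i)"
    by (subst sum.inter_filter [symmetric, OF fin]) simp
  ultimately have "{\<tau> \<in> PiE {..<M} B. inj_on \<tau> {..<M}} = {}"
    using fin by (simp add: card_eq_0_iff)
  \<comment> \<open>All contributing choices have the same sign, so one of them suffices for a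
    nonzero total.\<close>
  moreover have "restrict id {..<M} \<in> {\<tau> \<in> PiE {..<M} B. inj_on \<tau> {..<M}}"
    by (auto simp: B_def inj_on_def)
  ultimately show False
    by blast
qed

section \<open>Path spaces\<close>

lemma openin_compact_open_subbasis:
  assumes "compactin X K" "openin Y U"
  shows "openin (compact_open_topology X Y)
     {f \<in> topspace X \<rightarrow>\<^sub>E topspace Y. continuous_map X Y f \<and> f ` K \<subseteq> U}"
  unfolding compact_open_topology_def
  by (rule topology_generated_by_Basis) (use assms in blast)

text \<open>The unit interval is locally compact: a compact neighbourhood K of t that
  \<open>s p\<close> maps into B gives a subbasic open set of paths, and evaluation at points of K
  sends it into B.\<close>

lemma continuous_on_path_space_eval:
  fixes s :: "'b::topological_space \<Rightarrow> real \<Rightarrow> 'a::topological_space"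
  assumes s: "continuous_map (top_of_set F) (path_space X) s"
  shows "continuous_on (F \<times> {0..1}) (\<lambda>(p, t). s p t)"
  unfolding continuous_on_topological
proof (intro ballI allI impI)
  fix z B assume z: "z \<in> F \<times> {0..1}" and B: "open B" "(case z of (p, t) \<Rightarrow> s p t) \<in> B"
  obtain p t where pt: "z = (p, t)" "p \<in> F" "t \<in> {0..1}"
    using z by blast
  have sF: "s q \<in> topspace (path_space X)" if "q \<in> F" for q
    using continuous_map_funspace[OF s] that by auto
  then have "continuous_on {0..1} (s p)" and X: "s q ` {0..1} \<subseteq> X" if "q \<in> F" for q
    using pt that by (auto simp: topspace_path_space path_def path_image_def)
  then have cont: "continuous_on {0..1} (s p)"
    using pt by blast
  obtain A where A: "open A" "t \<in> A" "\<forall>u\<in>{0..1}. u \<in> A \<longrightarrow> s p u \<in> B"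
    using cont[unfolded continuous_on_topological] pt(3) B pt(1) by (metis case_prod_conv)
  obtain e where e: "e > 0" "cball t e \<subseteq> A"
    using A open_contains_cball by blast
  define K where "K = cball t e \<inter> {0..1}"
  have K: "compactin (top_of_set {0..1}) K"
    unfolding K_def compactin_subtopology by (auto intro!: compact_Int)
  let ?O = "{f \<in> topspace (top_of_set {0..1}) \<rightarrow>\<^sub>E topspace (top_of_set X).
     continuous_map (top_of_set {0..1}) (top_of_set X) f \<and> f ` K \<subseteq> X \<inter> B}"
  have "openin (path_space X) ?O"
    unfolding path_space_def
    by (rule openin_compact_open_subbasis[OF K]) (rule openin_open_Int[OF B(1)])
  from openin_continuous_map_preimage[OF s this]
  obtain V where V: "open V" "{q \<in> F. s q \<in> ?O} = F \<inter> V"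
    by (auto simp: openin_open)
  have "s p ` K \<subseteq> X \<inter> B"
    using A e X[OF pt(2)] by (auto simp: K_def)
  then have "s p \<in> ?O"
    using sF[OF pt(2)] by (simp add: path_space_def topspace_compact_open_topology)
  then have "p \<in> V"
    using V pt by blast
  have "open (V \<times> ball t e)" "z \<in> V \<times> ball t e"
    using V(1) \<open>p \<in> V\<close> pt e by (auto intro: open_Times)
  moreover have "(case y of (p, t) \<Rightarrow> s p t) \<in> B" if y: "y \<in> F \<times> {0..1}" "y \<in> V \<times> ball t e" for y
  proof -
    obtain q u where q: "y = (q, u)" "q \<in> F" "u \<in> {0..1}" "q \<in> V" "u \<in> ball t e"
      using y by (cases y) auto
    then have "s q ` K \<subseteq> X \<inter> B" "u \<in> K"
      using V(2) by (auto simp: K_def)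
    then show ?thesis
      using q by auto
  qed
  ultimately show "\<exists>A. open A \<and> z \<in> A \<and> (\<forall>y\<in>F \<times> {0..1}. y \<in> A \<longrightarrow> (case y of (p, t) \<Rightarrow> s p t) \<in> B)"
    by blast
qed

text \<open>The other half of the exponential law. Preimages of subbasic sets are open by the tube
  lemma. The restriction is needed because points of the path space are undefined outside the
  interval.\<close>

lemma continuous_map_into_path_space:
  fixes h :: "'b::topological_space \<Rightarrow> real \<Rightarrow> 'a::topological_space"
  assumes h: "continuous_on (F \<times> {0..1}) (\<lambda>(p, t). h p t)"
    and X: "\<And>p t. p \<in> F \<Longrightarrow> t \<in> {0..1} \<Longrightarrow> h p t \<in> X"
  shows "continuous_map (top_of_set F) (path_space X) (\<lambda>p. restrict (h p) {0..1})"
proof -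
  have slice: "continuous_on {0..1} (h p)" if "p \<in> F" for p
  proof -
    have "continuous_on {0..1} ((\<lambda>(p, t). h p t) \<circ> Pair p)"
      using that by (intro continuous_on_compose continuous_on_subset[OF h]) (auto intro!: continuous_intros)
    then show ?thesis
      by (simp add: o_def)
  qed
  show ?thesis
    unfolding path_space_def compact_open_topology_def
  proof (rule continuous_on_generated_topo)
    fix O' assume "O' \<in> {{f \<in> topspace (top_of_set {0..1 :: real}) \<rightarrow>\<^sub>E topspace (top_of_set X).
        continuous_map (top_of_set {0..1}) (top_of_set X) f \<and> f ` K \<subseteq> U} | K U.
          compactin (top_of_set {0..1}) K \<and> openin (top_of_set X) U}"
    then obtain K U where O': "O' = {f \<in> {0..1::real} \<rightarrow>\<^sub>E X.
        continuous_map (top_of_set {0..1}) (top_of_set X) f \<and> f ` K \<subseteq> U}"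
      and K: "compact K" "K \<subseteq> {0..1}" and U: "openin (top_of_set X) U"
      by (auto simp: compactin_subtopology)
    have "(\<lambda>p. restrict (h p) {0..1}) -` O' \<inter> F = {p \<in> F. \<forall>t\<in>K. h p t \<in> U}"
    proof (intro equalityI subsetI)
      fix p assume p: "p \<in> {p \<in> F. \<forall>t\<in>K. h p t \<in> U}"
      have "continuous_on {0..1} (restrict (h p) {0..1})"
        using slice[of p] p by (auto cong: continuous_on_cong_simp)
      then show "p \<in> (\<lambda>p. restrict (h p) {0..1}) -` O' \<inter> F"
        using p X K(2) by (auto simp: O')
    next
      fix p assume "p \<in> (\<lambda>p. restrict (h p) {0..1}) -` O' \<inter> F"
      then show "p \<in> {p \<in> F. \<forall>t\<in>K. h p t \<in> U}"
        using K(2) by (force simp: O')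
    qed
    moreover have "openin (top_of_set F) {p \<in> F. \<forall>t\<in>K. h p t \<in> U}"
    proof (subst openin_subopen, intro ballI)
      fix p assume p: "p \<in> {p \<in> F. \<forall>t\<in>K. h p t \<in> U}"
      have "openin (top_of_set (F \<times> {0..1})) (F \<times> {0..1} \<inter> (\<lambda>(p, t). h p t) -` U)"
        using X by (intro continuous_openin_preimage[OF h _ U]) auto
      then obtain W where W: "open W" "F \<times> {0..1} \<inter> (\<lambda>(p, t). h p t) -` U = F \<times> {0..1} \<inter> W"
        by (auto simp: openin_open)
      have W_iff: "(q, t) \<in> W \<longleftrightarrow> h q t \<in> U" if "q \<in> F" "t \<in> {0..1}" for q t
        using W(2) that by (auto simp: set_eq_iff)
      have "{p} \<times> K \<subseteq> W"
        using p K(2) W_iff by auto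
      from Elementary_Topology.tube_lemma[OF K(1) W(1) this] obtain V where V: "p \<in> V" "open V" "V \<times> K \<subseteq> W"
        by blast
      show "\<exists>T. openin (top_of_set F) T \<and> p \<in> T \<and> T \<subseteq> {p \<in> F. \<forall>t\<in>K. h p t \<in> U}"
      proof (intro exI conjI)
        show "openin (top_of_set F) (F \<inter> V)"
          using V by (intro openin_open_Int)
        show "F \<inter> V \<subseteq> {p \<in> F. \<forall>t\<in>K. h p t \<in> U}"
          using V(3) W_iff K(2) by blast
      qed (use p V in auto)
    qed
    ultimately show "openin (top_of_set F) ((\<lambda>p. restrict (h p) {0..1}) -` O' \<inter> topspace (top_of_set F))"
      by simp
  next
    have "(\<lambda>p. restrict (h p) {0..1}) ` F \<subseteq> topspace (path_space X)"
    proof (rule image_subsetI)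
      fix p assume p: "p \<in> F"
      have "continuous_on {0..1} (restrict (h p) {0..1})"
        using slice[of p] p by (auto cong: continuous_on_cong_simp)
      then show "restrict (h p) {0..1} \<in> topspace (path_space X)"
        using X[OF p] by (auto simp: topspace_path_space path_def path_image_def)
    qed
    then show "(\<lambda>p. restrict (h p) {0..1}) ` topspace (top_of_set F) \<subseteq>
      \<Union>{{f \<in> topspace (top_of_set {0..1 :: real}) \<rightarrow>\<^sub>E topspace (top_of_set X).
        continuous_map (top_of_set {0..1}) (top_of_set X) f \<and> f ` K \<subseteq> U} | K U.
          compactin (top_of_set {0..1}) K \<and> openin (top_of_set X) U}"
      by (simp add: path_space_def compact_open_topology_def)
  qed
qed

section \<open>Regrouping the domains of a motion planner\<close>

lemma card_le_order_of_instability: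
  assumes "I \<subseteq> {1..k}" "(\<Inter>i\<in>I. top_of_set (X \<times> X) closure_of F i) \<noteq> {}"
  shows "card I \<le> order_of_instability X k F"
proof -
  let ?A = "{card I | I. I \<subseteq> {1..k} \<and> (\<Inter>i\<in>I. top_of_set (X \<times> X) closure_of F i) \<noteq> {}}"
  have "?A \<subseteq> card ` Pow {1..k}"
    by auto
  then have "finite ?A"
    by (rule finite_subset) simp
  then show ?thesis
    unfolding order_of_instability_def using assms by (intro Max_ge) auto
qed

lemma continuous_on_Union_disjoint:
  fixes \<V> :: "'a::topological_space set set"
  assumes ope: "\<And>V. V \<in> \<V> \<Longrightarrow> openin (top_of_set Z) V" and dis: "disjoint \<V>"
    and H: "\<And>V. V \<in> \<V> \<Longrightarrow> continuous_on (V \<times> I) (H V)"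
  shows "continuous_on (\<Union>\<V> \<times> I) (\<lambda>z. H (THE V. V \<in> \<V> \<and> fst z \<in> V) z)" (is "continuous_on _ ?G")
proof -
  have the: "(THE V. V \<in> \<V> \<and> x \<in> V) = V" if "V \<in> \<V>" "x \<in> V" for x V
    using that dis by (intro the_equality) (auto simp: disjoint_def)
  have "continuous_map (top_of_set (\<Union>\<V> \<times> I)) euclidean ?G"
  proof (rule pasting_lemma[where I = \<V> and T = "\<lambda>V. V \<times> I" and f = H])
    show "openin (top_of_set (\<Union>\<V> \<times> I)) (V \<times> I)" if V: "V \<in> \<V>" for V
    proof -
      obtain U where U: "open U" "V = Z \<inter> U"
        using ope[OF V] by (auto simp: openin_open)
      have "\<Union>\<V> \<subseteq> Z"
        using ope openin_imp_subset by blast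
      then have "V \<times> I = (\<Union>\<V> \<times> I) \<inter> (U \<times> UNIV)"
        using U V by blast
      then show ?thesis
        using U(1) by (auto intro!: openin_open_Int open_Times)
    qed
    show "continuous_map (subtopology (top_of_set (\<Union>\<V> \<times> I)) (V \<times> I)) euclidean (H V)" if "V \<in> \<V>" for V
    proof -
      have "\<Union>\<V> \<times> I \<inter> V \<times> I = V \<times> I"
        using that by blast
      then show ?thesis
        using H[OF that] by (simp add: subtopology_subtopology)
    qed
    show "H V z = H V' z" if "V \<in> \<V>" "V' \<in> \<V>" "z \<in> topspace (top_of_set (\<Union>\<V> \<times> I)) \<inter> V \<times> I \<inter> V' \<times> I" for V V' z
    proof -
      have "V = V'"
        using that the[of V "fst z"] the[of V' "fst z"] by auto
      then show ?thesis
        by simp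
    qed
    show "\<exists>V. V \<in> \<V> \<and> z \<in> V \<times> I \<and> ?G z = H V z" if z: "z \<in> topspace (top_of_set (\<Union>\<V> \<times> I))" for z
    proof -
      obtain V where "V \<in> \<V>" "z \<in> V \<times> I"
        using z by auto
      then show ?thesis
        using the[of V "fst z"] by (intro exI[of _ V]) auto
    qed
  qed
  then show ?thesis
    by simp
qed

text \<open>A homotopy over a set of pairs that joins the two projections up to an error that is small
  in the coordinates \<open>g\<close>.\<close>

definition almost_joined :: "'a::topological_space set \<Rightarrow> ('j \<Rightarrow> 'a \<Rightarrow> 'b::metric_space) \<Rightarrow> 'j set \<Rightarrow> real \<Rightarrow>
    ('a \<times> 'a) set \<Rightarrow> (('a \<times> 'a) \<times> real \<Rightarrow> 'a) \<Rightarrow> bool" where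
  "almost_joined X g J \<epsilon> V H \<longleftrightarrow>
     continuous_on (V \<times> {0..1}) H \<and> H ` (V \<times> {0..1}) \<subseteq> X \<and>
     (\<forall>z\<in>V. \<forall>j\<in>J. dist (g j (H (z, 0))) (g j (fst z)) < \<epsilon> \<and> dist (g j (H (z, 1))) (g j (snd z)) < \<epsilon>)"

lemma almost_joined_subset: "almost_joined X g J \<epsilon> V H \<Longrightarrow> W \<subseteq> V \<Longrightarrow> almost_joined X g J \<epsilon> W H"
  unfolding almost_joined_def by (blast intro: continuous_on_subset)

lemma almost_joined_Union:
  assumes ope: "\<And>V. V \<in> \<V> \<Longrightarrow> openin (top_of_set Z) V" and dis: "disjoint \<V>"
    and ex: "\<And>V. V \<in> \<V> \<Longrightarrow> \<exists>H. almost_joined X g J \<epsilon> V H"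
  shows "\<exists>H. almost_joined X g J \<epsilon> (\<Union>\<V>) H"
proof -
  obtain H where H: "\<And>V. V \<in> \<V> \<Longrightarrow> almost_joined X g J \<epsilon> V (H V)"
    using ex by metis
  have the: "(THE V. V \<in> \<V> \<and> x \<in> V) = V" if "V \<in> \<V>" "x \<in> V" for x V
    using that dis by (intro the_equality) (auto simp: disjoint_def)
  let ?G = "\<lambda>z. H (THE V. V \<in> \<V> \<and> fst z \<in> V) z"
  have "continuous_on (\<Union>\<V> \<times> {0..1}) ?G"
    using ope dis H by (intro continuous_on_Union_disjoint) (auto simp: almost_joined_def)
  moreover have "?G ` (\<Union>\<V> \<times> {0..1}) \<subseteq> X"
  proof (rule image_subsetI)
    fix z assume "z \<in> \<Union>\<V> \<times> {0..1::real}"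
    then obtain V where V: "V \<in> \<V>" "z \<in> V \<times> {0..1}"
      by auto
    then show "?G z \<in> X"
      using H[OF V(1)] the[OF V(1), of "fst z"] by (auto simp: almost_joined_def)
  qed
  moreover have "dist (g j (?G (z, 0))) (g j (fst z)) < \<epsilon> \<and> dist (g j (?G (z, 1))) (g j (snd z)) < \<epsilon>"
    if z: "z \<in> \<Union>\<V>" and "j \<in> J" for z j
  proof -
    obtain V where V: "V \<in> \<V>" "z \<in> V"
      using z by auto
    then show ?thesis
      using H[OF V(1)] the[OF V] \<open>j \<in> J\<close> by (simp add: almost_joined_def)
  qed
  ultimately show ?thesis
    unfolding almost_joined_def by (intro exI[of _ ?G]) blast
qed

text \<open>With a retraction r of a neighbourhood onto F, the path chosen for z is that of
  \<open>r z\<close>. Its ends are the components of \<open>r z\<close>, which agree with those of z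
  on F; near F the coordinates g therefore differ by less than \<epsilon>.\<close>

lemma almost_joined_near_ENR:
  fixes X :: "'a::euclidean_space set" and g :: "'j \<Rightarrow> 'a \<Rightarrow> 'b::metric_space"
  assumes F: "ENR F" "F \<subseteq> X \<times> X"
    and s: "continuous_map (top_of_set F) (path_space X) s" "\<And>p. p \<in> F \<Longrightarrow> endpoints (s p) = p"
    and Z: "Z \<subseteq> X \<times> X" and J: "finite J" and g: "\<And>j. j \<in> J \<Longrightarrow> continuous_on X (g j)" and "\<epsilon> > 0"
  obtains W H where "openin (top_of_set Z) W" "F \<inter> Z \<subseteq> W" "almost_joined X g J \<epsilon> W H"
proof -
  obtain U where U: "open U" "F retract_of U"
    using F(1) by (auto simp: ENR_def)
  then obtain r where r: "F \<subseteq> U" "continuous_on U r" "r ` U \<subseteq> F" "\<And>x. x \<in> F \<Longrightarrow> r x = x"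
    by (auto simp: retract_of_def retraction_def Pi_iff image_subset_iff)
  have rX: "fst (r z) \<in> X" "snd (r z) \<in> X" if "z \<in> U" for z
    using that r(3) F(2) by fastforce+
  define \<phi> where "\<phi> z = (\<Sum>j\<in>J. dist (g j (fst (r z))) (g j (fst z)) + dist (g j (snd (r z))) (g j (snd z)))" for z
  have cont: "continuous_on (Z \<inter> U) \<phi>"
    unfolding \<phi>_def
  proof (intro continuous_on_sum continuous_on_add continuous_on_dist)
    fix j assume "j \<in> J"
    note c = continuous_on_compose2[OF g[OF this]]
    have r': "continuous_on (Z \<inter> U) r"
      using r(2) by (rule continuous_on_subset) auto
    show "continuous_on (Z \<inter> U) (\<lambda>z. g j (fst (r z)))" "continuous_on (Z \<inter> U) (\<lambda>z. g j (snd (r z)))"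
      using rX by (intro c continuous_intros r'; blast)+
    show "continuous_on (Z \<inter> U) (\<lambda>z. g j (fst z))" "continuous_on (Z \<inter> U) (\<lambda>z. g j (snd z))"
      using Z by (intro c continuous_intros; fastforce)+
  qed
  define W where "W = Z \<inter> U \<inter> \<phi> -` {..<\<epsilon>}"
  have "openin (top_of_set (Z \<inter> U)) W"
    unfolding W_def using cont open_lessThan by (rule continuous_openin_preimage_gen)
  then have "openin (top_of_set Z) W"
    using openin_open_Int[OF U(1), of Z] openin_trans by blast
  moreover have "F \<inter> Z \<subseteq> W"
    using r \<open>\<epsilon> > 0\<close> by (auto simp: W_def \<phi>_def)
  moreover define H where "H = (\<lambda>(z, t). s (r z) t)"
  have sF: "s q \<in> topspace (path_space X)" if "q \<in> F" for q
    using continuous_map_funspace[OF s(1)] that by auto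
  have "almost_joined X g J \<epsilon> W H"
    unfolding almost_joined_def
  proof (intro conjI ballI)
    have "continuous_on (W \<times> {0..1}) ((\<lambda>(p, t). s p t) \<circ> (\<lambda>z. (r (fst z), snd z)))"
    proof (intro continuous_on_compose continuous_on_subset[OF continuous_on_path_space_eval[OF s(1)]])
      have "W \<subseteq> U"
        by (auto simp: W_def)
      then show "continuous_on (W \<times> {0..1::real}) (\<lambda>z. (r (fst z), snd z))"
        by (intro continuous_on_Pair continuous_on_compose2[OF r(2)] continuous_intros) auto
      show "(\<lambda>z. (r (fst z), snd z)) ` (W \<times> {0..1::real}) \<subseteq> F \<times> {0..1}"
        using r(3) by (auto simp: W_def)
    qed
    then show "continuous_on (W \<times> {0..1}) H"
      by (simp add: H_def o_def case_prod_unfold)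
    show "H ` (W \<times> {0..1}) \<subseteq> X"
    proof clarify
      fix z and t :: real assume "z \<in> W" "t \<in> {0..1}"
      then have "r z \<in> F"
        using r(3) by (auto simp: W_def)
      from sF[OF this] \<open>t \<in> {0..1}\<close> show "H (z, t) \<in> X"
        by (auto simp: H_def topspace_path_space path_image_def)
    qed
    fix z j assume z: "z \<in> W" and j: "j \<in> J"
    then have "r z \<in> F"
      using r(3) by (auto simp: W_def)
    from s(2)[OF this] have e: "H (z, 0) = fst (r z)" "H (z, 1) = snd (r z)"
      by (auto simp: H_def endpoints_def pathstart_def pathfinish_def prod_eq_iff)
    have "dist (g j (fst (r z))) (g j (fst z)) + dist (g j (snd (r z))) (g j (snd z)) \<le> \<phi> z"
      unfolding \<phi>_def using j J by (intro member_le_sum) auto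
    also have "\<dots> < \<epsilon>"
      using z by (simp add: W_def)
    finally have "dist (g j (fst (r z))) (g j (fst z)) + dist (g j (snd (r z))) (g j (snd z)) < \<epsilon>" .
    moreover have "0 \<le> dist (g j (fst (r z))) (g j (fst z))" "0 \<le> dist (g j (snd (r z))) (g j (snd z))"
      by simp_all
    ultimately show "dist (g j (H (z, 0))) (g j (fst z)) < \<epsilon>" "dist (g j (H (z, 1))) (g j (snd z)) < \<epsilon>"
      unfolding e by linarith+
  qed
  ultimately show thesis
    by (rule that)
qed

text \<open>Each point of Z lies in at most r closures. The set \<open>A I\<close> of points outside
  all closures not indexed by I is open, so a Lebesgue number of this cover turns the pointwise
  bound into a uniform one for neighbourhoods.\<close>

lemma motion_planner_nerve:
  assumes mp: "motion_planner X k F s" and ord: "order_of_instability X k F \<le> r"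
    and Z: "compact Z" "Z \<subseteq> X \<times> X"
  obtains \<delta> where "\<delta> > 0" "\<And>z. z \<in> Z \<Longrightarrow> card {i \<in> {1..k}. \<exists>y\<in>F i. dist y z < \<delta>} \<le> r"
proof -
  let ?I = "{I. I \<subseteq> {1..k} \<and> card I \<le> r}"
  define A where "A I = - (\<Union>j\<in>{1..k} - I. closure (F j))" for I
  have F: "F i \<subseteq> X \<times> X" if "i \<in> {1..k}" for i
    using mp that unfolding motion_planner_def by blast
  have sub: "Z \<subseteq> \<Union>(A ` ?I)"
  proof
    fix z assume z: "z \<in> Z"
    define I where "I = {i \<in> {1..k}. z \<in> closure (F i)}"
    have "z \<in> top_of_set (X \<times> X) closure_of F i" if "i \<in> I" for i
    proof -
      have "X \<times> X \<inter> F i = F i"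
        using F[of i] that by (auto simp: I_def)
      then show ?thesis
        using that z Z(2) by (auto simp: closure_of_subtopology I_def)
    qed
    then have "card I \<le> order_of_instability X k F"
      by (intro card_le_order_of_instability) (auto simp: I_def)
    with ord have "I \<in> ?I"
      by (auto simp: I_def)
    moreover have "z \<in> A I"
      by (auto simp: A_def I_def)
    ultimately show "z \<in> \<Union>(A ` ?I)"
      by blast
  qed
  have opn: "open G" if "G \<in> A ` ?I" for G
  proof -
    have "closed (\<Union>j\<in>{1..k} - I. closure (F j))" for I
      by (intro closed_UN) auto
    then show ?thesis
      using that by (auto simp: A_def)
  qed
  obtain \<delta> where \<delta>: "0 < \<delta>" "\<And>z. z \<in> Z \<Longrightarrow> \<exists>G\<in>A ` ?I. ball z \<delta> \<subseteq> G"
    using Heine_Borel_lemma[OF Z(1) sub opn] by blast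
  have "card {i \<in> {1..k}. \<exists>y\<in>F i. dist y z < \<delta>} \<le> r" if z: "z \<in> Z" for z
  proof -
    obtain I where I: "I \<subseteq> {1..k}" "card I \<le> r" "ball z \<delta> \<subseteq> A I"
      using \<delta>(2)[OF z] by blast
    have "{i \<in> {1..k}. \<exists>y\<in>F i. dist y z < \<delta>} \<subseteq> I"
    proof (rule subsetI, rule ccontr)
      fix i assume "i \<in> {i \<in> {1..k}. \<exists>y\<in>F i. dist y z < \<delta>}" "i \<notin> I"
      then obtain y where "i \<in> {1..k} - I" "y \<in> F i" "y \<in> ball z \<delta>"
        by (auto simp: dist_commute)
      moreover from this have "y \<in> closure (F i)"
        using closure_subset by blast
      ultimately show False
        using I(3) by (auto simp: A_def)
    qed
    then show ?thesis
      using I card_mono[of I] finite_subset[of I "{1..k}"] by (meson finite_atLeastAtMost order_trans)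
  qed
  with \<delta>(1) show thesis
    by (rule that)
qed

text \<open>Compact pieces are wanted for uniform continuity of the homotopies. With a Lebesgue
  number \<epsilon>, discarding from each set the points closer than \<epsilon> / 2 to its
  complement still leaves room for every set of diameter below \<epsilon> / 2.\<close>

lemma compact_open_shrinking:
  fixes V :: "nat \<Rightarrow> 'a::heine_borel set"
  assumes Z: "compact Z" and V: "\<And>d. d < r \<Longrightarrow> openin (top_of_set Z) (V d)" and cover: "Z \<subseteq> (\<Union>d<r. V d)"
  shows "\<exists>C \<delta>. \<delta> > 0 \<and> (\<forall>d<r. compact (C d) \<and> C d \<subseteq> Z \<inter> V d) \<and>
    (\<forall>S. S \<subseteq> Z \<and> S \<noteq> {} \<and> (\<forall>x\<in>S. \<forall>y\<in>S. dist x y < \<delta>) \<longrightarrow> (\<exists>d<r. S \<subseteq> C d))"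
proof -
  have "\<forall>d. \<exists>U. d < r \<longrightarrow> open U \<and> V d = Z \<inter> U"
    using V by (auto simp: openin_open)
  then obtain O' where O': "\<And>d. d < r \<Longrightarrow> open (O' d)" "\<And>d. d < r \<Longrightarrow> V d = Z \<inter> O' d"
    by metis
  have sub: "Z \<subseteq> \<Union>(O' ` {..<r})"
    using cover O'(2) by auto
  have opn: "open G" if "G \<in> O' ` {..<r}" for G
    using O'(1) that by auto
  obtain \<epsilon> where \<epsilon>: "0 < \<epsilon>" "\<And>z. z \<in> Z \<Longrightarrow> \<exists>G\<in>O' ` {..<r}. ball z \<epsilon> \<subseteq> G"
    using Heine_Borel_lemma[OF Z sub opn] by blast
  define C where "C d = Z - (\<Union>y\<in>Z - V d. ball y (\<epsilon> / 2))" for d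
  have "compact (C d)" for d
    unfolding C_def by (intro compact_diff Z open_UN) auto
  moreover have "C d \<subseteq> Z \<inter> V d" for d
    using \<epsilon>(1) by (auto simp: C_def)
  moreover have "\<exists>d<r. S \<subseteq> C d"
    if S: "S \<subseteq> Z" "S \<noteq> {}" "\<forall>x\<in>S. \<forall>y\<in>S. dist x y < \<epsilon> / 2" for S
  proof -
    obtain z where z: "z \<in> S"
      using S(2) by blast
    then obtain d where d: "d < r" "ball z \<epsilon> \<subseteq> O' d"
      using \<epsilon>(2) S(1) by blast
    have "S \<subseteq> C d"
    proof
      fix x assume x: "x \<in> S"
      have False if y: "y \<in> Z" "y \<notin> V d" "dist y x < \<epsilon> / 2" for y
      proof -
        have "dist z y \<le> dist z x + dist y x"
          by (rule dist_triangle2)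
        then have "y \<in> ball z \<epsilon>"
          using S(3) z x y(3) by fastforce
        then show False
          using d y O'(2) by auto
      qed
      then show "x \<in> C d"
        using x S(1) by (auto simp: C_def)
    qed
    with d show ?thesis
      by blast
  qed
  ultimately show ?thesis
    using \<epsilon>(1) by (intro exI[of _ C] exI[of _ "\<epsilon> / 2"]) simp
qed

text \<open>Take a function \<open>\<phi> i\<close> that is positive exactly on \<open>O' i\<close>. The members of \<open>\<V> d\<close> consist of the points
  whose \<open>d + 1\<close> largest values \<open>\<phi> i\<close> are positive and belong to a given index set; two of them are
  disjoint because their index sets have the same size.\<close>

lemma regroup_open_cover:
  fixes O' :: "nat \<Rightarrow> 'a::heine_borel set"
  assumes Z: "compact Z" and ope: "\<And>i. i \<in> {1..k} \<Longrightarrow> openin (top_of_set Z) (O' i)"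
    and cover: "Z \<subseteq> (\<Union>i\<in>{1..k}. O' i)"
    and mult: "\<And>z. z \<in> Z \<Longrightarrow> card {i \<in> {1..k}. z \<in> O' i} \<le> r"
  shows "\<exists>\<V>. (\<forall>d. \<forall>V\<in>\<V> d. openin (top_of_set Z) V \<and> (\<exists>i\<in>{1..k}. V \<subseteq> O' i)) \<and>
     (\<forall>d. disjoint (\<V> d)) \<and> Z \<subseteq> (\<Union>d<r. \<Union>(\<V> d))"
proof -
  \<comment> \<open>The distance \<open>infdist\<close> to the empty set is 0, so a set that
    contains all of Z is given the constant value 1 instead.\<close>
  define \<phi> where "\<phi> i z = (if Z \<subseteq> O' i then 1 else infdist z (Z - O' i))" for i z
  have cont: "continuous_on UNIV (\<phi> i)" for i
    unfolding \<phi>_def by (cases "Z \<subseteq> O' i") (auto intro!: continuous_intros)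
  have nonneg: "0 \<le> \<phi> i z" for i z
    by (simp add: \<phi>_def infdist_nonneg)
  have pos: "0 < \<phi> i z \<longleftrightarrow> z \<in> O' i" if "i \<in> {1..k}" "z \<in> Z" for i z
  proof (cases "Z \<subseteq> O' i")
    case False
    have "closed (Z - O' i)"
      using Z ope[OF that(1)] by (metis closedin_closed_trans closedin_diff closedin_topspace compact_imp_closed topspace_euclidean_subtopology)
    then have "infdist z (Z - O' i) = 0 \<longleftrightarrow> z \<in> Z - O' i"
      using False by (subst in_closed_iff_infdist_zero) auto
    then show ?thesis
      using False that nonneg[of i z] by (auto simp: \<phi>_def less_le)
  qed (use that in \<open>auto simp: \<phi>_def\<close>)
  define V where "V I = Z \<inter> {z. \<forall>i\<in>I. 0 < \<phi> i z \<and> (\<forall>j\<in>{1..k} - I. \<phi> j z < \<phi> i z)}" for I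
  define \<V> where "\<V> d = V ` {I. I \<subseteq> {1..k} \<and> card I = Suc d}" for d
  show ?thesis
  proof (intro exI[of _ \<V>] conjI allI ballI)
    fix d W assume "W \<in> \<V> d"
    then obtain I where I: "I \<subseteq> {1..k}" "card I = Suc d" "W = V I"
      by (auto simp: \<V>_def)
    have "finite I"
      using I(1) finite_subset by blast
    moreover have "{z. \<forall>i\<in>I. 0 < \<phi> i z \<and> (\<forall>j\<in>{1..k} - I. \<phi> j z < \<phi> i z)} =
        (\<Inter>i\<in>I. {z. 0 < \<phi> i z} \<inter> (\<Inter>j\<in>{1..k} - I. {z. \<phi> j z < \<phi> i z}))"
      by auto
    ultimately have "open {z. \<forall>i\<in>I. 0 < \<phi> i z \<and> (\<forall>j\<in>{1..k} - I. \<phi> j z < \<phi> i z)}"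
      using cont by (auto intro!: open_INT open_Int open_Collect_less)
    then show "openin (top_of_set Z) W"
      unfolding I(3) V_def by (rule openin_open_Int)
    obtain i where "i \<in> I"
      using I(2) by fastforce
    moreover have i: "i \<in> {1..k}"
      using \<open>i \<in> I\<close> I(1) by blast
    ultimately have "W \<subseteq> O' i"
      using pos[OF i] by (auto simp: I(3) V_def)
    with i show "\<exists>i\<in>{1..k}. W \<subseteq> O' i" ..
  next
    fix d
    show "disjoint (\<V> d)"
      unfolding disjoint_def
    proof (intro ballI impI, rule ccontr)
      fix A B assume "A \<in> \<V> d" "B \<in> \<V> d" "A \<noteq> B" "A \<inter> B \<noteq> {}"
      then obtain I I' z where I: "I \<subseteq> {1..k}" "I' \<subseteq> {1..k}" "card I = Suc d" "card I' = Suc d" "I \<noteq> I'"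
        "z \<in> V I" "z \<in> V I'"
        by (auto simp: \<V>_def)
      have fin: "finite I" "finite I'"
        using I finite_subset by blast+
      have "\<not> I \<subseteq> I'" "\<not> I' \<subseteq> I"
        using I card_subset_eq[OF fin(2), of I] card_subset_eq[OF fin(1), of I'] by auto
      then obtain i j where ij: "i \<in> I" "i \<notin> I'" "j \<in> I'" "j \<notin> I"
        by blast
      then have "\<phi> j z < \<phi> i z" "\<phi> i z < \<phi> j z"
        using I by (auto simp: V_def)
      then show False
        by simp
    qed
  next
    show "Z \<subseteq> (\<Union>d<r. \<Union>(\<V> d))"
    proof
      fix z assume z: "z \<in> Z"
      \<comment> \<open>For this I the values outside are zero and those inside positive. Its size d
        + 1 is at most r, hence d < r.\<close>
      define I where "I = {i \<in> {1..k}. z \<in> O' i}"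
      have "I \<noteq> {}"
        using cover z unfolding I_def by blast
      moreover have "finite I"
        by (simp add: I_def)
      ultimately obtain d where d: "card I = Suc d"
        by (metis card_eq_0_iff not0_implies_Suc)
      have "\<phi> j z = 0" if "j \<in> {1..k} - I" for j
        using pos[of j z] nonneg[of j z] that z by (auto simp: I_def)
      then have "z \<in> V I"
        using z pos by (auto simp: V_def I_def)
      moreover have "d < r"
        using mult[OF z] d by (simp add: I_def)
      ultimately show "z \<in> (\<Union>d<r. \<Union>(\<V> d))"
      proof -
        have "V I \<in> \<V> d"
          unfolding \<V>_def using d by (intro imageI) (auto simp: I_def)
        with \<open>z \<in> V I\<close> \<open>d < r\<close> show ?thesis
          by blast
      qed
    qed
  qed
qed

lemma motion_planner_cover:
  fixes X :: "'a::euclidean_space set" and g :: "'j \<Rightarrow> 'a \<Rightarrow> 'b::metric_space"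
  assumes mp: "motion_planner X k F s" and ord: "order_of_instability X k F \<le> r"
    and Z: "compact Z" "Z \<subseteq> X \<times> X"
    and J: "finite J" "\<And>j. j \<in> J \<Longrightarrow> continuous_on X (g j)" and "\<epsilon> > 0"
  shows "\<exists>C H \<delta>. \<delta> > 0 \<and>
    (\<forall>d<r. compact (C d) \<and> C d \<subseteq> Z \<and> almost_joined X g J \<epsilon> (C d) (H d)) \<and>
    (\<forall>S. S \<subseteq> Z \<and> S \<noteq> {} \<and> (\<forall>x\<in>S. \<forall>y\<in>S. dist x y < \<delta>) \<longrightarrow> (\<exists>d<r. S \<subseteq> C d))"
proof -
  have F: "F i \<subseteq> X \<times> X" "ENR (F i)" "continuous_map (top_of_set (F i)) (path_space X) (s i)"
    "\<And>p. p \<in> F i \<Longrightarrow> endpoints (s i p) = p" if "i \<in> {1..k}" for i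
    using mp that unfolding motion_planner_def by blast+
  have cov: "(\<Union>i\<in>{1..k}. F i) = X \<times> X"
    using mp by (simp add: motion_planner_def)
  obtain \<delta> where \<delta>: "\<delta> > 0" "\<And>z. z \<in> Z \<Longrightarrow> card {i \<in> {1..k}. \<exists>y\<in>F i. dist y z < \<delta>} \<le> r"
    by (rule motion_planner_nerve[OF mp ord Z], erule that, blast)
  have "\<forall>i. \<exists>W H. i \<in> {1..k} \<longrightarrow>
      openin (top_of_set Z) W \<and> F i \<inter> Z \<subseteq> W \<and> almost_joined X g J \<epsilon> W H"
  proof
    fix i
    show "\<exists>W H. i \<in> {1..k} \<longrightarrow>
      openin (top_of_set Z) W \<and> F i \<inter> Z \<subseteq> W \<and> almost_joined X g J \<epsilon> W H"
    proof (cases "i \<in> {1..k}")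
      case True
      show ?thesis
        by (rule almost_joined_near_ENR[OF F(2)[OF True] F(1)[OF True] F(3)[OF True] F(4)[OF True] Z(2) J \<open>\<epsilon> > 0\<close>])
           blast+
    qed blast
  qed
  then obtain W H where W: "\<And>i. i \<in> {1..k} \<Longrightarrow>
      openin (top_of_set Z) (W i) \<and> F i \<inter> Z \<subseteq> W i \<and> almost_joined X g J \<epsilon> (W i) (H i)"
    by metis
  \<comment> \<open>The neighbourhoods \<open>W i\<close> alone may overlap too much; cutting them
    down to the \<delta>-neighbourhood of \<open>F i\<close> restores the multiplicity r, and
    \<open>F i \<inter> Z\<close> is still covered.\<close>
  define O' where "O' i = W i \<inter> (\<Union>y\<in>F i. ball y \<delta>)" for i
  have 1: "openin (top_of_set Z) (O' i)" if "i \<in> {1..k}" for i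
  proof -
    have "openin (top_of_set Z) (Z \<inter> (\<Union>y\<in>F i. ball y \<delta>))"
      by (intro openin_open_Int open_UN) auto
    moreover have "O' i = W i \<inter> (Z \<inter> (\<Union>y\<in>F i. ball y \<delta>))"
      using W[OF that] openin_imp_subset by (fastforce simp: O'_def)
    ultimately show ?thesis
      using W[OF that] by (simp add: openin_Int)
  qed
  have 2: "Z \<subseteq> (\<Union>i\<in>{1..k}. O' i)"
  proof
    fix z assume "z \<in> Z"
    then obtain i where i: "i \<in> {1..k}" "z \<in> F i"
      using Z(2) cov by blast
    then have "z \<in> O' i"
      using W[OF i(1)] \<open>z \<in> Z\<close> \<delta>(1) by (auto simp: O'_def intro!: bexI[of _ z])
    with i show "z \<in> (\<Union>i\<in>{1..k}. O' i)"
      by blast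
  qed
  have 3: "card {i \<in> {1..k}. z \<in> O' i} \<le> r" if "z \<in> Z" for z
  proof -
    have "card {i \<in> {1..k}. z \<in> O' i} \<le> card {i \<in> {1..k}. \<exists>y\<in>F i. dist y z < \<delta>}"
      by (intro card_mono) (auto simp: O'_def)
    then show ?thesis
      using \<delta>(2)[OF that] by linarith
  qed
  have "\<exists>\<V>. (\<forall>d. \<forall>V\<in>\<V> d. openin (top_of_set Z) V \<and> (\<exists>i\<in>{1..k}. V \<subseteq> O' i)) \<and>
     (\<forall>d. disjoint (\<V> d)) \<and> Z \<subseteq> (\<Union>d<r. \<Union>(\<V> d))"
    by (rule regroup_open_cover[OF Z(1) 1 2 3])
  then obtain \<V> where "\<forall>d. \<forall>V\<in>\<V> d. openin (top_of_set Z) V \<and> (\<exists>i\<in>{1..k}. V \<subseteq> O' i)"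
     "\<forall>d. disjoint (\<V> d)" and cov\<V>: "Z \<subseteq> (\<Union>d<r. \<Union>(\<V> d))"
    by (elim exE conjE)
  then have \<V>: "\<And>d V. V \<in> \<V> d \<Longrightarrow> openin (top_of_set Z) V"
    "\<And>d V. V \<in> \<V> d \<Longrightarrow> \<exists>i\<in>{1..k}. V \<subseteq> O' i" "\<And>d. disjoint (\<V> d)"
    by simp_all
  have "\<exists>H. almost_joined X g J \<epsilon> (\<Union>(\<V> d)) H" for d
  proof (rule almost_joined_Union[OF \<V>(1) \<V>(3)])
    fix V assume "V \<in> \<V> d"
    then obtain i where "i \<in> {1..k}" "V \<subseteq> O' i"
      using \<V>(2) by blast
    moreover have "O' i \<subseteq> W i"
      by (auto simp: O'_def)
    ultimately show "\<exists>H. almost_joined X g J \<epsilon> V H"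
      using W almost_joined_subset by (metis order_trans)
  qed
  then obtain H' where H': "\<And>d. almost_joined X g J \<epsilon> (\<Union>(\<V> d)) (H' d)"
    by metis
  have "openin (top_of_set Z) (\<Union>(\<V> d))" for d
    using \<V>(1) by blast
  from compact_open_shrinking[OF Z(1) this cov\<V>]
  obtain C \<delta>' where C: "\<delta>' > 0" "\<forall>d<r. compact (C d) \<and> C d \<subseteq> Z \<inter> \<Union>(\<V> d)"
    "\<forall>S. S \<subseteq> Z \<and> S \<noteq> {} \<and> (\<forall>x\<in>S. \<forall>y\<in>S. dist x y < \<delta>') \<longrightarrow> (\<exists>d<r. S \<subseteq> C d)"
    by (elim exE conjE)
  have "almost_joined X g J \<epsilon> (C d) (H' d)" if "d < r" for d
    using almost_joined_subset[OF H'[of d]] C(2) that by simp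
  with C show ?thesis
    by (intro exI[of _ C] exI[of _ H'] exI[of _ \<delta>']) simp
qed

section \<open>Homotopic maps pull back cohomologous cocycles\<close>

text \<open>Equality of the Alexander-Spanier classes of two pullbacks, with an explicit scale so
  that finitely many comparisons can be brought to a common one.\<close>

definition cohomologous_on :: "(real ^ 3 \<Rightarrow> real ^ 3 \<Rightarrow> real ^ 3 \<Rightarrow> int) \<Rightarrow> real \<Rightarrow> 'z::metric_space set \<Rightarrow>
    ('z \<Rightarrow> real ^ 3) \<Rightarrow> ('z \<Rightarrow> real ^ 3) \<Rightarrow> bool" where
  "cohomologous_on c \<delta> C f g \<longleftrightarrow>
     (\<exists>b. \<forall>x\<in>C. \<forall>y\<in>C. \<forall>z\<in>C. dist x y < \<delta> \<and> dist x z < \<delta> \<and> dist y z < \<delta> \<longrightarrow>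
        c (f x) (f y) (f z) - c (g x) (g y) (g z) = bd1 b x y z)"

lemma cohomologous_on_refl: "cohomologous_on c \<delta> C f f"
  unfolding cohomologous_on_def by (intro exI[of _ "\<lambda>_ _. 0"]) (simp add: bd1_def)

lemma cohomologous_on_trans:
  assumes "cohomologous_on c \<delta> C f g" "cohomologous_on c \<delta> C g h"
  shows "cohomologous_on c \<delta> C f h"
proof -
  obtain b where b: "\<forall>x\<in>C. \<forall>y\<in>C. \<forall>z\<in>C. dist x y < \<delta> \<and> dist x z < \<delta> \<and> dist y z < \<delta> \<longrightarrow>
        c (f x) (f y) (f z) - c (g x) (g y) (g z) = bd1 b x y z"
    using assms(1) unfolding cohomologous_on_def by blast
  obtain b' where b': "\<forall>x\<in>C. \<forall>y\<in>C. \<forall>z\<in>C. dist x y < \<delta> \<and> dist x z < \<delta> \<and> dist y z < \<delta> \<longrightarrow>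
        c (g x) (g y) (g z) - c (h x) (h y) (h z) = bd1 b' x y z"
    using assms(2) unfolding cohomologous_on_def by blast
  show ?thesis
    unfolding cohomologous_on_def
  proof (intro exI[of _ "\<lambda>x y. b x y + b' x y"] ballI impI)
    fix x y z assume "x \<in> C" "y \<in> C" "z \<in> C" "dist x y < \<delta> \<and> dist x z < \<delta> \<and> dist y z < \<delta>"
    with b b' have "c (f x) (f y) (f z) - c (g x) (g y) (g z) = bd1 b x y z"
      "c (g x) (g y) (g z) - c (h x) (h y) (h z) = bd1 b' x y z"
      by blast+
    then show "c (f x) (f y) (f z) - c (h x) (h y) (h z) = bd1 (\<lambda>x y. b x y + b' x y) x y z"
      by (simp add: bd1_def)
  qed
qed

lemma cohomologous_on_chain:
  assumes "\<And>l. l < n \<Longrightarrow> cohomologous_on c \<delta> C (h l) (h (Suc l))"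
  shows "cohomologous_on c \<delta> C (h 0) (h n)"
  using assms
proof (induction n)
  case 0
  show ?case
    by (rule cohomologous_on_refl)
next
  case (Suc n)
  then show ?case
    by (meson cohomologous_on_trans less_Suc_eq)
qed

lemma cohomologous_on_mono:
  assumes "cohomologous_on c \<delta> C f g" "\<delta>' \<le> \<delta>"
  shows "cohomologous_on c \<delta>' C f g"
proof -
  obtain b where b: "\<forall>x\<in>C. \<forall>y\<in>C. \<forall>z\<in>C. dist x y < \<delta> \<and> dist x z < \<delta> \<and> dist y z < \<delta> \<longrightarrow>
        c (f x) (f y) (f z) - c (g x) (g y) (g z) = bd1 b x y z"
    using assms(1) unfolding cohomologous_on_def by blast
  show ?thesis
    unfolding cohomologous_on_def
  proof (intro exI[of _ b] ballI impI)
    fix x y z assume *: "x \<in> C" "y \<in> C" "z \<in> C" "dist x y < \<delta>' \<and> dist x z < \<delta>' \<and> dist y z < \<delta>'"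
    then have "dist x y < \<delta> \<and> dist x z < \<delta> \<and> dist y z < \<delta>"
      using assms(2) by linarith
    with * b show "c (f x) (f y) (f z) - c (g x) (g y) (g z) = bd1 b x y z"
      by blast
  qed
qed

text \<open>The prism decomposition of the homotopy between two nearby maps.\<close>

lemma cohomologous_on_close:
  assumes c: "cocycle_on clustered c"
    and cl: "\<And>x y z. x \<in> C \<Longrightarrow> y \<in> C \<Longrightarrow> z \<in> C \<Longrightarrow> dist x y < \<delta> \<Longrightarrow> dist x z < \<delta> \<Longrightarrow> dist y z < \<delta> \<Longrightarrow>
      clustered {f x, f y, f z, g x, g y, g z}"
  shows "cohomologous_on c \<delta> C f g"
  unfolding cohomologous_on_def
proof (intro exI[of _ "\<lambda>x y. c (f x) (f y) (g y) - c (f x) (g x) (g y)"] ballI impI)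
  fix x y z assume "x \<in> C" "y \<in> C" "z \<in> C" "dist x y < \<delta> \<and> dist x z < \<delta> \<and> dist y z < \<delta>"
  then have S: "clustered {f x, f y, f z, g x, g y, g z}"
    using cl by blast
  have coc: "c q r s - c p r s + c p q s - c p q r = 0"
    if "{p, q, r, s} \<subseteq> {f x, f y, f z, g x, g y, g z}" for p q r s
    using c clustered_subset[OF S that] by (simp add: cocycle_on_def)
  have "c (f y) (f z) (g z) - c (f x) (f z) (g z) + c (f x) (f y) (g z) - c (f x) (f y) (f z) = 0"
    "c (f y) (g y) (g z) - c (f x) (g y) (g z) + c (f x) (f y) (g z) - c (f x) (f y) (g y) = 0"
    "c (g x) (g y) (g z) - c (f x) (g y) (g z) + c (f x) (g x) (g z) - c (f x) (g x) (g y) = 0"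
    by (rule coc; blast)+
  then show "c (f x) (f y) (f z) - c (g x) (g y) (g z) =
      bd1 (\<lambda>x y. c (f x) (f y) (g y) - c (f x) (g x) (g y)) x y z"
    by (simp add: bd1_def)
qed

text \<open>Uniform continuity allows the interval to be cut into L equal parts such that maps at
  consecutive times are close; the prism formula then applies to each part.\<close>

lemma cohomologous_on_homotopy:
  fixes G :: "'z::metric_space \<times> real \<Rightarrow> real ^ 3"
  assumes c: "cocycle_on clustered c" and C: "compact C"
    and G: "continuous_on (C \<times> {0..1}) G" "\<And>z. z \<in> C \<times> {0..1} \<Longrightarrow> norm (G z) = 1"
  obtains \<delta> where "\<delta> > 0" "cohomologous_on c \<delta> C (\<lambda>z. G (z, 0)) (\<lambda>z. G (z, 1))"
proof -
  have "uniformly_continuous_on (C \<times> {0..1}) G"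
    using G(1) C by (intro compact_uniformly_continuous compact_Times) auto
  from uniformly_continuous_onE[OF this, of "1 / 4"] obtain \<eta> where \<eta>: "\<eta> > 0"
    "\<And>z z'. z \<in> C \<times> {0..1} \<Longrightarrow> z' \<in> C \<times> {0..1} \<Longrightarrow> dist z' z < \<eta> \<Longrightarrow> dist (G z') (G z) < 1 / 4"
    by (metis zero_less_divide_1_iff zero_less_numeral)
  \<comment> \<open>Half of \<eta> is reserved for the distance in C and half for the distance in
    time.\<close>
  obtain L :: nat where L: "2 / \<eta> < L"
    using reals_Archimedean2 by blast
  then have L0: "L > 0"
    using \<eta>(1) by (cases L) (auto simp: not_less divide_less_0_iff)
  have step: "1 / real L < \<eta> / 2"
    using L \<eta>(1) L0 by (simp add: field_simps)
  have "cohomologous_on c (\<eta> / 2) C (\<lambda>z. G (z, real 0 / L)) (\<lambda>z. G (z, real L / L))"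
  proof (rule cohomologous_on_chain[where h = "\<lambda>l z. G (z, real l / L)"])
    fix l assume l: "l < L"
    show "cohomologous_on c (\<eta> / 2) C (\<lambda>z. G (z, real l / L)) (\<lambda>z. G (z, real (Suc l) / L))"
    proof (rule cohomologous_on_close[OF c])
      fix x y z assume C': "x \<in> C" "y \<in> C" "z \<in> C" and d: "dist x y < \<eta> / 2" "dist x z < \<eta> / 2" "dist y z < \<eta> / 2"
      define T where "T = {real l / L, real (Suc l) / L}"
      have T: "t \<in> {0..1}" if "t \<in> T" for t
        using that l by (auto simp: T_def)
      have Tclose: "\<bar>t - t'\<bar> \<le> 1 / L" if "t \<in> T" "t' \<in> T" for t t'
        using that by (auto simp: T_def add_divide_distrib)
      have close: "dist (G (u, t)) (G (v, t')) < 1 / 4" if "u \<in> {x, y, z}" "v \<in> {x, y, z}" "t \<in> T" "t' \<in> T" for u v t t'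
      proof (rule \<eta>(2))
        show "(v, t') \<in> C \<times> {0..1}" "(u, t) \<in> C \<times> {0..1}"
          using that C' T by auto
        have "dist u v < \<eta> / 2"
          using that d \<eta>(1) by (auto simp: dist_commute)
        moreover have "dist t t' < \<eta> / 2"
          using Tclose[OF that(3,4)] step by (simp add: dist_real_def)
        moreover have "dist (u, t) (v, t') \<le> dist u v + dist t t'"
          unfolding dist_Pair_Pair by (rule sqrt_sum_squares_le_sum) auto
        ultimately show "dist (u, t) (v, t') < \<eta>"
          by linarith
      qed
      have norm: "1 \<le> norm (G (u, t))" if "u \<in> {x, y, z}" "t \<in> T" for u t
        using G(2)[of "(u, t)"] that C' T by auto
      have "clustered (G ` ({x, y, z} \<times> T))"
        unfolding clustered_def using close norm by auto
      then show "clustered {G (x, real l / L), G (y, real l / L), G (z, real l / L),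
          G (x, real (Suc l) / L), G (y, real (Suc l) / L), G (z, real (Suc l) / L)}"
        by (rule clustered_subset) (auto simp: T_def)
    qed
  qed
  then show thesis
    using \<eta>(1) L0 by (intro that[of "\<eta> / 2"]) auto
qed

text \<open>Three comparisons are chained: the first projection with the start of the homotopy, its
  start with its end, and its end with the second projection. The outer two repair the error at the
  ends. With 1/16 for that error and for the oscillation of the projection, two points of the
  homotopy differ by less than 3/16, which is below 1/4.\<close>

lemma almost_joined_cohomologous:
  fixes X :: "'a::metric_space set" and g :: "'j \<Rightarrow> 'a \<Rightarrow> real ^ 3"
  assumes c: "cocycle_on clustered c" and C: "compact C" "C \<subseteq> X \<times> X"
    and H: "almost_joined X g J (1 / 16) C H" and j: "j \<in> J"
    and g: "continuous_on X (g j)" "\<And>x. x \<in> X \<Longrightarrow> norm (g j x) = 1"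
  shows "\<exists>\<delta>>0. cohomologous_on c \<delta> C (\<lambda>z. g j (fst z)) (\<lambda>z. g j (snd z))"
proof -
  have HX: "H (z, t) \<in> X" if "z \<in> C" "t \<in> {0..1}" for z t
    using H that by (auto simp: almost_joined_def)
  \<comment> \<open>Here p is one of the projections. Both directions are provided, since the chain
    leaves the first projection but arrives at the second.\<close>
  have ends: "\<exists>\<delta>>0. cohomologous_on c \<delta> C (\<lambda>z. g j (p z)) (\<lambda>z. g j (H (z, t))) \<and>
       cohomologous_on c \<delta> C (\<lambda>z. g j (H (z, t))) (\<lambda>z. g j (p z))"
    if p: "continuous_on C p" "p ` C \<subseteq> X" and t: "t \<in> {0..1}"
      and near: "\<And>z. z \<in> C \<Longrightarrow> dist (g j (H (z, t))) (g j (p z)) < 1 / 16" for p t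
  proof -
    have "uniformly_continuous_on C (\<lambda>z. g j (p z))"
      using p C(1) by (intro compact_uniformly_continuous continuous_on_compose2[OF g(1)])
    from uniformly_continuous_onE[OF this, of "1 / 16"] obtain \<eta> where \<eta>: "\<eta> > 0"
      "\<And>z z'. z \<in> C \<Longrightarrow> z' \<in> C \<Longrightarrow> dist z' z < \<eta> \<Longrightarrow> dist (g j (p z')) (g j (p z)) < 1 / 16"
      by (metis zero_less_divide_1_iff zero_less_numeral)
    have cl: "clustered ((\<lambda>z. g j (p z)) ` {x, y, z} \<union> (\<lambda>z. g j (H (z, t))) ` {x, y, z})"
      if C': "x \<in> C" "y \<in> C" "z \<in> C" and d: "dist x y < \<eta>" "dist x z < \<eta>" "dist y z < \<eta>" for x y z
    proof -
      have pp: "dist (g j (p u)) (g j (p v)) < 1 / 16" if "u \<in> {x, y, z}" "v \<in> {x, y, z}" for u v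
        using that C' d \<eta>(1) by (intro \<eta>(2)) (auto simp: dist_commute)
      have pH: "dist (g j (p u)) (g j (H (v, t))) < 1 / 8" if "u \<in> {x, y, z}" "v \<in> {x, y, z}" for u v
      proof -
        have "dist (g j (p u)) (g j (H (v, t))) \<le> dist (g j (p u)) (g j (p v)) + dist (g j (H (v, t))) (g j (p v))"
          by (rule dist_triangle2)
        then show ?thesis
          using pp[OF that] near[of v] that C' by auto
      qed
      have HH: "dist (g j (H (u, t))) (g j (H (v, t))) < 1 / 4" if "u \<in> {x, y, z}" "v \<in> {x, y, z}" for u v
      proof -
        have "dist (g j (H (u, t))) (g j (H (v, t))) \<le> dist (g j (H (u, t))) (g j (p u)) + dist (g j (p u)) (g j (H (v, t)))"
          by (rule dist_triangle)
        then show ?thesis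
          using pH[OF that] near[of u] that C' by auto
      qed
      have "1 \<le> norm q" if "q \<in> (\<lambda>z. g j (p z)) ` {x, y, z} \<union> (\<lambda>z. g j (H (z, t))) ` {x, y, z}" for q
      proof -
        have "norm (g j (p u)) = 1" "norm (g j (H (u, t))) = 1" if "u \<in> {x, y, z}" for u
        proof -
          have "u \<in> C"
            using that C' by blast
          then have "p u \<in> X" "H (u, t) \<in> X"
            using p(2) HX t by blast+
          then show "norm (g j (p u)) = 1" "norm (g j (H (u, t))) = 1"
            using g(2) by blast+
        qed
        then have "norm q = 1"
          using that by (elim UnE imageE) simp_all
        then show ?thesis
          by simp
      qed
      moreover have "dist q r < 1 / 4"
        if qr: "q \<in> (\<lambda>z. g j (p z)) ` {x, y, z} \<union> (\<lambda>z. g j (H (z, t))) ` {x, y, z}"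
          "r \<in> (\<lambda>z. g j (p z)) ` {x, y, z} \<union> (\<lambda>z. g j (H (z, t))) ` {x, y, z}" for q r
      proof -
        obtain u v where uv: "u \<in> {x, y, z}" "v \<in> {x, y, z}"
          "q = g j (p u) \<or> q = g j (H (u, t))" "r = g j (p v) \<or> r = g j (H (v, t))"
          using qr by blast
        show ?thesis
          using uv(3,4) pp[OF uv(1,2)] pH[OF uv(1,2)] pH[OF uv(2,1)] HH[OF uv(1,2)]
          by (auto simp: dist_commute)
      qed
      ultimately show ?thesis
        unfolding clustered_def by blast
    qed
    have "cohomologous_on c \<eta> C (\<lambda>z. g j (p z)) (\<lambda>z. g j (H (z, t)))"
    proof (rule cohomologous_on_close[OF c])
      fix x y z assume "x \<in> C" "y \<in> C" "z \<in> C" "dist x y < \<eta>" "dist x z < \<eta>" "dist y z < \<eta>"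
      from cl[OF this] show "clustered {g j (p x), g j (p y), g j (p z),
          g j (H (x, t)), g j (H (y, t)), g j (H (z, t))}"
        by (rule clustered_subset) simp
    qed
    moreover have "cohomologous_on c \<eta> C (\<lambda>z. g j (H (z, t))) (\<lambda>z. g j (p z))"
    proof (rule cohomologous_on_close[OF c])
      fix x y z assume "x \<in> C" "y \<in> C" "z \<in> C" "dist x y < \<eta>" "dist x z < \<eta>" "dist y z < \<eta>"
      from cl[OF this] show "clustered {g j (H (x, t)), g j (H (y, t)), g j (H (z, t)),
          g j (p x), g j (p y), g j (p z)}"
        by (rule clustered_subset) simp
    qed
    ultimately show ?thesis
      using \<eta>(1) by blast
  qed
  have near: "dist (g j (H (z, 0))) (g j (fst z)) < 1 / 16" "dist (g j (H (z, 1))) (g j (snd z)) < 1 / 16"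
    if "z \<in> C" for z
    using H that j by (auto simp: almost_joined_def)
  have proj: "fst ` C \<subseteq> X" "snd ` C \<subseteq> X"
    using C(2) by auto
  obtain \<delta>1 where 1: "\<delta>1 > 0" "cohomologous_on c \<delta>1 C (\<lambda>z. g j (fst z)) (\<lambda>z. g j (H (z, 0)))"
    using ends[OF continuous_on_fst[OF continuous_on_id] proj(1) _ near(1)] by auto
  obtain \<delta>2 where 2: "\<delta>2 > 0" "cohomologous_on c \<delta>2 C (\<lambda>z. g j (H (z, 1))) (\<lambda>z. g j (snd z))"
    using ends[OF continuous_on_snd[OF continuous_on_id] proj(2) _ near(2)] by auto
  have "continuous_on (C \<times> {0..1}) (\<lambda>z. g j (H z))"
    using H by (intro continuous_on_compose2[OF g(1)]) (auto simp: almost_joined_def)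
  from cohomologous_on_homotopy[OF c C(1) this]
  obtain \<delta>3 where 3: "\<delta>3 > 0" "cohomologous_on c \<delta>3 C (\<lambda>z. g j (H (z, 0))) (\<lambda>z. g j (H (z, 1)))"
    using g(2) HX by force
  define \<delta> where "\<delta> = min \<delta>1 (min \<delta>2 \<delta>3)"
  have "cohomologous_on c \<delta> C (\<lambda>z. g j (fst z)) (\<lambda>z. g j (H (z, 0)))"
    using 1(2) by (rule cohomologous_on_mono) (simp add: \<delta>_def)
  moreover have "cohomologous_on c \<delta> C (\<lambda>z. g j (H (z, 0))) (\<lambda>z. g j (H (z, 1)))"
    using 3(2) by (rule cohomologous_on_mono) (simp add: \<delta>_def)
  moreover have "cohomologous_on c \<delta> C (\<lambda>z. g j (H (z, 1))) (\<lambda>z. g j (snd z))"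
    using 2(2) by (rule cohomologous_on_mono) (simp add: \<delta>_def)
  ultimately have "cohomologous_on c \<delta> C (\<lambda>z. g j (fst z)) (\<lambda>z. g j (snd z))"
    by (meson cohomologous_on_trans)
  moreover have "\<delta> > 0"
    using 1 2 3 by (simp add: \<delta>_def)
  ultimately show ?thesis
    by blast
qed

section \<open>The lower bound\<close>

lemma abs_sin_cos_diff_le: "\<bar>sin a - sin b\<bar> \<le> \<bar>a - b\<bar>" "\<bar>cos a - cos b\<bar> \<le> \<bar>a - b\<bar>" for a b :: real
proof -
  have "\<bar>2 * sin ((a - b) / 2) * cos ((a + b) / 2)\<bar> \<le> 2 * \<bar>(a - b) / 2\<bar> * 1"
    unfolding abs_mult by (intro mult_mono abs_sin_x_le_abs_x) auto
  then show "\<bar>sin a - sin b\<bar> \<le> \<bar>a - b\<bar>"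
    by (simp add: sin_diff_sin)
  have "\<bar>2 * sin ((a + b) / 2) * sin ((b - a) / 2)\<bar> \<le> 2 * 1 * \<bar>(b - a) / 2\<bar>"
    unfolding abs_mult by (intro mult_mono abs_sin_x_le_abs_x) auto
  then show "\<bar>cos a - cos b\<bar> \<le> \<bar>a - b\<bar>"
    by (simp add: cos_diff_cos)
qed

lemma sin_cos_grid_step:
  fixes s L :: nat
  assumes "s < 2 * L"
  shows "sin (pi * (Suc s mod (2 * L)) / L) = sin (pi * Suc s / L)"
    "cos (pi * (Suc s mod (2 * L)) / L) = cos (pi * Suc s / L)"
proof -
  have "sin (pi * (Suc s mod (2 * L)) / L) = sin (pi * Suc s / L) \<and>
      cos (pi * (Suc s mod (2 * L)) / L) = cos (pi * Suc s / L)"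
  proof (cases "Suc s = 2 * L")
    case True
    moreover have "L > 0"
      using assms by (cases L) auto
    ultimately show ?thesis
      by (simp only: True) simp
  next
    case False
    with assms show ?thesis
      by simp
  qed
  then show "sin (pi * (Suc s mod (2 * L)) / L) = sin (pi * Suc s / L)"
    "cos (pi * (Suc s mod (2 * L)) / L) = cos (pi * Suc s / L)"
    by blast+
qed

lemma dist_torus_map_le:
  "dist (torus_map a b) (torus_map c d) \<le> 2 * \<bar>a - c\<bar> + 2 * \<bar>b - d\<bar>"
proof -
  let ?v = "torus_map a b - torus_map c d"
  have "norm ?v \<le> (\<Sum>i\<in>UNIV. \<bar>?v $ i\<bar>)"
    by (rule norm_le_l1_cart)
  also have "\<dots> = \<bar>sin a - sin c\<bar> + \<bar>sin b - sin d\<bar> + \<bar>(cos a - cos c) + (cos b - cos d)\<bar>"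
    by (simp add: sum_3 algebra_simps)
  also have "\<dots> \<le> \<bar>sin a - sin c\<bar> + \<bar>sin b - sin d\<bar> + (\<bar>cos a - cos c\<bar> + \<bar>cos b - cos d\<bar>)"
    by (intro add_left_mono abs_triangle_ineq)
  also have "\<dots> \<le> 2 * \<bar>a - c\<bar> + 2 * \<bar>b - d\<bar>"
    using abs_sin_cos_diff_le[of a c] abs_sin_cos_diff_le[of b d] by linarith
  finally show ?thesis
    by (simp add: dist_norm)
qed

lemma dist_grid_map_pair_step:
  assumes "p \<in> {..<2 * L} \<times> {..<2 * L}"
  shows "dist (grid_map L p) (grid_map L (pair_step (2 * L) c p)) \<le> 2 * pi / L"
proof -
  obtain s t where p: "p = (s, t)" "s < 2 * L" "t < 2 * L"
    using assms by auto
  have L: "L > 0"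
    using p by (cases L) auto
  have d: "\<bar>pi * real u / L - pi * real (Suc u) / L\<bar> = pi / L" for u
    using L by (simp add: field_simps)
  show ?thesis
  proof (cases "even c")
    case True
    then have "grid_map L (pair_step (2 * L) c p) = torus_map (pi * Suc s / L) (pi * t / L)"
      using sin_cos_grid_step[OF p(2)] by (simp add: grid_map_def pair_step_def p(1) torus_map_def)
    then show ?thesis
      using dist_torus_map_le[of "pi * s / L" "pi * t / L" "pi * Suc s / L" "pi * t / L"] d[of s]
      by (simp add: grid_map_def p(1))
  next
    case False
    then have "grid_map L (pair_step (2 * L) c p) = torus_map (pi * s / L) (pi * Suc t / L)"
      using sin_cos_grid_step[OF p(3)] by (simp add: grid_map_def pair_step_def p(1) torus_map_def)
    then show ?thesis
      using dist_torus_map_le[of "pi * s / L" "pi * t / L" "pi * s / L" "pi * Suc t / L"] d[of t]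
      by (simp add: grid_map_def p(1))
  qed
qed

lemma norm_vec_le_sum: "norm (x :: 'a::real_normed_vector ^ 'n) \<le> (\<Sum>i\<in>UNIV. norm (x $ i))"
  unfolding norm_vec_def by (rule L2_set_le_sum) simp

text \<open>One point rests at the origin, the other ones orbit around it at distances of different
  magnitude; the directions in which they are seen from the origin are arbitrary.\<close>

locale orbits =
  fixes e :: "nat \<Rightarrow> 'n::finite" and i0 :: 'n and m :: nat
  assumes e: "bij_betw e {..<m} (UNIV - {i0})"
begin

definition idx :: "'n \<Rightarrow> nat" where
  "idx = inv_into {..<m} e"

text \<open>The vectors of \<open>torus_map\<close> have norms between 1 and 3. Powers of 4 thus
  keep the ranges from \<open>rad i\<close> to \<open>3 * rad i\<close> disjoint, so the points
  never collide and normalisation can wait until directions are taken.\<close>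

definition rad :: "'n \<Rightarrow> real" where
  "rad i = (if i = i0 then 0 else 4 ^ idx i)"

definition direction :: "nat \<Rightarrow> (real ^ 3) ^ 'n \<Rightarrow> real ^ 3" where
  "direction j x = sgn (x $ e j - x $ i0)"

definition shell :: "((real ^ 3) ^ 'n) set" where
  "shell = {a. \<forall>i. norm (a $ i) \<in> {rad i..3 * rad i}}"

text \<open>The number r selects the copy: even factors of the torus form the first configuration,
  odd ones the second. At \<open>i0\<close> the value of \<open>idx\<close> is arbitrary, but the
  radius 0 removes it.\<close>

definition place :: "nat \<Rightarrow> (nat \<Rightarrow> nat \<times> nat) \<Rightarrow> nat \<Rightarrow> (real ^ 3) ^ 'n" where
  "place L x r = (\<chi> i. rad i *\<^sub>R grid_map L (x (2 * idx i + r)))"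

lemma e_neq: "j < m \<Longrightarrow> e j \<noteq> i0"
  using bij_betwE[OF e] by auto

lemma idx_e: "j < m \<Longrightarrow> idx (e j) = j"
  unfolding idx_def using e by (intro inv_into_f_f) (auto simp: bij_betw_def)

lemma idx_less: "i \<noteq> i0 \<Longrightarrow> idx i < m"
  unfolding idx_def using inv_into_into[of i e "{..<m}"] e by (auto simp: bij_betw_def)

lemma idx_inj: "i \<noteq> i0 \<Longrightarrow> k \<noteq> i0 \<Longrightarrow> idx i = idx k \<Longrightarrow> i = k"
  unfolding idx_def by (rule inv_into_injective[where f = e and A = "{..<m}"])
    (use e in \<open>auto simp: bij_betw_def\<close>)

lemma rad_nonneg: "0 \<le> rad i"
  by (simp add: rad_def)

lemma rad_gap:
  assumes "k \<noteq> i0" "i = i0 \<or> idx i < idx k"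
  shows "3 * rad i < rad k"
proof (cases "i = i0")
  case False
  with assms have "Suc (idx i) \<le> idx k"
    by simp
  then have "(4 :: real) ^ Suc (idx i) \<le> 4 ^ idx k"
    by (intro power_increasing) auto
  moreover have "(0 :: real) < 4 ^ idx i"
    by simp
  ultimately have "3 * 4 ^ idx i < (4 :: real) ^ idx k"
    unfolding power_Suc by linarith
  then show ?thesis
    using assms False by (simp add: rad_def)
qed (use assms in \<open>simp add: rad_def\<close>)

lemma shell_subset: "shell \<subseteq> configuration_space"
proof
  fix a assume a: "a \<in> shell"
  have "i = k" if "a $ i = a $ k" for i k
  proof (rule ccontr)
    assume "i \<noteq> k"
    have n: "rad i \<le> norm (a $ i)" "norm (a $ i) \<le> 3 * rad i" for i
      using a by (auto simp: shell_def)
    have "3 * rad i < rad k \<or> 3 * rad k < rad i"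
      using \<open>i \<noteq> k\<close> idx_inj[of i k] rad_gap[of i k] rad_gap[of k i] by (metis linorder_neqE_nat)
    then show False
      using n[of i] n[of k] that by auto
  qed
  then show "a \<in> configuration_space"
    by (auto simp: configuration_space_def)
qed

lemma compact_shell: "compact shell"
  unfolding compact_eq_bounded_closed
proof
  show "bounded shell"
    unfolding bounded_iff
  proof (intro exI ballI)
    fix a assume a: "a \<in> shell"
    have "norm a \<le> (\<Sum>i\<in>UNIV. norm (a $ i))"
      by (rule norm_vec_le_sum)
    also have "\<dots> \<le> (\<Sum>i\<in>UNIV. 3 * rad i)"
      using a by (intro sum_mono) (auto simp: shell_def)
    finally show "norm a \<le> (\<Sum>i\<in>UNIV. 3 * rad i)" .
  qed
  have "shell = (\<Inter>i. {a. rad i \<le> norm (a $ i)} \<inter> {a. norm (a $ i) \<le> 3 * rad i})"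
    by (auto simp: shell_def)
  then show "closed shell"
    by (auto intro!: closed_INT closed_Int closed_Collect_le continuous_intros)
qed

lemma continuous_on_direction: "j < m \<Longrightarrow> continuous_on configuration_space (direction j)"
  unfolding direction_def using e_neq[of j]
  by (intro continuous_intros) (auto simp: configuration_space_def)

lemma norm_direction: "j < m \<Longrightarrow> x \<in> configuration_space \<Longrightarrow> norm (direction j x) = 1"
  using e_neq[of j] by (auto simp: direction_def norm_sgn configuration_space_def)

lemma place_in_shell: "place L x r \<in> shell"
proof -
  have "norm (place L x r $ i) \<in> {rad i..3 * rad i}" for i
  proof -
    define v where "v = grid_map L (x (2 * idx i + r))"
    have "norm (place L x r $ i) = rad i * norm v"
      by (simp add: place_def v_def rad_nonneg)
    moreover have "1 \<le> norm v" "norm v \<le> 3"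
      using norm_torus_map by (auto simp: v_def grid_map_def)
    ultimately show ?thesis
      using mult_left_mono[of 1 "norm v" "rad i"] mult_left_mono[of "norm v" 3 "rad i"] rad_nonneg[of i]
      by (simp add: mult.commute)
  qed
  then show ?thesis
    by (simp add: shell_def)
qed

lemma direction_place: "j < m \<Longrightarrow> direction j (place L x r) = sgn (grid_map L (x (2 * j + r)))"
  using e_neq[of j] by (simp add: direction_def place_def idx_e rad_def sgn_scaleR)

lemma dist_place_step:
  assumes x: "x \<in> grid (2 * m) (2 * L)" and r: "r < 2"
  shows "dist (place L x r) (place L (step (2 * L) c x) r) \<le> (\<Sum>i\<in>UNIV. rad i) * (2 * pi / L)"
proof -
  let ?y = "step (2 * L) c x"
  have "dist (place L x r) (place L ?y r) \<le>
      (\<Sum>i\<in>UNIV. norm ((place L x r - place L ?y r) $ i))"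
    unfolding dist_norm by (rule norm_vec_le_sum)
  also have "\<dots> \<le> (\<Sum>i\<in>UNIV. rad i * (2 * pi / L))"
  proof (rule sum_mono)
    fix i
    show "norm ((place L x r - place L ?y r) $ i) \<le> rad i * (2 * pi / L)"
    proof (cases "i = i0")
      case False
      let ?f = "2 * idx i + r"
      have "?f < 2 * m"
        using idx_less[OF False] r by simp
      then have xf: "x ?f \<in> {..<2 * L} \<times> {..<2 * L}"
        using x PiE_mem[of x "{..<2 * m}" _ ?f] by (simp add: grid_def)
      have "dist (grid_map L (x ?f)) (grid_map L (?y ?f)) \<le> 2 * pi / L"
        using dist_grid_map_pair_step[OF xf] by (auto simp: step_def)
      then have "rad i * dist (grid_map L (x ?f)) (grid_map L (?y ?f)) \<le> rad i * (2 * pi / L)"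
        by (rule mult_left_mono) (rule rad_nonneg)
      moreover have "norm ((place L x r - place L ?y r) $ i) =
          rad i * dist (grid_map L (x ?f)) (grid_map L (?y ?f))"
        by (simp add: place_def dist_norm rad_nonneg flip: scaleR_diff_right)
      ultimately show ?thesis
        by simp
    qed (simp add: place_def rad_def)
  qed
  also have "\<dots> = (\<Sum>i\<in>UNIV. rad i) * (2 * pi / L)"
    by (rule sum_distrib_right [symmetric])
  finally show ?thesis .
qed

lemma dist_walk:
  fixes \<Gamma> :: "(nat \<Rightarrow> nat \<times> nat) \<Rightarrow> 'z::metric_space"
  assumes \<Gamma>: "\<And>x c. x \<in> grid (2 * m) (2 * L) \<Longrightarrow> dist (\<Gamma> x) (\<Gamma> (step (2 * L) c x)) \<le> \<eta>"
    and x: "x \<in> grid (2 * m) (2 * L)" and \<pi>: "\<pi> permutes {..<4 * m}" and kl: "k \<le> l" "l \<le> 4 * m"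
  shows "dist (\<Gamma> (walk (step (2 * L)) \<pi> x k)) (\<Gamma> (walk (step (2 * L)) \<pi> x l)) \<le> real (l - k) * \<eta>"
  using kl
proof (induction l rule: dec_induct)
  case (step l)
  have \<pi>': "\<pi> permutes {..<2 * (2 * m)}"
    using \<pi> by simp
  have "walk (step (2 * L)) \<pi> x l \<in> grid (2 * m) (2 * L)"
    using torus_grid.walk_in[OF torus_grid_grid \<pi>' x, of l] step by simp
  from \<Gamma>[OF this, of "\<pi> l"]
  have "dist (\<Gamma> (walk (step (2 * L)) \<pi> x l)) (\<Gamma> (walk (step (2 * L)) \<pi> x (Suc l))) \<le> \<eta>"
    by simp
  moreover have "dist (\<Gamma> (walk (step (2 * L)) \<pi> x k)) (\<Gamma> (walk (step (2 * L)) \<pi> x (Suc l))) \<le>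
     dist (\<Gamma> (walk (step (2 * L)) \<pi> x k)) (\<Gamma> (walk (step (2 * L)) \<pi> x l)) +
     dist (\<Gamma> (walk (step (2 * L)) \<pi> x l)) (\<Gamma> (walk (step (2 * L)) \<pi> x (Suc l)))"
    by (rule dist_triangle)
  moreover have "real (Suc l - k) * \<eta> = real (l - k) * \<eta> + \<eta>"
    using step by (simp add: Suc_diff_le algebra_simps)
  ultimately show ?case
    using step by simp
qed simp

definition planet :: "nat \<Rightarrow> ((real ^ 3) ^ 'n) \<times> ((real ^ 3) ^ 'n) \<Rightarrow> real ^ 3" where
  "planet f z = direction (f div 2) (if even f then fst z else snd z)"

lemma continuous_on_planet: "f < 2 * m \<Longrightarrow> continuous_on (configuration_space \<times> configuration_space) (planet f)"
proof -
  assume "f < 2 * m"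
  then have c: "continuous_on configuration_space (direction (f div 2))"
    by (intro continuous_on_direction) (simp add: less_mult_imp_div_less mult.commute)
  show ?thesis
  proof (cases "even f")
    case True
    then show ?thesis
      unfolding planet_def by (auto intro!: continuous_on_compose2[OF c] continuous_intros)
  next
    case False
    then show ?thesis
      unfolding planet_def by (auto intro!: continuous_on_compose2[OF c] continuous_intros)
  qed
qed

lemma norm_planet:
  assumes "f < 2 * m" "z \<in> configuration_space \<times> configuration_space"
  shows "norm (planet f z) = 1"
proof -
  have "f div 2 < m"
    using assms(1) by (simp add: less_mult_imp_div_less mult.commute)
  then show ?thesis
    using assms(2) by (auto simp: planet_def norm_direction)
qed

lemma order_of_instability_lower_bound:
  assumes mp: "motion_planner (configuration_space :: ((real ^ 3) ^ 'n) set) k F s"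
  shows "2 * m + 1 \<le> order_of_instability (configuration_space :: ((real ^ 3) ^ 'n) set) k F"
proof (rule ccontr)
  let ?X = "configuration_space :: ((real ^ 3) ^ 'n) set"
  assume "\<not> 2 * m + 1 \<le> order_of_instability ?X k F"
  then have ord: "order_of_instability ?X k F \<le> 2 * m"
    by simp
  \<comment> \<open>The image of the torus lies in this compact set, which supplies all uniform
    constants, while the homotopies may run through the whole configuration space.\<close>
  define Z where "Z = shell \<times> shell"
  have Z: "compact Z" "Z \<subseteq> ?X \<times> ?X"
    using compact_shell shell_subset by (auto simp: Z_def intro: compact_Times)
  obtain C H \<delta>0 where \<delta>0: "\<delta>0 > 0"
    and C: "\<forall>d<2 * m. compact (C d) \<and> C d \<subseteq> Z \<and> almost_joined ?X direction {..<m} (1 / 16) (C d) (H d)"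
    and cov: "\<forall>S. S \<subseteq> Z \<and> S \<noteq> {} \<and> (\<forall>x\<in>S. \<forall>y\<in>S. dist x y < \<delta>0) \<longrightarrow> (\<exists>d<2 * m. S \<subseteq> C d)"
    using motion_planner_cover[OF mp ord Z, of "{..<m}" direction "1 / 16"] continuous_on_direction by auto
  \<comment> \<open>The covering set \<open>C i\<close> serves the direction \<open>i div 2\<close>,
    so each direction is served by two sets; this matches the squares in the product.\<close>
  have "\<forall>i. \<exists>\<delta>. i < 2 * m \<longrightarrow> \<delta> > 0 \<and> cohomologous_on (pole_cocycle i) \<delta> (C i)
      (\<lambda>z. direction (i div 2) (fst z)) (\<lambda>z. direction (i div 2) (snd z))"
  proof
    fix i
    have "\<exists>\<delta>>0. cohomologous_on (pole_cocycle i) \<delta> (C i)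
      (\<lambda>z. direction (i div 2) (fst z)) (\<lambda>z. direction (i div 2) (snd z))" if i: "i < 2 * m"
    proof (rule almost_joined_cohomologous[OF cocycle_on_pole_cocycle])
      have "i div 2 < m"
        using i by (simp add: less_mult_imp_div_less mult.commute)
      then show "i div 2 \<in> {..<m}" "continuous_on ?X (direction (i div 2))"
        "\<And>x. x \<in> ?X \<Longrightarrow> norm (direction (i div 2) x) = 1"
        by (simp_all add: continuous_on_direction norm_direction)
      show "compact (C i)" "C i \<subseteq> ?X \<times> ?X" "almost_joined ?X direction {..<m} (1 / 16) (C i) (H i)"
        using C i Z(2) by (blast intro: order_trans)+
    qed
    then show "\<exists>\<delta>. i < 2 * m \<longrightarrow> \<delta> > 0 \<and> cohomologous_on (pole_cocycle i) \<delta> (C i)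
      (\<lambda>z. direction (i div 2) (fst z)) (\<lambda>z. direction (i div 2) (snd z))"
      by blast
  qed
  then obtain \<delta>c where \<delta>c: "\<forall>i. i < 2 * m \<longrightarrow> \<delta>c i > 0 \<and> cohomologous_on (pole_cocycle i) (\<delta>c i) (C i)
      (\<lambda>z. direction (i div 2) (fst z)) (\<lambda>z. direction (i div 2) (snd z))"
    by (elim choice [THEN exE])
  have "\<forall>f. \<exists>\<delta>. f < 2 * m \<longrightarrow> \<delta> > 0 \<and> (\<forall>x\<in>Z. \<forall>y\<in>Z. dist y x < \<delta> \<longrightarrow> dist (planet f y) (planet f x) < 1 / 4)"
  proof
    fix f
    show "\<exists>\<delta>. f < 2 * m \<longrightarrow> \<delta> > 0 \<and> (\<forall>x\<in>Z. \<forall>y\<in>Z. dist y x < \<delta> \<longrightarrow> dist (planet f y) (planet f x) < 1 / 4)"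
    proof (cases "f < 2 * m")
      case True
      have "uniformly_continuous_on Z (planet f)"
        using Z continuous_on_subset[OF continuous_on_planet[OF True] Z(2)]
        by (intro compact_uniformly_continuous)
      then have "\<exists>\<delta>>0. \<forall>x\<in>Z. \<forall>y\<in>Z. dist y x < \<delta> \<longrightarrow> dist (planet f y) (planet f x) < 1 / 4"
        unfolding uniformly_continuous_on_def by (rule allE[where x = "1 / 4"]) simp
      then show ?thesis
        by blast
    qed simp
  qed
  then obtain \<delta>u where \<delta>u: "\<forall>f. f < 2 * m \<longrightarrow> \<delta>u f > 0 \<and>
      (\<forall>x\<in>Z. \<forall>y\<in>Z. dist y x < \<delta>u f \<longrightarrow> dist (planet f y) (planet f x) < 1 / 4)"
    by (elim choice [THEN exE])
  \<comment> \<open>Three kinds of scales are combined: the Lebesgue number of the cover, the scales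
    of the primitives, and those on which directions vary by less than 1/4.\<close>
  define \<Delta> where "\<Delta> = insert \<delta>0 (\<delta>c ` {..<2 * m} \<union> \<delta>u ` {..<2 * m})"
  define \<delta> where "\<delta> = Min \<Delta>"
  have fin: "finite \<Delta>" "\<Delta> \<noteq> {}"
    by (auto simp: \<Delta>_def)
  have "\<forall>d\<in>\<Delta>. d > 0"
    using \<delta>0 \<delta>c \<delta>u by (auto simp: \<Delta>_def)
  then have \<delta>: "\<delta> > 0"
    unfolding \<delta>_def using fin by (subst Min_gr_iff) auto
  have \<delta>_le: "\<delta> \<le> d" if "d \<in> \<Delta>" for d
    unfolding \<delta>_def using fin(1) that by (rule Min_le)
  define sm where "sm S \<longleftrightarrow> S \<subseteq> Z \<and> (\<forall>x\<in>S. \<forall>y\<in>S. dist x y < \<delta>)" for S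
  define R where "R = (\<Sum>i\<in>UNIV. rad i)"
  have R: "R \<ge> 0"
    unfolding R_def by (intro sum_nonneg rad_nonneg)
  \<comment> \<open>A walk has 4m steps, each moving either configuration by at most R * 2 pi / L;
    the bound keeps all vertices of a simplex within \<delta>. Adding 2 afterwards ensures L \<ge>
    2, as the degree computation requires.\<close>
  obtain L0 :: nat where L0: "4 * m * (2 * (R * (2 * pi))) / \<delta> < L0"
    using reals_Archimedean2 by blast
  define L where "L = L0 + 2"
  define \<eta> where "\<eta> = 2 * (R * (2 * pi / L))"
  have "4 * m * (2 * (R * (2 * pi))) / \<delta> < L" and Lpos: "0 < real L"
    using L0 by (auto simp: L_def)
  then have \<eta>: "4 * m * \<eta> < \<delta>"
    using \<delta> by (simp add: \<eta>_def field_simps)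
  have \<eta>0: "\<eta> \<ge> 0"
    using R Lpos by (simp add: \<eta>_def)
  define \<Gamma> where "\<Gamma> x = (place L x 0, place L x 1)" for x
  have step: "dist (\<Gamma> x) (\<Gamma> (step (2 * L) c x)) \<le> \<eta>" if x: "x \<in> grid (2 * m) (2 * L)" for x c
  proof -
    have "dist (place L x r) (place L (step (2 * L) c x) r) \<le> R * (2 * pi / L)" if "r < 2" for r
      unfolding R_def by (rule dist_place_step[OF x that])
    from this[of 0] this[of 1] have "dist (place L x 0) (place L (step (2 * L) c x) 0) +
        dist (place L x 1) (place L (step (2 * L) c x) 1) \<le> \<eta>"
      by (simp add: \<eta>_def)
    moreover
    have "dist (\<Gamma> x) (\<Gamma> (step (2 * L) c x)) \<le>
        dist (place L x 0) (place L (step (2 * L) c x) 0) + dist (place L x 1) (place L (step (2 * L) c x) 1)"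
      unfolding \<Gamma>_def dist_Pair_Pair by (rule sqrt_sum_squares_le_sum) auto
    ultimately show ?thesis
      by linarith
  qed
  have "\<forall>i. \<exists>b. i < 2 * m \<longrightarrow> (\<forall>x\<in>C i. \<forall>y\<in>C i. \<forall>z\<in>C i. dist x y < \<delta>c i \<and> dist x z < \<delta>c i \<and> dist y z < \<delta>c i \<longrightarrow>
        pole_cocycle i (direction (i div 2) (fst x)) (direction (i div 2) (fst y)) (direction (i div 2) (fst z)) -
        pole_cocycle i (direction (i div 2) (snd x)) (direction (i div 2) (snd y)) (direction (i div 2) (snd z)) =
        bd1 b x y z)"
    using \<delta>c unfolding cohomologous_on_def by blast
  then obtain b where b: "\<forall>i. i < 2 * m \<longrightarrow> (\<forall>x\<in>C i. \<forall>y\<in>C i. \<forall>z\<in>C i. dist x y < \<delta>c i \<and> dist x z < \<delta>c i \<and> dist y z < \<delta>c i \<longrightarrow>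
        pole_cocycle i (direction (i div 2) (fst x)) (direction (i div 2) (fst y)) (direction (i div 2) (fst z)) -
        pole_cocycle i (direction (i div 2) (snd x)) (direction (i div 2) (snd y)) (direction (i div 2) (snd z)) =
        bd1 (b i) x y z)"
    by (elim choice [THEN exE])
  show False
  proof (rule no_cohomological_cover[where sm = sm and U = planet and m = m and L = L and \<Gamma> = \<Gamma> and C = C and b = b])
    show "2 \<le> L"
      by (simp add: L_def)
    show "sm B" if "sm A" "B \<subseteq> A" for A B
      using that unfolding sm_def by blast
    show "sm ((\<Gamma> \<circ> walk (step (2 * L)) \<pi> x) ` {..4 * m})"
      if x: "x \<in> grid (2 * m) (2 * L)" and \<pi>: "\<pi> permutes {..<4 * m}" for x \<pi>
    proof -
      let ?w = "\<lambda>k. \<Gamma> (walk (step (2 * L)) \<pi> x k)"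
      have le: "dist (?w k) (?w l) < \<delta>" if "k \<le> l" "l \<le> 4 * m" for k l
      proof -
        have "dist (?w k) (?w l) \<le> real (l - k) * \<eta>"
          by (rule dist_walk[OF step x \<pi> that])
        also have "\<dots> \<le> real (4 * m) * \<eta>"
          using that \<eta>0 by (intro mult_right_mono) auto
        finally show ?thesis
          using \<eta> by simp
      qed
      have "dist (?w k) (?w l) < \<delta>" if "k \<le> 4 * m" "l \<le> 4 * m" for k l
        using le[of k l] le[of l k] that by (metis dist_commute nle_le)
      moreover have "?w k \<in> Z" for k
        by (simp add: \<Gamma>_def Z_def place_in_shell)
      ultimately show ?thesis
        unfolding sm_def by (auto simp del: walk.simps)
    qed
    show "planet f (\<Gamma> x) = sgn (grid_map L (x f))" if "f < 2 * m" for x f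
    proof -
      have j: "f div 2 < m"
        using that by (simp add: less_mult_imp_div_less mult.commute)
      show ?thesis
      proof (cases "even f")
        case True
        then show ?thesis
          using direction_place[OF j, of L x 0] by (simp add: planet_def \<Gamma>_def)
      next
        case False
        then have "2 * (f div 2) + 1 = f"
          by simp
        then show ?thesis
          using direction_place[OF j, of L x 1] False by (simp add: planet_def \<Gamma>_def)
      qed
    qed
    show "clustered (planet f ` S)" if S: "sm S" and f: "f < 2 * m" for S f
    proof -
      have "\<delta> \<le> \<delta>u f"
        using f by (intro \<delta>_le) (auto simp: \<Delta>_def)
      then have "dist (planet f x) (planet f y) < 1 / 4" if "x \<in> S" "y \<in> S" for x y
        using \<delta>u f S that unfolding sm_def by (meson less_le_trans subsetD)
      moreover have "norm (planet f x) = 1" if "x \<in> S" for x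
        using S that Z(2) by (intro norm_planet f) (auto simp: sm_def)
      ultimately show ?thesis
        by (auto simp: clustered_def)
    qed
    show "\<exists>i<2 * m. S \<subseteq> C i" if "sm S" "S \<noteq> {}" for S
    proof -
      have "\<delta> \<le> \<delta>0"
        by (intro \<delta>_le) (simp add: \<Delta>_def)
      then have "\<forall>x\<in>S. \<forall>y\<in>S. dist x y < \<delta>0"
        using that(1) unfolding sm_def by (meson less_le_trans)
      then show ?thesis
        using cov that by (simp add: sm_def)
    qed
    show "pole_cocycle i (planet (2 * (i div 2)) x) (planet (2 * (i div 2)) y) (planet (2 * (i div 2)) z) -
        pole_cocycle i (planet (2 * (i div 2) + 1) x) (planet (2 * (i div 2) + 1) y) (planet (2 * (i div 2) + 1) z) =
        bd1 (b i) x y z" if i: "i < 2 * m" and S: "sm {x, y, z}" and xyz: "{x, y, z} \<subseteq> C i" for i x y z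
    proof -
      have "\<delta> \<le> \<delta>c i"
        using i by (intro \<delta>_le) (auto simp: \<Delta>_def)
      moreover have "dist x y < \<delta>" "dist x z < \<delta>" "dist y z < \<delta>"
        using S by (auto simp: sm_def)
      ultimately have "dist x y < \<delta>c i \<and> dist x z < \<delta>c i \<and> dist y z < \<delta>c i"
        by linarith
      moreover have "x \<in> C i" "y \<in> C i" "z \<in> C i"
        using xyz by auto
      ultimately show ?thesis
        using b i by (simp add: planet_def)
    qed
  qed
qed

end

section \<open>An optimal motion planner\<close>

lemma ENR_Times:
  fixes S :: "'a::euclidean_space set" and T :: "'b::euclidean_space set"
  assumes "ENR S" "ENR T"
  shows "ENR (S \<times> T)"
proof -
  obtain U V where "open U" "S retract_of U" "open V" "T retract_of V"
    using assms by (auto simp: ENR_def)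
  then show ?thesis
    unfolding ENR_def by (intro exI[of _ "U \<times> V"]) (simp add: open_Times retract_of_Times)
qed

lemma ENR_finite_disjoint_Union:
  fixes \<S> :: "'a::euclidean_space set set"
  assumes "finite \<S>" "disjoint \<S>" and S: "\<And>S. S \<in> \<S> \<Longrightarrow> ENR S"
    and clo: "\<And>S. S \<in> \<S> \<Longrightarrow> closedin (top_of_set (\<Union>\<S>)) S"
  shows "ENR (\<Union>\<S>)"
proof -
  have "\<T> \<subseteq> \<S> \<longrightarrow> ENR (\<Union>\<T>)" if "finite \<T>" for \<T>
    using that
  proof (induction \<T>)
    case (insert T \<T>)
    show ?case
    proof
      assume sub: "insert T \<T> \<subseteq> \<S>"
      have 1: "closedin (top_of_set (T \<union> \<Union>\<T>)) T"
        using sub by (intro closedin_subset_trans[OF clo]) auto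
      have "closedin (top_of_set (\<Union>\<S>)) (\<Union>\<T>)"
        using sub insert.hyps clo by (intro closedin_Union) auto
      then have 2: "closedin (top_of_set (T \<union> \<Union>\<T>)) (\<Union>\<T>)"
        by (rule closedin_subset_trans) (use sub in auto)
      have "T \<inter> \<Union>\<T> = {}"
      proof -
        have "T \<inter> B = {}" if "B \<in> \<T>" for B
          using that sub insert.hyps by (intro disjointD[OF \<open>disjoint \<S>\<close>]) auto
        then show ?thesis
          by blast
      qed
      then have "ENR (T \<inter> \<Union>\<T>)"
        by simp
      then show "ENR (\<Union>(insert T \<T>))"
        using ENR_closedin_Un_local[OF _ _ _ 1 2] S sub insert.IH by simp
    qed
  qed simp
  then show ?thesis
    using assms(1) by blast
qed

section \<open>Strata of configurations with a given order of heights\<close>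

definition height_order :: "(real ^ 3) ^ 'n \<Rightarrow> ('n \<times> 'n) set" where
  "height_order x = {(i, j). x $ i $ 1 \<le> x $ j $ 1}"

definition num_heights :: "(real ^ 3) ^ 'n \<Rightarrow> nat" where
  "num_heights x = card (range (\<lambda>i. x $ i $ 1))"

text \<open>Ties of y are ties of x, so heights of y map onto heights of x. If the counts agree,
  this surjection is injective and no tie of x has been broken.\<close>

lemma height_order_refines:
  fixes x y :: "(real ^ 3) ^ 'n::finite"
  assumes sub: "height_order y \<subseteq> height_order x"
  shows "num_heights x \<le> num_heights y"
    and "num_heights x = num_heights y \<Longrightarrow> height_order y = height_order x"
proof -
  define \<phi> where "\<phi> u = x $ (SOME i. y $ i $ 1 = u) $ 1" for u
  have \<phi>: "\<phi> (y $ i $ 1) = x $ i $ 1" for i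
  proof -
    let ?i = "SOME k. y $ k $ 1 = y $ i $ 1"
    have "y $ ?i $ 1 = y $ i $ 1"
      by (rule someI[of _ i]) simp
    then have "(?i, i) \<in> height_order y" "(i, ?i) \<in> height_order y"
      by (auto simp: height_order_def)
    then have "(?i, i) \<in> height_order x" "(i, ?i) \<in> height_order x"
      using sub by blast+
    then show ?thesis
      by (auto simp: height_order_def \<phi>_def)
  qed
  then have im: "\<phi> ` range (\<lambda>i. y $ i $ 1) = range (\<lambda>i. x $ i $ 1)"
    by (force simp: image_iff)
  then show "num_heights x \<le> num_heights y"
    unfolding num_heights_def by (metis card_image_le finite finite_imageI)
  assume "num_heights x = num_heights y"
  then have inj_\<phi>: "inj_on \<phi> (range (\<lambda>i. y $ i $ 1))"
    using im by (intro eq_card_imp_inj_on) (auto simp: num_heights_def)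
  then have inj: "y $ i $ 1 = y $ j $ 1" if "x $ i $ 1 = x $ j $ 1" for i j
    using inj_onD[OF inj_\<phi>, of "y $ i $ 1" "y $ j $ 1"] \<phi>[of i] \<phi>[of j] that by auto
  have "height_order x \<subseteq> height_order y"
  proof clarify
    fix i j assume "(i, j) \<in> height_order x"
    then have le: "x $ i $ 1 \<le> x $ j $ 1"
      by (simp add: height_order_def)
    show "(i, j) \<in> height_order y"
    proof (cases "x $ i $ 1 = x $ j $ 1")
      case True
      then show ?thesis
        using inj[OF True] by (simp add: height_order_def)
    next
      case False
      then have "(j, i) \<notin> height_order y"
        using le sub by (auto simp: height_order_def)
      then show ?thesis
        by (auto simp: height_order_def)
    qed
  qed
  with sub show "height_order y = height_order x"
    by blast
qed

lemma open_finite_all: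
  fixes P :: "'i \<Rightarrow> 'a::topological_space \<Rightarrow> bool"
  assumes "finite I" "\<And>i. i \<in> I \<Longrightarrow> open {x. P i x}"
  shows "open {x. \<forall>i\<in>I. P i x}"
proof -
  have "{x. \<forall>i\<in>I. P i x} = (\<Inter>i\<in>I. {x. P i x})"
    by auto
  then show ?thesis
    using assms by (auto intro: open_INT)
qed

text \<open>Strict inequalities survive small perturbations, while ties may break. Hence the order
  of a nearby configuration can only be finer.\<close>

lemma open_height_order_refines: "open {y :: (real ^ 3) ^ 'n::finite. height_order y \<subseteq> Q}"
proof -
  have "open {y :: (real ^ 3) ^ 'n. \<forall>ij\<in>- Q. y $ snd ij $ 1 < y $ fst ij $ 1}"
    by (intro open_finite_all open_Collect_less continuous_intros) auto
  moreover have "{y :: (real ^ 3) ^ 'n. height_order y \<subseteq> Q} =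
      {y. \<forall>ij\<in>- Q. y $ snd ij $ 1 < y $ fst ij $ 1}"
  proof (rule Collect_cong)
    fix y :: "(real ^ 3) ^ 'n"
    have "height_order y \<subseteq> Q \<longleftrightarrow> (\<forall>ij\<in>- Q. ij \<notin> height_order y)"
      by blast
    then show "height_order y \<subseteq> Q \<longleftrightarrow> (\<forall>ij\<in>- Q. y $ snd ij $ 1 < y $ fst ij $ 1)"
      by (simp add: height_order_def case_prod_unfold not_le)
  qed
  ultimately show ?thesis
    by simp
qed

lemma open_configuration_space: "open (configuration_space :: ((real ^ 3) ^ 'n::finite) set)"
proof -
  have "open {x :: (real ^ 3) ^ 'n. \<forall>ij\<in>{ij. fst ij \<noteq> snd ij}. x $ fst ij \<noteq> x $ snd ij}"
    by (intro open_finite_all open_Collect_neq continuous_intros) auto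
  moreover have "configuration_space = {x :: (real ^ 3) ^ 'n. \<forall>ij\<in>{ij. fst ij \<noteq> snd ij}. x $ fst ij \<noteq> x $ snd ij}"
    by (auto simp: configuration_space_def)
  ultimately show ?thesis
    by simp
qed

text \<open>The ties prescribed by Q cut out a linear subspace, and the remaining strict
  inequalities and the distinctness of the points are open conditions in it.\<close>

lemma ENR_stratum: "ENR {x \<in> configuration_space :: ((real ^ 3) ^ 'n::finite) set. height_order x = Q}"
proof -
  let ?L = "{x :: (real ^ 3) ^ 'n. \<forall>ij\<in>Q \<inter> Q\<inverse>. x $ fst ij $ 1 = x $ snd ij $ 1}"
  let ?O = "configuration_space \<inter> {x :: (real ^ 3) ^ 'n. height_order x \<subseteq> Q}"
  have "subspace ?L"
    by (auto simp: subspace_def)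
  then have L: "ENR ?L"
    by (intro ENR_convex_closed subspace_imp_convex closed_subspace)
  have LO: "openin (top_of_set ?L) (?L \<inter> ?O)"
    by (intro openin_open_Int open_Int open_configuration_space open_height_order_refines)
  have "?L \<inter> ?O = {x \<in> configuration_space. height_order x = Q}"
  proof (intro equalityI subsetI)
    fix x assume x: "x \<in> ?L \<inter> ?O"
    have "(i, j) \<in> height_order x" if "(i, j) \<in> Q" for i j
    proof (cases "(j, i) \<in> Q")
      case True
      with that have "(i, j) \<in> Q \<inter> Q\<inverse>"
        by auto
      then show ?thesis
        using x by (force simp: height_order_def)
    next
      case False
      then have "(j, i) \<notin> height_order x"
        using x by auto
      then show ?thesis
        by (auto simp: height_order_def)
    qed
    then show "x \<in> {x \<in> configuration_space. height_order x = Q}"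
      using x by auto
  next
    fix x assume "x \<in> {x \<in> configuration_space. height_order x = Q}"
    then show "x \<in> ?L \<inter> ?O"
      by (auto simp: height_order_def)
  qed
  with ENR_openin[OF L LO] show ?thesis
    by simp
qed

text \<open>The total number of heights runs from 2 to 2n; the shift by one turns this into the
  indices 1 to 2n - 1 of a motion planner.\<close>

definition planner_domain :: "nat \<Rightarrow> (((real ^ 3) ^ 'n::finite) \<times> ((real ^ 3) ^ 'n)) set" where
  "planner_domain l = {p \<in> configuration_space \<times> configuration_space.
     num_heights (fst p) + num_heights (snd p) = Suc l}"

text \<open>Near p neither component can have fewer heights. As the total is fixed, neither can have
  more, so neither order is refined properly.\<close>

lemma planner_domain_locally_constant:
  fixes p :: "((real ^ 3) ^ 'n::finite) \<times> ((real ^ 3) ^ 'n)"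
  assumes p: "p \<in> planner_domain l"
  obtains A where "open A" "p \<in> A"
    "\<And>q. q \<in> planner_domain l \<Longrightarrow> q \<in> A \<Longrightarrow>
       height_order (fst q) = height_order (fst p) \<and> height_order (snd q) = height_order (snd p)"
proof -
  define A where "A = {y. height_order y \<subseteq> height_order (fst p)} \<times> {y. height_order y \<subseteq> height_order (snd p)}"
  have "height_order (fst q) = height_order (fst p) \<and> height_order (snd q) = height_order (snd p)"
    if q: "q \<in> planner_domain l" "q \<in> A" for q
  proof -
    have sub: "height_order (fst q) \<subseteq> height_order (fst p)" "height_order (snd q) \<subseteq> height_order (snd p)"
      using q(2) by (auto simp: A_def)
    have "num_heights (fst p) + num_heights (snd p) = num_heights (fst q) + num_heights (snd q)"
      using p q(1) by (simp add: planner_domain_def)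
    then have "num_heights (fst p) = num_heights (fst q)" "num_heights (snd p) = num_heights (snd q)"
      using height_order_refines(1)[OF sub(1)] height_order_refines(1)[OF sub(2)] by linarith+
    then show ?thesis
      using height_order_refines(2)[OF sub(1)] height_order_refines(2)[OF sub(2)] by blast
  qed
  moreover have "open A" "p \<in> A"
    by (auto simp: A_def mem_Times_iff intro!: open_Times open_height_order_refines)
  ultimately show thesis
    using that by blast
qed

lemma num_heights_eq: "height_order x = height_order y \<Longrightarrow> num_heights x = num_heights y"
  for x y :: "(real ^ 3) ^ 'n::finite"
  using height_order_refines(1)[of x y] height_order_refines(1)[of y x] by simp

text \<open>The pieces with constant orders are open in the domain; being finite in number and
  disjoint, they are closed as well, and each is empty or a product of two strata.\<close>

lemma ENR_planner_domain: "ENR (planner_domain l :: (((real ^ 3) ^ 'n::finite) \<times> ((real ^ 3) ^ 'n)) set)"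
proof -
  let ?W = "planner_domain l :: (((real ^ 3) ^ 'n) \<times> ((real ^ 3) ^ 'n)) set"
  define P where "P QQ = {p \<in> ?W. (height_order (fst p), height_order (snd p)) = QQ}" for QQ
  have W: "\<Union>(range P) = ?W"
    by (auto simp: P_def)
  have dis: "disjoint (range P)"
    by (auto simp: disjoint_def P_def)
  have ope: "openin (top_of_set ?W) (P QQ)" for QQ
  proof (subst openin_subopen, intro ballI)
    fix p assume p: "p \<in> P QQ"
    then have "p \<in> ?W"
      by (simp add: P_def)
    from planner_domain_locally_constant[OF this] obtain A where A: "open A" "p \<in> A"
      "\<And>q. q \<in> ?W \<Longrightarrow> q \<in> A \<Longrightarrow>
        height_order (fst q) = height_order (fst p) \<and> height_order (snd q) = height_order (snd p)"
      by blast
    have "?W \<inter> A \<subseteq> P QQ"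
      using A(3) p by (auto simp: P_def)
    then show "\<exists>T. openin (top_of_set ?W) T \<and> p \<in> T \<and> T \<subseteq> P QQ"
      using A p by (intro exI[of _ "?W \<inter> A"]) (auto simp: P_def intro: openin_open_Int)
  qed
  have "ENR (\<Union>(range P))"
  proof (rule ENR_finite_disjoint_Union)
    show "finite (range P)"
      by simp
    show "disjoint (range P)"
      by (rule dis)
    show "ENR S" if inS: "S \<in> range P" for S
    proof (cases "S = {}")
      case False
      obtain Q Q' where S: "S = P (Q, Q')"
        using inS by (metis imageE surj_pair)
      let ?D = "\<lambda>Q. {x \<in> configuration_space :: ((real ^ 3) ^ 'n) set. height_order x = Q}"
      have "S = ?D Q \<times> ?D Q'"
      proof (intro equalityI subsetI)
        fix p assume p: "p \<in> ?D Q \<times> ?D Q'"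
        obtain q where "q \<in> P (Q, Q')"
          using False S by blast
        then have "num_heights (fst p) = num_heights (fst q)" "num_heights (snd p) = num_heights (snd q)"
          using p by (auto intro!: num_heights_eq simp: P_def)
        then show "p \<in> S"
          using p \<open>q \<in> P (Q, Q')\<close> unfolding S by (auto simp: P_def planner_domain_def)
      qed (auto simp: S P_def planner_domain_def)
      then show ?thesis
        using ENR_Times[OF ENR_stratum ENR_stratum] by simp
    qed simp
    show "closedin (top_of_set (\<Union>(range P))) S" if inS: "S \<in> range P" for S
    proof -
      obtain QQ where S: "S = P QQ"
        using inS by blast
      have "?W - P QQ = (\<Union>QQ'\<in>- {QQ}. P QQ')"
        by (auto simp: P_def)
      then have "openin (top_of_set ?W) (?W - P QQ)"
        using ope by (auto intro: openin_Union)
      then show ?thesis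
        unfolding W S by (simp add: closedin_def P_def)
    qed
  qed
  then show ?thesis
    by (simp only: W)
qed

section \<open>Paths through standard configurations\<close>

text \<open>Clamped parameters replace a case distinction on t, so joint continuity in the points
  and the time is immediate.\<close>

definition three_segments :: "'a::real_normed_vector \<Rightarrow> 'a \<Rightarrow> 'a \<Rightarrow> 'a \<Rightarrow> real \<Rightarrow> 'a" where
  "three_segments x z z' y t = x + max 0 (min 1 (3 * t)) *\<^sub>R (z - x) +
     max 0 (min 1 (3 * t - 1)) *\<^sub>R (z' - z) + max 0 (min 1 (3 * t - 2)) *\<^sub>R (y - z')"

lemma three_segments_ends: "three_segments x z z' y 0 = x" "three_segments x z z' y 1 = y"
  by (simp_all add: three_segments_def)

lemma three_segments_mem:
  assumes "closed_segment x z \<subseteq> X" "closed_segment z z' \<subseteq> X" "closed_segment z' y \<subseteq> X" "t \<in> {0..1}"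
  shows "three_segments x z z' y t \<in> X"
proof -
  have seg: "u + c *\<^sub>R (v - u) \<in> closed_segment u v" if "0 \<le> c" "c \<le> 1" for u v :: 'a and c
    using that unfolding closed_segment_def by (auto intro!: exI[of _ c] simp: algebra_simps)
  consider "t \<le> 1 / 3" | "1 / 3 \<le> t" "t \<le> 2 / 3" | "2 / 3 \<le> t"
    by linarith
  then show ?thesis
  proof cases
    case 1
    then have "max 0 (min 1 (3 * t)) = 3 * t" "max 0 (min 1 (3 * t - 1)) = 0" "max 0 (min 1 (3 * t - 2)) = 0"
      using assms(4) by auto
    then have "three_segments x z z' y t = x + (3 * t) *\<^sub>R (z - x)"
      unfolding three_segments_def by (simp only:) simp
    then show ?thesis
      using seg[of "3 * t" x z] 1 assms by auto
  next
    case 2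
    then have "max 0 (min 1 (3 * t)) = 1" "max 0 (min 1 (3 * t - 1)) = 3 * t - 1" "max 0 (min 1 (3 * t - 2)) = 0"
      using assms(4) by auto
    then have "three_segments x z z' y t = z + (3 * t - 1) *\<^sub>R (z' - z)"
      unfolding three_segments_def by (simp only:) simp
    then show ?thesis
      using seg[of "3 * t - 1" z z'] 2 assms by auto
  next
    case 3
    then have "max 0 (min 1 (3 * t)) = 1" "max 0 (min 1 (3 * t - 1)) = 1" "max 0 (min 1 (3 * t - 2)) = 3 * t - 2"
      using assms(4) by auto
    then have "three_segments x z z' y t = z' + (3 * t - 2) *\<^sub>R (y - z')"
      unfolding three_segments_def by (simp only:) simp
    then show ?thesis
      using seg[of "3 * t - 2" z' y] 3 assms by auto
  qed
qed

text \<open>The first coordinates of the target refine the given order of the heights to a linear order;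
  the second ones do not depend on it.\<close>

definition target :: "('n \<Rightarrow> real) \<Rightarrow> ('n \<times> 'n) set \<Rightarrow> (real ^ 3) ^ 'n::finite" where
  "target \<nu> Q = (\<chi> i. vector [real (card {j. (j, i) \<in> Q}) + \<nu> i, \<nu> i, 0])"

lemma target_nth [simp]:
  "target \<nu> Q $ i $ 1 = real (card {j. (j, i) \<in> Q}) + \<nu> i" "target \<nu> Q $ i $ 2 = \<nu> i"
  by (simp_all add: target_def)

locale labelled =
  fixes \<nu> :: "'n::finite \<Rightarrow> real"
  assumes inj: "inj \<nu>" and range: "\<And>i. 0 \<le> \<nu> i \<and> \<nu> i < 1"
begin

text \<open>The second coordinates stay equal to the distinct labels \<nu> along the whole
  segment.\<close>

lemma segment_targets: "closed_segment (target \<nu> Q) (target \<nu> Q') \<subseteq> configuration_space"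
proof
  fix x assume "x \<in> closed_segment (target \<nu> Q) (target \<nu> Q')"
  then obtain u where x: "x = (1 - u) *\<^sub>R target \<nu> Q + u *\<^sub>R target \<nu> Q'"
    by (auto simp: closed_segment_def)
  have "x $ i $ 2 = \<nu> i" for i
    unfolding x by (simp add: algebra_simps)
  then have "x $ i \<noteq> x $ j" if "i \<noteq> j" for i j
    using that inj by (metis injD)
  then show "x \<in> configuration_space"
    by (simp add: configuration_space_def)
qed

text \<open>Points of different heights keep their order, since the counts in the target differ by
  at least 1 and the labels lie in [0, 1). Points of equal height are separated as soon as u > 0,
  the difference of their heights being u times the difference of the labels; at u = 0 the
  configuration is x itself.\<close>

lemma segment_to_target:
  fixes x :: "(real ^ 3) ^ 'n"
  assumes x: "x \<in> configuration_space"
  shows "closed_segment x (target \<nu> (height_order x)) \<subseteq> configuration_space"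
proof
  let ?z = "target \<nu> (height_order x)"
  fix y assume "y \<in> closed_segment x ?z"
  then obtain u where u: "0 \<le> u" "u \<le> 1" and y: "y = (1 - u) *\<^sub>R x + u *\<^sub>R ?z"
    by (auto simp: closed_segment_def)
  have lt: "?z $ i $ 1 < ?z $ j $ 1" if "x $ i $ 1 < x $ j $ 1" for i j
  proof -
    have "{k. (k, i) \<in> height_order x} \<subseteq> {k. (k, j) \<in> height_order x}"
      "j \<in> {k. (k, j) \<in> height_order x}" "j \<notin> {k. (k, i) \<in> height_order x}"
      using that by (auto simp: height_order_def)
    then have "{k. (k, i) \<in> height_order x} \<subset> {k. (k, j) \<in> height_order x}"
      by blast
    then have "card {k. (k, i) \<in> height_order x} < card {k. (k, j) \<in> height_order x}"
      by (intro psubset_card_mono) auto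
    then have "real (card {k. (k, i) \<in> height_order x}) + 1 \<le> real (card {k. (k, j) \<in> height_order x})"
      by linarith
    then show ?thesis
      using range[of i] range[of j] by simp
  qed
  have less: "y $ i $ 1 < y $ j $ 1" if "x $ i $ 1 < x $ j $ 1" for i j
  proof (cases "u = 0")
    case True
    then show ?thesis
      using that y by simp
  next
    case False
    have "(1 - u) * x $ i $ 1 \<le> (1 - u) * x $ j $ 1"
      using that u by (intro mult_left_mono) auto
    moreover have "u * ?z $ i $ 1 < u * ?z $ j $ 1"
      using lt[OF that] u False by (intro mult_strict_left_mono) auto
    ultimately show ?thesis
      unfolding y by (simp del: target_nth)
  qed
  have "y $ i \<noteq> y $ j" if "i \<noteq> j" for i j
  proof (cases "x $ i $ 1 = x $ j $ 1")
    case True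
    show ?thesis
    proof (cases "u = 0")
      case False
      have "{k. (k, i) \<in> height_order x} = {k. (k, j) \<in> height_order x}"
        using True by (auto simp: height_order_def)
      then have "y $ i $ 1 - y $ j $ 1 = u * (\<nu> i - \<nu> j)"
        unfolding y using True by (simp add: algebra_simps)
      moreover have "\<nu> i \<noteq> \<nu> j"
        using inj that by (auto simp: inj_def)
      ultimately have "y $ i $ 1 - y $ j $ 1 \<noteq> 0"
        using False by simp
      then show ?thesis
        by auto
    qed (use x y that in \<open>simp add: configuration_space_def\<close>)
  next
    case False
    then show ?thesis
      using less[of i j] less[of j i] by (auto simp: neq_iff)
  qed
  then show "y \<in> configuration_space"
    by (simp add: configuration_space_def)
qed

definition plan :: "((real ^ 3) ^ 'n) \<times> ((real ^ 3) ^ 'n) \<Rightarrow> real \<Rightarrow> (real ^ 3) ^ 'n" where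
  "plan p = three_segments (fst p) (target \<nu> (height_order (fst p))) (target \<nu> (height_order (snd p))) (snd p)"

lemma continuous_on_locally_constant_order:
  assumes f: "\<And>p q. height_order (fst p) = height_order (fst q) \<Longrightarrow>
      height_order (snd p) = height_order (snd q) \<Longrightarrow> f p = f q"
  shows "continuous_on (planner_domain l) f"
  unfolding continuous_on_topological
proof (intro ballI allI impI)
  fix p B assume p: "p \<in> planner_domain l" and B: "open B" "f p \<in> B"
  from planner_domain_locally_constant[OF p] obtain A where A: "open A" "p \<in> A"
    "\<And>q. q \<in> planner_domain l \<Longrightarrow> q \<in> A \<Longrightarrow>
       height_order (fst q) = height_order (fst p) \<and> height_order (snd q) = height_order (snd p)"
    by blast
  have "f q \<in> B" if "q \<in> planner_domain l" "q \<in> A" for q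
  proof -
    have "f q = f p"
      using A(3)[OF that] by (intro f) auto
    with B show ?thesis
      by simp
  qed
  with A(1,2) show "\<exists>A. open A \<and> p \<in> A \<and> (\<forall>q\<in>planner_domain l. q \<in> A \<longrightarrow> f q \<in> B)"
    by blast
qed

lemma continuous_on_plan: "continuous_on (planner_domain l \<times> {0..1}) (\<lambda>(p, t). plan p t)"
proof -
  have t: "continuous_on (planner_domain l \<times> {0..1::real}) (\<lambda>z. target \<nu> (height_order (fst (fst z))))"
    "continuous_on (planner_domain l \<times> {0..1::real}) (\<lambda>z. target \<nu> (height_order (snd (fst z))))"
    by (rule continuous_on_compose2[OF continuous_on_locally_constant_order[of _ l]];
        auto intro: continuous_on_fst continuous_on_id)+
  show ?thesis
    unfolding plan_def three_segments_def case_prod_unfold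
    by (intro continuous_intros t)
qed

lemma plan_in: "p \<in> configuration_space \<times> configuration_space \<Longrightarrow> t \<in> {0..1} \<Longrightarrow> plan p t \<in> configuration_space"
  unfolding plan_def
  using segment_to_target[of "fst p"] segment_to_target[of "snd p"] segment_targets
  by (intro three_segments_mem) (auto simp: closed_segment_commute)

lemma motion_planner_plan:
  "motion_planner (configuration_space :: ((real ^ 3) ^ 'n) set) (2 * CARD('n) - 1) planner_domain
     (\<lambda>l p. restrict (plan p) {0..1})"
  unfolding motion_planner_def
proof (intro conjI ballI)
  let ?X = "configuration_space :: ((real ^ 3) ^ 'n) set"
  show "disjoint_family_on (planner_domain :: nat \<Rightarrow> (((real ^ 3) ^ 'n) \<times> ((real ^ 3) ^ 'n)) set) {1..2 * CARD('n) - 1}"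
    by (auto simp: disjoint_family_on_def planner_domain_def)
  have h: "1 \<le> num_heights x" "num_heights x \<le> CARD('n)" for x :: "(real ^ 3) ^ 'n"
    unfolding num_heights_def by (auto simp: Suc_le_eq card_gt_0_iff intro: card_image_le)
  show "(\<Union>l\<in>{1..2 * CARD('n) - 1}. planner_domain l) = ?X \<times> ?X"
  proof (intro equalityI subsetI)
    fix p assume p: "p \<in> ?X \<times> ?X"
    define l where "l = num_heights (fst p) + num_heights (snd p) - 1"
    have "l \<in> {1..2 * CARD('n) - 1}" "Suc l = num_heights (fst p) + num_heights (snd p)"
      using h[of "fst p"] h[of "snd p"] by (auto simp: l_def)
    then show "p \<in> (\<Union>l\<in>{1..2 * CARD('n) - 1}. planner_domain l)"
      using p by (intro UN_I[of l]) (auto simp: planner_domain_def)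
  qed (auto simp: planner_domain_def)
  fix l
  show "continuous_map (top_of_set (planner_domain l)) (path_space ?X) (\<lambda>p. restrict (plan p) {0..1})"
    using continuous_on_plan by (rule continuous_map_into_path_space) (auto intro!: plan_in simp: planner_domain_def)
  show "endpoints (restrict (plan p) {0..1}) = p" for p
    by (simp add: endpoints_def pathstart_def pathfinish_def plan_def three_segments_ends)
  show "ENR (planner_domain l :: (((real ^ 3) ^ 'n) \<times> ((real ^ 3) ^ 'n)) set)"
    by (rule ENR_planner_domain)
qed

end

text \<open>There are only k closures to intersect. For the planner with 2n - 1 domains this trivial
  bound already meets the lower bound.\<close>

lemma order_of_instability_le: "order_of_instability X k F \<le> k"
proof -
  let ?A = "{card I | I. I \<subseteq> {1..k} \<and> (\<Inter>i\<in>I. top_of_set (X \<times> X) closure_of F i) \<noteq> {}}"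
  have le: "a \<le> k" if "a \<in> ?A" for a
    using that card_mono[of "{1..k}"] by fastforce
  then have "finite ?A"
    by (meson atMost_iff finite_atMost finite_subset subsetI)
  moreover have "card ({} :: nat set) \<in> ?A"
    by (intro CollectI exI[of _ "{}"]) simp
  ultimately show ?thesis
    unfolding order_of_instability_def using le by (intro Max.boundedI) blast+
qed

theorem theorem2:
  fixes X :: "((real ^ 3) ^ 'n) set"
  defines "X \<equiv> configuration_space"
  shows "(\<forall>k F s. motion_planner X k F s \<longrightarrow> order_of_instability X k F \<ge> 2 * CARD('n) - 1) \<and>
         (\<exists>k F s. motion_planner X k F s \<and> order_of_instability X k F = 2 * CARD('n) - 1)"
proof -
  obtain i0 :: 'n where "i0 \<in> UNIV"
    by blast
  have "card (UNIV - {i0}) = CARD('n) - 1"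
    by simp
  then obtain e where "bij_betw e {..<CARD('n) - 1} (UNIV - {i0})"
    using ex_bij_betw_nat_finite[of "UNIV - {i0}"] by (auto simp: atLeast0LessThan)
  then interpret orbits e i0 "CARD('n) - 1"
    by unfold_locales
  have "CARD('n) \<ge> 1"
    by (simp add: Suc_le_eq)
  then have lower: "2 * CARD('n) - 1 \<le> order_of_instability X k F" if "motion_planner X k F s" for k F s
    using order_of_instability_lower_bound that unfolding X_def by fastforce
  obtain h :: "'n \<Rightarrow> nat" where h: "bij_betw h UNIV {0..<CARD('n)}"
    using ex_bij_betw_finite_nat[of "UNIV :: 'n set"] by auto
  interpret labelled "\<lambda>i. h i / CARD('n)"
  proof
    show "inj (\<lambda>i. real (h i) / real CARD('n))"
      using h by (auto simp: inj_def bij_betw_def)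
    show "0 \<le> real (h i) / real CARD('n) \<and> real (h i) / real CARD('n) < 1" for i
      using bij_betwE[OF h] by auto
  qed
  have "order_of_instability X (2 * CARD('n) - 1) planner_domain = 2 * CARD('n) - 1"
    using lower[OF motion_planner_plan[folded X_def]] order_of_instability_le by (rule order_antisym[rotated])
  then show ?thesis
    using lower motion_planner_plan[folded X_def] by blast
qed

end
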